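(* Let $p>1$ and let $\hat{\pi}=\frac{2\pi}{p\sin(\pi/p)}$. For a real-valued $q\in L^{1}(0,\hat{\pi})$, let $\lambda_1<\lambda_2<\cdots$ denote the eigenvalues of the Dirichlet problem $$(|y'|^{p-2}y')'=-(p-1)(\lambda-q(x))|y|^{p-2}y \ \text{ on } (0,\hat{\pi}),\qquad y(0)=y(\hat{\pi})=0 .$$ If $q$ is single-well with transition point $\frac{\hat{\pi}}{2}$, then $$\lambda_2-\lambda_1\ge 2^{p}-1,$$ and equality holds if and only if $q$ is constant (a.e.). Furthermore, for every $a\in[0,\hat{\pi}]$ with $a\neq\frac{\hat{\pi}}{2}$, there exists a single-well potential $q$ with transition point $a$ such that $\lambda_2-\lambda_1<2^{p}-1$.
   Context: A function $V$ on $[0,\hat{\pi}]$ is called single-well with transition point $a\in[0,\hat{\pi}]$ if $V$ is decreasing (in the weak sense) on $[0,a]$ and increasing (in the weak sense) on $[a,\hat{\pi}]$. An eigenvalue is a real number $\lambda$ for which the boundary value problem has a nontrivial solution $y$ (with $y$ and $|y'|^{p-2}y'$ absolutely continuous and the equation holding a.e.). The eigenvalues form a strictly increasing sequence $\lambda_1<\lambda_2<\cdots$ tending to $\infty$, and an eigenfunction for $\lambda_n$ has exactly $n-1$ zeros in $(0,\hat{\pi})$. *)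

theory Defs
  imports "HOL-Analysis.Analysis"
begin

definition pi_hat :: "real \<Rightarrow> real" where
  "pi_hat p = 2 * pi / (p * sin (pi / p))"

definition single_well :: "real \<Rightarrow> real \<Rightarrow> (real \<Rightarrow> real) \<Rightarrow> bool" where
  "single_well b a V \<longleftrightarrow> a \<in> {0..b} \<and> antimono_on {0..a} V \<and> mono_on {a..b} V"

text \<open>
  The usual epsilon-delta notion; a division \<open>D\<close> of its own union is an arbitrary finite family
  of non-overlapping compact intervals.
\<close>
definition abs_continuous_on :: "real set \<Rightarrow> (real \<Rightarrow> real) \<Rightarrow> bool" where
  "abs_continuous_on S f \<longleftrightarrow>
     (\<forall>\<epsilon>>0. \<exists>\<delta>>0. \<forall>D. D division_of \<Union>D \<and> \<Union>D \<subseteq> S \<and> (\<Sum>k\<in>D. measure lborel k) < \<delta>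
        \<longrightarrow> (\<Sum>k\<in>D. \<bar>f (Sup k) - f (Inf k)\<bar>) < \<epsilon>)"

text \<open>
  \<open>signed_power p s\<close> is $|s|^{p-2}s$, with value \<open>0\<close> at \<open>s = 0\<close> also when \<open>p < 2\<close>.
\<close>
definition signed_power :: "real \<Rightarrow> real \<Rightarrow> real" where
  "signed_power p s = \<bar>s\<bar> powr (p - 2) * s"

text \<open>
  In \<open>dirichlet_solution p b q lam y y'\<close> the function \<open>y'\<close> is the derivative of \<open>y\<close> on \<open>{0..b}\<close>,
  one-sided at the endpoints. Its existence at every point is no restriction: if $|y'|^{p-2}y'$
  agrees a.e. with a continuous function, then so does $y'$, and the absolutely continuous
  \<open>y\<close> is of class $C^1$.
\<close>
definition dirichlet_solution ::
  "real \<Rightarrow> real \<Rightarrow> (real \<Rightarrow> real) \<Rightarrow> real \<Rightarrow> (real \<Rightarrow> real) \<Rightarrow> (real \<Rightarrow> real) \<Rightarrow> bool" where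
  "dirichlet_solution p b q lam y y' \<longleftrightarrow>
     (\<forall>x\<in>{0..b}. (y has_real_derivative y' x) (at x within {0..b})) \<and>
     abs_continuous_on {0..b} y \<and>
     abs_continuous_on {0..b} (\<lambda>x. signed_power p (y' x)) \<and>
     (AE x in lebesgue. x \<in> {0<..<b} \<longrightarrow>
        ((\<lambda>t. signed_power p (y' t)) has_real_derivative
           - (p - 1) * (lam - q x) * signed_power p (y x)) (at x)) \<and>
     y 0 = 0 \<and> y b = 0"

definition dirichlet_eigenvalue :: "real \<Rightarrow> real \<Rightarrow> (real \<Rightarrow> real) \<Rightarrow> real \<Rightarrow> bool" where
  "dirichlet_eigenvalue p b q lam \<longleftrightarrow>
     (\<exists>y y'. dirichlet_solution p b q lam y y' \<and> (\<exists>x\<in>{0..b}. y x \<noteq> 0))"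

text \<open>
  \<open>lam\<close> is the \<open>n\<close>-th eigenvalue, counted from \<open>n = 1\<close>, in the increasing enumeration of the set of
  eigenvalues.
\<close>
definition nth_dirichlet_eigenvalue ::
  "real \<Rightarrow> real \<Rightarrow> (real \<Rightarrow> real) \<Rightarrow> nat \<Rightarrow> real \<Rightarrow> bool" where
  "nth_dirichlet_eigenvalue p b q n lam \<longleftrightarrow>
     dirichlet_eigenvalue p b q lam \<and>
     finite {\<mu>. dirichlet_eigenvalue p b q \<mu> \<and> \<mu> \<le> lam} \<and>
     card {\<mu>. dirichlet_eigenvalue p b q \<mu> \<and> \<mu> \<le> lam} = n"

end

theory Submission
  imports Defs
begin

text \<open>
  Write \<open>y = r S(\<theta>)\<close>, \<open>y' = r S'(\<theta>)\<close> with the generalised sine \<open>S\<close>, whose first zero is \<open>b = pi_hat p\<close>. The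
  angle solves \<open>\<theta>' = 1 + (\<lambda> - q - 1) |S(\<theta>)|^p\<close>, an equation that is Lipschitz in \<open>\<theta>\<close>, and the \<open>n\<close>-th eigenvalue
  is characterised by \<open>\<theta>(b) = n b\<close>.

  The lower bound is a comparison argument. Let \<open>w = |y'|^(p-2) y' / |y|^(p-2) y\<close>, so that
  \<open>w' = -(p-1)(\<lambda> - q + |w|^(p/(p-1)))\<close>. If two potentials have the same \<open>\<lambda>1\<close>, the potentials drop out of the
  difference of the differences of the \<open>w\<close> for \<open>\<lambda>1\<close> and \<open>\<lambda>2\<close>, and convexity of \<open>|w|^(p/(p-1))\<close> shows that
  an ordering of the first solutions on one side of the zero \<open>z\<close> of \<open>y2\<close> carries over to the second ones.
  For \<open>z \<le> b/2\<close> one compares \<open>q\<close> with the potential that is constant on each half of the interval,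
  the left value being chosen such that the first solutions have the same angle at \<open>z\<close> and the right one
  such that \<open>\<lambda>1\<close> is unchanged; monotonicity of \<open>q\<close> on the halves gives the ordering, so the gap does not
  increase. For two-valued potentials the solutions are \<open>S(k x)\<close> and the bound follows from convexity of
  \<open>t^p\<close>. The case \<open>z \<ge> b/2\<close> follows by reflection.

  If \<open>a \<noteq> b/2\<close>, a small step with its jump between \<open>a\<close> and \<open>b/2\<close> lowers the gap to first order.
\<close>

section \<open>Calculus with countable exceptional sets\<close>

text \<open>A single-well function has at most countably many discontinuities. So every equation can
  be read with ordinary derivatives off a countable set; a.e. differentiability enters only when a
  solution in the sense of the definition is converted in
  \<open>dirichlet_solution_imp_hsol\<close>. The obstacle in the comparison is that
  \<open>w\<close> is infinite at both ends of a nodal interval. At scale \<open>1\<close> all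
  angles leave a zero like \<open>x\<close> with an error of order \<open>x powr (p + 1)\<close>, so
  the difference of two \<open>w\<close> tends to \<open>0\<close> there. This supplies the initial
  value of the differential inequality, and at \<open>z\<close> it drives the case of equality. The
  comparison runs from each end of the interval towards \<open>z\<close> separately. If the constant
  value of \<lambda>1 - q - 1 that matches the first angle at \<open>z\<close> is at most
  \<open>0\<close>, the left side alone gives the bound. Otherwise the gain on the left must be paid
  for on the right, and the two sides are joined at \<open>b / 2\<close>. The constant
  \<open>2 powr p - 1\<close> is the gap of the zero potential, whose n-th eigenvalue is
  \<open>n powr p\<close> with eigenfunction \<open>S(n x)\<close>.\<close>

lemma mono_of_pos_deriv_off_countable:
  fixes f :: "real \<Rightarrow> real"
  assumes ab: "a \<le> b" and cont: "continuous_on {a..b} f" and N: "countable N"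
    and der: "\<And>x. x \<in> {a<..<b} - N \<Longrightarrow> \<exists>d>0. (f has_real_derivative d) (at x)"
  shows "f a \<le> f b"
proof (rule ccontr)
  assume "\<not> f a \<le> f b"
  hence lt: "f b < f a" by simp
  have "uncountable {f b<..<f a}" using lt by (simp add: uncountable_open_interval)
  moreover have "countable (f ` N)" using N by simp
  ultimately obtain y where y: "y \<in> {f b<..<f a}" "y \<notin> f ` N"
    by (metis Diff_eq_empty_iff countable_empty uncountable_minus_countable subsetI)
  define A where "A = {a..b} \<inter> f -` {y..}"
  have clA: "closed A" unfolding A_def
    by (rule continuous_closed_preimage[OF cont closed_atLeastAtMost closed_atLeast])
  have "a \<in> A" using y ab by (auto simp: A_def)
  have bdd: "bdd_above A" by (rule bdd_aboveI[of _ b]) (auto simp: A_def)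
  define x0 where "x0 = Sup A"
  have x0A: "x0 \<in> A" unfolding x0_def using closed_contains_Sup[OF _ bdd clA] \<open>a \<in> A\<close> by blast
  have above: "f x < y" if "x0 < x" "x \<le> b" for x
    using cSup_upper[OF _ bdd, of x] that x0A by (auto simp: A_def x0_def not_le[symmetric])
  have x0ab: "a \<le> x0" "x0 \<le> b" "f x0 \<ge> y" using x0A by (auto simp: A_def)
  have "x0 \<noteq> b" using y x0ab by auto
  hence "x0 < b" using x0ab by simp
  have cx0: "isCont f x0 \<or> x0 = a" 
    using cont x0ab \<open>x0 < b\<close> by (metis at_within_Icc_at continuous_on_eq_continuous_within atLeastAtMost_iff order_le_less)
  have fx0: "f x0 = y"
  proof (rule ccontr)
    assume "f x0 \<noteq> y" hence gt: "f x0 > y" using x0ab by simp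
    have "\<exists>x\<ge>x0. x \<le> b \<and> f x = y"
      using IVT2'[of f b y x0] gt y(1) \<open>x0 < b\<close> continuous_on_subset[OF cont, of "{x0..b}"] x0ab
      by auto
    then obtain x where "x \<ge> x0" "x \<le> b" "f x = y" by blast
    with above[of x] gt show False by (cases "x = x0") auto
  qed
  have "x0 \<noteq> a" using fx0 y by auto
  moreover have "x0 \<notin> N" using y(2) fx0 by auto
  ultimately obtain d where d: "d > 0" "(f has_real_derivative d) (at x0)"
    using der[of x0] x0ab \<open>x0 < b\<close> by auto
  obtain e where e: "e > 0" "\<And>h. h > 0 \<Longrightarrow> h < e \<Longrightarrow> f x0 < f (x0 + h)"
    using DERIV_pos_inc_right[OF d(2,1)] by blast
  define h where "h = min (e/2) (b - x0)"
  have "h > 0" "h < e" "x0 + h \<le> b" using e \<open>x0 < b\<close> by (auto simp: h_def min_def)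
  thus False using e(2)[of h] above[of "x0+h"] fx0 by auto
qed

text \<open>Adding a line of small positive slope makes the derivative strictly positive;
  \<open>k\<close> is chosen so that the line rises by at most \<open>e\<close> over the
  interval.\<close>

lemma mono_of_nonneg_deriv_off_countable:
  fixes f :: "real \<Rightarrow> real"
  assumes ab: "a \<le> b" and cont: "continuous_on {a..b} f" and N: "countable N"
    and der: "\<And>x. x \<in> {a<..<b} - N \<Longrightarrow> \<exists>d\<ge>0. (f has_real_derivative d) (at x)"
  shows "f a \<le> f b"
proof (rule field_le_epsilon)
  fix e :: real assume e: "e > 0"
  define k where "k = e / (b - a + 1)"
  have k: "k > 0" using e ab by (simp add: k_def)
  have "f a + k * a \<le> f b + k * b"
  proof (rule mono_of_pos_deriv_off_countable[OF ab _ N])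
    show "continuous_on {a..b} (\<lambda>x. f x + k * x)" by (intro continuous_intros cont)
    fix x assume "x \<in> {a<..<b} - N"
    then obtain d where "d \<ge> 0" "(f has_real_derivative d) (at x)" using der by blast
    thus "\<exists>d>0. ((\<lambda>x. f x + k * x) has_real_derivative d) (at x)"
      using k by (intro exI[of _ "d + k"]) (auto intro!: derivative_eq_intros)
  qed
  hence "f a \<le> f b + k * (b - a)" by (simp add: algebra_simps)
  also have "k * (b - a) \<le> k * (b - a + 1)" using k by simp
  also have "\<dots> = e" using ab by (simp add: k_def)
  finally show "f a \<le> f b + e" by simp
qed

lemma const_of_zero_deriv_off_countable:
  fixes f :: "real \<Rightarrow> real"
  assumes cont: "continuous_on {a..b} f" and N: "countable N"
    and der: "\<And>x. x \<in> {a<..<b} - N \<Longrightarrow> (f has_real_derivative 0) (at x)"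
    and x: "x \<in> {a..b}"
  shows "f x = f a"
proof (rule antisym)
  have c: "continuous_on {a..x} f" using x by (intro continuous_on_subset[OF cont]) auto
  show "f a \<le> f x"
    using x der by (intro mono_of_nonneg_deriv_off_countable[OF _ c N]) force+
  have "- f a \<le> - f x"
  proof (intro mono_of_nonneg_deriv_off_countable[where f="\<lambda>x. - f x", OF _ _ N])
    fix y assume "y \<in> {a<..<x} - N"
    hence "(f has_real_derivative 0) (at y)" using der x by auto
    from DERIV_minus[OF this] show "\<exists>d\<ge>0. ((\<lambda>x. - f x) has_real_derivative d) (at y)" by auto
  qed (use x c in \<open>auto intro: continuous_intros\<close>)
  thus "f x \<le> f a" by simp
qed

lemma lipschitz_of_bounded_deriv_off_countable:
  fixes f :: "real \<Rightarrow> real"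
  assumes cont: "continuous_on {a..b} f" and N: "countable N"
    and der: "\<And>x. x \<in> {a<..<b} - N \<Longrightarrow> \<exists>d. (f has_real_derivative d) (at x) \<and> \<bar>d\<bar> \<le> M"
    and x: "a \<le> x" "x \<le> y" "y \<le> b"
  shows "\<bar>f y - f x\<bar> \<le> M * (y - x)"
proof -
  have c: "continuous_on {x..y} f" using x by (intro continuous_on_subset[OF cont]) auto
  have "M * x - f x \<le> M * y - f y"
  proof (intro mono_of_nonneg_deriv_off_countable[where f="\<lambda>x. M * x - f x", OF _ _ N])
    fix z assume "z \<in> {x<..<y} - N"
    then obtain d where "(f has_real_derivative d) (at z)" "\<bar>d\<bar> \<le> M" using der[of z] x by auto
    thus "\<exists>d\<ge>0. ((\<lambda>x. M * x - f x) has_real_derivative d) (at z)"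
      by (intro exI[of _ "M - d"]) (auto intro!: derivative_eq_intros)
  qed (use x c in \<open>auto intro!: continuous_intros\<close>)
  moreover have "M * x + f x \<le> M * y + f y"
  proof (intro mono_of_nonneg_deriv_off_countable[where f="\<lambda>x. M * x + f x", OF _ _ N])
    fix z assume "z \<in> {x<..<y} - N"
    then obtain d where "(f has_real_derivative d) (at z)" "\<bar>d\<bar> \<le> M" using der[of z] x by auto
    thus "\<exists>d\<ge>0. ((\<lambda>x. M * x + f x) has_real_derivative d) (at z)"
      by (intro exI[of _ "M + d"]) (auto intro!: derivative_eq_intros)
  qed (use x c in \<open>auto intro!: continuous_intros\<close>)
  ultimately show ?thesis by (simp add: algebra_simps abs_le_iff)
qed

text \<open>The integral of the continuous candidate \<open>g\<close> is differentiable everywhere,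
  and \<open>f\<close> differs from it by a function with zero derivative off a countable set, hence
  by a constant.\<close>

lemma deriv_everywhere_of_off_countable:
  fixes f g :: "real \<Rightarrow> real"
  assumes cf: "continuous_on {a..b} f" and cg: "continuous_on {a..b} g" and N: "countable N"
    and der: "\<And>x. x \<in> {a<..<b} - N \<Longrightarrow> (f has_real_derivative g x) (at x)"
    and x: "x \<in> {a..b}"
  shows "(f has_real_derivative g x) (at x within {a..b})"
proof -
  define I where "I = (\<lambda>x. integral {a..x} g)"
  have dI: "(I has_real_derivative g x) (at x within {a..b})" if "x \<in> {a..b}" for x
    unfolding I_def by (rule integral_has_real_derivative[OF cg that])
  have cI: "continuous_on {a..b} I"
    using dI by (intro DERIV_continuous_on) auto
  have eq: "f y = I y + f a" if "y \<in> {a..b}" for y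
  proof -
    have "f y - I y = f a - I a"
    proof (rule const_of_zero_deriv_off_countable[where f="\<lambda>y. f y - I y", OF _ N _ that])
      fix z assume z: "z \<in> {a<..<b} - N"
      have "(I has_real_derivative g z) (at z)" using dI[of z] z by (simp add: at_within_Icc_at)
      thus "((\<lambda>y. f y - I y) has_real_derivative 0) (at z)"
        using DERIV_diff[OF der[OF z]] by fastforce
    qed (intro continuous_intros cf cI)
    thus ?thesis by (simp add: I_def)
  qed
  have "((\<lambda>y. I y + f a) has_real_derivative g x) (at x within {a..b})"
    using DERIV_add[OF dI[OF x] DERIV_const] by simp
  thus ?thesis
    using eq[symmetric] by (rule has_field_derivative_transform_within[OF _ zero_less_one x])
qed

text \<open>After the last point where \<open>D\<close> is nonnegative the inequality reads
  \<open>D' \<ge> K * D\<close>, so \<open>D * exp (- K x)\<close> cannot decrease. The hypothesis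
  is asked only where \<open>D\<close> is negative, which is what the sign arguments can
  deliver.\<close>

lemma gronwall_nonneg:
  fixes D :: "real \<Rightarrow> real"
  assumes cont: "continuous_on {a..b} D" and N: "countable N" and Da: "D a \<ge> 0"
    and der: "\<And>x. x \<in> {a<..<b} - N \<Longrightarrow> D x < 0 \<Longrightarrow>
      \<exists>d. (D has_real_derivative d) (at x) \<and> d \<ge> - K * \<bar>D x\<bar>"
    and x1: "x1 \<in> {a..b}"
  shows "D x1 \<ge> 0"
proof (rule ccontr)
  assume neg: "\<not> D x1 \<ge> 0"
  define A where "A = {a..x1} \<inter> D -` {0..}"
  have c1: "continuous_on {a..x1} D" using x1 by (intro continuous_on_subset[OF cont]) auto
  have clA: "closed A" unfolding A_def
    by (rule continuous_closed_preimage[OF c1 closed_atLeastAtMost closed_atLeast])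
  have "a \<in> A" using Da x1 by (auto simp: A_def)
  have bdd: "bdd_above A" by (rule bdd_aboveI[of _ x1]) (auto simp: A_def)
  define x0 where "x0 = Sup A"
  have x0A: "x0 \<in> A" unfolding x0_def using closed_contains_Sup[OF _ bdd clA] \<open>a \<in> A\<close> by blast
  have above: "D x < 0" if "x0 < x" "x \<le> x1" for x
    using cSup_upper[OF _ bdd, of x] that x0A by (auto simp: A_def x0_def not_le[symmetric])
  have x0: "a \<le> x0" "x0 \<le> x1" "D x0 \<ge> 0" using x0A by (auto simp: A_def)
  have "D x0 * exp (- K * x0) \<le> D x1 * exp (- K * x1)"
  proof (rule mono_of_nonneg_deriv_off_countable[where f="\<lambda>x. D x * exp (- K * x)", OF x0(2) _ N])
    show "continuous_on {x0..x1} (\<lambda>x. D x * exp (- K * x))"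
      using x0 by (intro continuous_intros continuous_on_subset[OF c1]) auto
    fix x assume x: "x \<in> {x0<..<x1} - N"
    then obtain d where d: "(D has_real_derivative d) (at x)" "d \<ge> K * D x"
      using der[of x] above[of x] x0 x1 by (auto simp: abs_if)
    have "((\<lambda>x. D x * exp (- K * x)) has_real_derivative (d - K * D x) * exp (- K * x)) (at x)"
      using d(1) by (auto intro!: derivative_eq_intros simp: algebra_simps)
    thus "\<exists>d\<ge>0. ((\<lambda>x. D x * exp (- K * x)) has_real_derivative d) (at x)"
      using d(2) by (intro exI[of _ "(d - K * D x) * exp (- K * x)"]) auto
  qed
  hence "D x1 * exp (- K * x1) \<ge> 0" using x0(3) by (smt (verit) exp_ge_zero mult_nonneg_nonneg)
  thus False using neg by (simp add: zero_le_mult_iff)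
qed

text \<open>Once \<open>D\<close> is known to be nonnegative, the inequality becomes
  \<open>D' \<ge> - K * D\<close> and \<open>D * exp (K x)\<close> cannot decrease. This makes
  strict orderings of angles persist.\<close>

lemma gronwall_pos:
  fixes D :: "real \<Rightarrow> real"
  assumes cont: "continuous_on {a..b} D" and N: "countable N" and Da: "D a > 0"
    and der: "\<And>x. x \<in> {a<..<b} - N \<Longrightarrow> \<exists>d. (D has_real_derivative d) (at x) \<and> d \<ge> - K * \<bar>D x\<bar>"
    and x1: "x1 \<in> {a..b}"
  shows "D x1 > 0"
proof -
  have nn: "D x \<ge> 0" if "x \<in> {a..b}" for x
    by (rule gronwall_nonneg[OF cont N _ der that]) (use Da in auto)
  have "D a * exp (K * a) \<le> D x1 * exp (K * x1)"
  proof (rule mono_of_nonneg_deriv_off_countable[where f="\<lambda>x. D x * exp (K * x)", OF _ _ N])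
    show "continuous_on {a..x1} (\<lambda>x. D x * exp (K * x))"
      using x1 by (intro continuous_intros continuous_on_subset[OF cont]) auto
    fix x assume x: "x \<in> {a<..<x1} - N"
    then obtain d where d: "(D has_real_derivative d) (at x)" "d \<ge> - K * D x"
      using der[of x] nn[of x] x1 by auto
    have "((\<lambda>x. D x * exp (K * x)) has_real_derivative (d + K * D x) * exp (K * x)) (at x)"
      using d(1) by (auto intro!: derivative_eq_intros simp: algebra_simps)
    thus "\<exists>d\<ge>0. ((\<lambda>x. D x * exp (K * x)) has_real_derivative d) (at x)"
      using d(2) by (intro exI[of _ "(d + K * D x) * exp (K * x)"]) auto
  qed (use x1 in auto)
  hence "D x1 * exp (K * x1) > 0" using Da by (smt (verit) exp_gt_zero mult_pos_pos)
  thus ?thesis by (simp add: zero_less_mult_iff)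
qed

section \<open>Signed powers\<close>

text \<open>In this form the power is multiplicative, composition multiplies the exponents, and the
  value at \<open>0\<close> is \<open>0\<close> for every exponent. So
  \<open>spow (1 / (p - 1))\<close> inverts \<open>spow (p - 1)\<close>, the function behind
  \<open>signed_power p\<close>.\<close>

definition spow :: "real \<Rightarrow> real \<Rightarrow> real" where
  "spow r x = sgn x * \<bar>x\<bar> powr r"

lemma signed_power_eq_spow: "signed_power p x = spow (p - 1) x"
proof (cases "x = 0")
  case False
  have "\<bar>x\<bar> powr (p - 2) * x = sgn x * (\<bar>x\<bar> powr (p - 2) * \<bar>x\<bar> powr 1)"
    using False by (simp add: sgn_mult_abs mult.left_commute) 
  also have "\<bar>x\<bar> powr (p - 2) * \<bar>x\<bar> powr 1 = \<bar>x\<bar> powr (p - 1)"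
    by (subst powr_add[symmetric]) simp
  finally show ?thesis by (simp add: signed_power_def spow_def)
qed (simp add: signed_power_def spow_def)

lemma spow_0 [simp]: "spow r 0 = 0"
  and spow_minus: "spow r (- x) = - spow r x"
  and abs_spow: "\<bar>spow r x\<bar> = \<bar>x\<bar> powr r"
  and spow_pos: "x > 0 \<Longrightarrow> spow r x = x powr r"
  and spow_neg: "x < 0 \<Longrightarrow> spow r x = - ((- x) powr r)"
  and spow_eq_0_iff [simp]: "spow r x = 0 \<longleftrightarrow> x = 0"
  and sgn_spow [simp]: "sgn (spow r x) = sgn x"
  by (auto simp: spow_def abs_mult sgn_mult sgn_if)

lemma spow_pos_iff [simp]: "spow r x > 0 \<longleftrightarrow> x > 0"
  and spow_neg_iff [simp]: "spow r x < 0 \<longleftrightarrow> x < 0"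
  using sgn_spow[of r x] by (metis sgn_greater sgn_less)+

lemma spow_mult: "spow r (x * y) = spow r x * spow r y"
  by (simp add: spow_def sgn_mult abs_mult powr_mult)

lemma spow_inverse: "spow r (inverse x) = inverse (spow r x)"
  by (simp add: spow_def abs_inverse sgn_inverse inverse_powr)

lemma spow_divide: "spow r (x / y) = spow r x / spow r y"
  by (simp add: divide_inverse spow_mult spow_inverse)

lemma spow_spow: "spow r (spow s x) = spow (s * r) x"
  by (simp add: spow_def[of r] abs_spow powr_powr) (simp add: spow_def)

lemma spow_1 [simp]: "spow 1 x = x"
  by (simp add: spow_def sgn_mult_abs)

lemma mult_spow: "x * spow r x = \<bar>x\<bar> powr (r + 1)"
  by (cases "x = 0") (auto simp: spow_def powr_add sgn_if)

lemma spow_strict_mono: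
  assumes "r > 0" "x < y" shows "spow r x < spow r y"
proof -
  consider "x \<ge> 0" | "x < 0" "y \<ge> 0" | "y < 0" using assms by linarith
  thus ?thesis
  proof cases
    case 2
    hence "- ((- x) powr r) < 0" by simp
    also have "0 \<le> spow r y" using 2 by (simp add: spow_def)
    finally show ?thesis using 2 by (simp add: spow_neg)
  qed (use assms in \<open>auto simp: spow_def sgn_if intro: powr_less_mono2\<close>)
qed

lemma spow_less_iff: "r > 0 \<Longrightarrow> spow r x < spow r y \<longleftrightarrow> x < y"
  using spow_strict_mono[of r x y] spow_strict_mono[of r y x] by (cases x y rule: linorder_cases) auto

lemma spow_le_iff: "r > 0 \<Longrightarrow> spow r x \<le> spow r y \<longleftrightarrow> x \<le> y"
  using spow_less_iff[of r y x] by (auto simp: not_less[symmetric])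

lemma abs_powr_has_derivative:
  assumes "r > 1"
  shows "((\<lambda>x. \<bar>x\<bar> powr r) has_real_derivative r * spow (r - 1) x) (at x)"
proof -
  consider "x > 0" | "x < 0" | "x = 0" by linarith
  thus ?thesis
  proof cases
    case 1
    have "((\<lambda>x. x powr r) has_real_derivative r * spow (r - 1) x) (at x)"
      using 1 by (auto intro!: derivative_eq_intros simp: spow_pos)
    moreover have "\<forall>\<^sub>F y in nhds x. y powr r = \<bar>y\<bar> powr r"
      using eventually_nhds_in_open[of "{0<..}" x] 1 by (auto elim: eventually_mono)
    ultimately show ?thesis by (simp add: DERIV_cong_ev[OF refl _ refl])
  next
    case 2
    have "((\<lambda>x. (-x) powr r) has_real_derivative r * spow (r - 1) x) (at x)"
      using 2 by (auto intro!: derivative_eq_intros simp: spow_neg)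
    moreover have "\<forall>\<^sub>F y in nhds x. (-y) powr r = \<bar>y\<bar> powr r"
      using eventually_nhds_in_open[of "{..<0}" x] 2 by (auto elim: eventually_mono)
    ultimately show ?thesis by (simp add: DERIV_cong_ev[OF refl _ refl])
  next
    case 3
    \<comment> \<open>At \<open>0\<close> the modulus of the difference quotient is
      \<open>\<bar>h\<bar> powr (r - 1)\<close>, which tends to \<open>0\<close> because
      \<open>r > 1\<close>.\<close>
    have "((\<lambda>h::real. \<bar>h\<bar> powr (r - 1)) \<longlongrightarrow> \<bar>0\<bar> powr (r - 1)) (at 0)"
      using assms by (intro tendsto_powr' tendsto_intros) auto
    hence "((\<lambda>h::real. \<bar>h\<bar> powr r / h) \<longlongrightarrow> 0) (at 0)"
    proof -
      assume *: "((\<lambda>h::real. \<bar>h\<bar> powr (r - 1)) \<longlongrightarrow> \<bar>0\<bar> powr (r - 1)) (at 0)"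
      have eq: "norm (\<bar>h\<bar> powr r / h) = \<bar>h\<bar> powr (r - 1)" for h :: real
        by (cases "h = 0") (auto simp: powr_diff abs_divide)
      show ?thesis using * by (subst tendsto_norm_zero_iff[symmetric]) (use assms in \<open>simp only: eq abs_zero powr_zero_eq_one\<close>, simp)
    qed
    thus ?thesis using 3 assms by (simp add: DERIV_def)
  qed
qed

lemma spow_has_derivative:
  assumes "x \<noteq> 0"
  shows "(spow r has_real_derivative r * \<bar>x\<bar> powr (r - 1)) (at x)"
proof (cases "x > 0")
  case True
  have "((\<lambda>x. x powr r) has_real_derivative r * \<bar>x\<bar> powr (r - 1)) (at x)"
    using True by (auto intro!: derivative_eq_intros)
  moreover have "\<forall>\<^sub>F y in nhds x. y powr r = spow r y"
    using eventually_nhds_in_open[of "{0<..}" x] True by (auto elim!: eventually_mono simp: spow_pos)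
  ultimately show ?thesis by (simp add: DERIV_cong_ev[OF refl _ refl])
next
  case False
  hence x: "x < 0" using assms by simp
  have "((\<lambda>x. - ((-x) powr r)) has_real_derivative r * \<bar>x\<bar> powr (r - 1)) (at x)"
    using x by (auto intro!: derivative_eq_intros)
  moreover have "\<forall>\<^sub>F y in nhds x. - ((-y) powr r) = spow r y"
    using eventually_nhds_in_open[of "{..<0}" x] x by (auto elim!: eventually_mono simp: spow_neg)
  ultimately show ?thesis by (simp add: DERIV_cong_ev[OF refl _ refl])
qed

lemma isCont_spow:
  assumes "r > 0" shows "isCont (spow r) x"
proof (cases "x = 0")
  case False
  thus ?thesis using spow_has_derivative DERIV_isCont by blast
next
  case True
  have "((\<lambda>h::real. \<bar>h\<bar> powr r) \<longlongrightarrow> \<bar>0\<bar> powr r) (at 0)"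
    using assms by (intro tendsto_powr' tendsto_intros) auto
  hence "(spow r \<longlongrightarrow> 0) (at 0)"
    by (subst tendsto_norm_zero_iff[symmetric]) (simp add: abs_spow)
  thus ?thesis using True by (simp add: isCont_def)
qed

lemma continuous_on_spow [continuous_intros]:
  assumes "continuous_on A g" "r > 0" shows "continuous_on A (\<lambda>x. spow r (g x))"
  using continuous_on_compose[OF assms(1), of "spow r"] isCont_spow[OF assms(2)]
  by (auto simp: o_def continuous_at_imp_continuous_on)

section \<open>The generalised sine\<close>

locale half_linear =
  fixes p :: real
  assumes p_gt_1: "p > 1"
begin

abbreviation b :: real where "b \<equiv> pi_hat p"

lemma sin_pi_div_p_pos: "sin (pi / p) > 0"
  using p_gt_1 by (intro sin_gt_zero) (auto simp: divide_less_eq)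

lemma b_pos: "b > 0"
  using sin_pi_div_p_pos p_gt_1 by (simp add: pi_hat_def)

text \<open>The generalised tangent \<open>T = S / C\<close> satisfies
  \<open>T' = 1 + \<bar>T\<bar> powr p\<close>, so this primitive is its inverse. Sine and cosine
  are rebuilt from it.\<close>

definition arctanp :: "real \<Rightarrow> real" where
  "arctanp t = (LBINT u=0..t. 1 / (1 + \<bar>u\<bar> powr p))"

lemma one_plus_powr_pos: "1 + \<bar>u\<bar> powr p > 0"
  by (smt (verit) powr_ge_zero)

lemma arctanp_deriv: "(arctanp has_real_derivative 1 / (1 + \<bar>t\<bar> powr p)) (at t)"
proof -
  define k where "k = (\<lambda>u. 1 / (1 + \<bar>u\<bar> powr p))"
  have c: "continuous_on {- \<bar>t\<bar> - 1..\<bar>t\<bar> + 1} k"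
    unfolding k_def using p_gt_1 one_plus_powr_pos
    by (intro continuous_intros continuous_on_powr') (auto simp: less_imp_neq[symmetric])
  have "((\<lambda>x. LBINT u=0..x. k u) has_vector_derivative k t) (at t within {- \<bar>t\<bar> - 1..\<bar>t\<bar> + 1})"
    using interval_integral_FTC2[OF _ _ c, of 0 t] by (simp add: zero_ereal_def)
  hence "((\<lambda>x. LBINT u=0..x. k u) has_vector_derivative k t) (at t)"
    by (subst (asm) at_within_Icc_at) auto
  thus ?thesis
    by (simp add: arctanp_def[abs_def] k_def has_real_derivative_iff_has_vector_derivative)
qed

lemma arctanp_0 [simp]: "arctanp 0 = 0"
  by (simp add: arctanp_def zero_ereal_def)

lemma isCont_arctanp: "isCont arctanp t"
  using arctanp_deriv DERIV_isCont by blast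

lemma arctanp_strict_mono: "x < y \<Longrightarrow> arctanp x < arctanp y"
  using DERIV_pos_imp_increasing[of x y arctanp] arctanp_deriv one_plus_powr_pos
  by (metis zero_less_divide_1_iff)

lemma arctanp_less_iff: "arctanp x < arctanp y \<longleftrightarrow> x < y"
  using arctanp_strict_mono[of x y] arctanp_strict_mono[of y x] by (cases x y rule: linorder_cases) auto

lemma arctanp_minus: "arctanp (- t) = - arctanp t"
proof -
  have "((\<lambda>t. arctanp t + arctanp (- t)) has_real_derivative 0) (at t)" for t
  proof -
    have "((\<lambda>t. arctanp (- t)) has_real_derivative 1 / (1 + \<bar>- t\<bar> powr p) * (- 1)) (at t)"
      by (rule DERIV_chain2[OF arctanp_deriv]) (auto intro!: derivative_eq_intros)
    from DERIV_add[OF arctanp_deriv this] show ?thesis by simp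
  qed
  from DERIV_isconst_all[of "\<lambda>t. arctanp t + arctanp (- t)" t 0] this show ?thesis by simp
qed

text \<open>Euler's reflection formula for the Gamma function, the source of the sine in
  \<open>pi_hat\<close>.\<close>

lemma Beta_reflection: "Beta (1/p) (1 - 1/p) = pi / sin (pi / p)"
proof -
  have p0: "0 < 1/p" "1/p < 1" using p_gt_1 by auto
  have "complex_of_real (Gamma (1/p) * Gamma (1 - 1/p)) =
        Gamma (complex_of_real (1/p)) * Gamma (complex_of_real (1 - 1/p))"
    by (simp only: Gamma_complex_of_real of_real_mult)
  also have "\<dots> = of_real pi / sin (of_real pi * complex_of_real (1/p))"
    using Gamma_reflection_complex[of "complex_of_real (1/p)"] by (simp only: of_real_diff of_real_1)
  also have "\<dots> = complex_of_real (pi / sin (pi / p))"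
    by (simp only: of_real_mult[symmetric] sin_of_real of_real_divide[symmetric]) simp
  finally have "Gamma (1/p) * Gamma (1 - 1/p) = pi / sin (pi / p)" by (simp only: of_real_eq_iff)
  thus ?thesis by (simp add: Beta_def)
qed

lemma powr_p_at_top: "filterlim (\<lambda>t::real. t powr p) at_top at_top"
proof (rule filterlim_at_top_mono[OF filterlim_ident])
  show "\<forall>\<^sub>F t::real in at_top. t \<le> t powr p"
    using eventually_ge_at_top[of 1]
  proof eventually_elim
    case (elim t)
    thus ?case using powr_mono[of 1 p t] p_gt_1 by simp
  qed
qed

text \<open>The substitution \<open>X = t powr p / (1 + t powr p)\<close> turns the integrand into
  that of the Beta integral with parameters \<open>1/p\<close> and \<open>1 - 1/p\<close>, divided
  by \<open>p\<close>. As \<open>t\<close> grows, \<open>X\<close> tends to \<open>1\<close> and the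
  incomplete integral to the full one.\<close>

lemma arctanp_tendsto: "(arctanp \<longlongrightarrow> b / 2) at_top"
proof -
  have p0: "0 < 1/p" "1/p < 1" using p_gt_1 by auto
  define be where "be = (\<lambda>u::real. u powr (1/p - 1) * (1 - u) powr (1 - 1/p - 1))"
  define Bi where "Bi = (\<lambda>x. integral {0..x} be)"
  have hB: "(be has_integral Beta (1/p) (1 - 1/p)) {0..1}"
    unfolding be_def using has_integral_Beta_real[of "1/p" "1 - 1/p"] p0 by simp
  hence int: "be integrable_on {0..1}" by blast
  have cB: "continuous_on {0..1} Bi"
    unfolding Bi_def by (rule indefinite_integral_continuous_1[OF int])
  have Bi1: "Bi 1 = Beta (1/p) (1 - 1/p)" using hB by (simp add: Bi_def integral_unique)
  have dB: "(Bi has_real_derivative be x) (at x)" if x: "0 < x" "x < 1" for x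
  proof -
    have "isCont be x" unfolding be_def using x by (intro continuous_intros) auto
    hence "(Bi has_vector_derivative be x) (at x within {0..1})"
      using integral_has_vector_derivative_continuous_at[OF int, of x "{}"] x
      by (auto simp: Bi_def continuous_at_imp_continuous_at_within)
    thus ?thesis using x by (simp add: at_within_Icc_at has_real_derivative_iff_has_vector_derivative)
  qed
  define X where "X = (\<lambda>t::real. t powr p / (1 + t powr p))"
  have X01: "0 \<le> X t" "X t < 1" for t
    by (auto simp: X_def intro!: divide_nonneg_nonneg add_nonneg_nonneg) (smt (verit) divide_less_eq_1 powr_ge_zero)
  have Xpos: "X t > 0" if "t > 0" for t using that by (auto simp: X_def intro!: divide_pos_pos add_pos_pos)
  have dX: "(X has_real_derivative p * t powr (p - 1) / (1 + t powr p)\<^sup>2) (at t)" if "t > 0" for t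
    unfolding X_def using that
    by (auto intro!: derivative_eq_intros simp: power2_eq_square field_simps add_pos_pos less_imp_neq[symmetric])
  have cX: "continuous_on {0..} X"
    unfolding X_def using p_gt_1
    by (intro continuous_intros continuous_on_powr') (auto, smt (verit) powr_ge_zero)
  have eq: "arctanp t = Bi (X t) / p" if t: "t > 0" for t
  proof -
    have "arctanp t - Bi (X t) / p = arctanp 0 - Bi (X 0) / p"
    proof (rule DERIV_isconst2[of 0 t])
      have "continuous_on {0..t} (\<lambda>t. Bi (X t))"
        using X01 by (intro continuous_on_compose2[OF cB]) (auto intro: continuous_on_subset[OF cX] simp: less_imp_le)
      thus "continuous_on {0..t} (\<lambda>t. arctanp t - Bi (X t) / p)"
        using isCont_arctanp p_gt_1 by (intro continuous_intros) (auto simp: continuous_at_imp_continuous_on)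
      fix x :: real assume x: "0 < x" "x < t"
      have 1: "1 + x powr p > 0" by (smt (verit) powr_ge_zero)
      have "be (X x) * (p * x powr (p - 1) / (1 + x powr p)\<^sup>2) / p = 1 / (1 + \<bar>x\<bar> powr p)"
      proof -
        have mX: "1 - X x = 1 / (1 + x powr p)" using 1 by (simp add: X_def field_simps)
        have "(X x) powr (1/p - 1) = x powr (p * (1/p - 1)) / (1 + x powr p) powr (1/p - 1)"
          unfolding X_def using 1 x by (simp add: powr_divide powr_powr)
        moreover have "p * (1/p - 1) = 1 - p" using p_gt_1 by (simp add: field_simps)
        moreover have "(1 - X x) powr (1 - 1/p - 1) = 1 / (1 + x powr p) powr (- (1/p))"
          unfolding mX using 1 by (simp add: powr_divide)
        ultimately have "be (X x) = x powr (1 - p) / ((1 + x powr p) powr (1/p - 1) * (1 + x powr p) powr (- (1/p)))"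
          by (simp add: be_def)
        also have "(1 + x powr p) powr (1/p - 1) * (1 + x powr p) powr (- (1/p)) = (1 + x powr p) powr (-1)"
          by (subst powr_add[symmetric]) simp
        also have "(1 + x powr p) powr (-1) = 1 / (1 + x powr p)"
          using 1 by (simp add: powr_minus_divide)
        finally have "be (X x) = x powr (1 - p) * (1 + x powr p)" by simp
        moreover have "x powr (1 - p) * x powr (p - 1) = 1"
          using x by (subst powr_add[symmetric]) simp
        moreover have "x powr (1 - p) * y * (p * x powr (p - 1) / y\<^sup>2) / p = (x powr (1 - p) * x powr (p - 1)) * (y / y\<^sup>2)" for y
          using p_gt_1 by simp
        ultimately show ?thesis using 1 x p_gt_1 by (simp add: power2_eq_square)
      qed
      moreover have dBX: "((\<lambda>t. Bi (X t)) has_real_derivative be (X x) * (p * x powr (p - 1) / (1 + x powr p)\<^sup>2)) (at x)"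
        using x by (intro DERIV_chain2[OF dB dX] Xpos X01) auto
      ultimately show "((\<lambda>t. arctanp t - Bi (X t) / p) has_real_derivative 0) (at x)"
        using DERIV_diff[OF arctanp_deriv DERIV_cdivide[OF dBX, of p]] by simp
    qed (use t in auto)
    thus ?thesis using p_gt_1 by (simp add: X_def Bi_def)
  qed
  have "(X \<longlongrightarrow> 1) at_top"
  proof -
    have "filterlim (\<lambda>t::real. 1 + t powr p) at_top at_top"
      by (intro filterlim_tendsto_add_at_top[OF tendsto_const] powr_p_at_top)
    hence "((\<lambda>t::real. 1 - inverse (1 + t powr p)) \<longlongrightarrow> 1 - 0) at_top"
      by (intro tendsto_diff tendsto_const tendsto_inverse_0_at_top)
    moreover have "1 - inverse (1 + t powr p) = X t" for t
      using add_pos_nonneg[of 1 "t powr p"] by (simp add: X_def field_simps)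
    ultimately show ?thesis by simp
  qed
  hence "((\<lambda>t. Bi (X t)) \<longlongrightarrow> Bi 1) at_top"
    by (intro continuous_on_tendsto_compose[OF cB]) (auto simp: X01 less_imp_le)
  hence "((\<lambda>t. Bi (X t) / p) \<longlongrightarrow> Bi 1 / p) at_top"
    using p_gt_1 by (intro tendsto_intros) auto
  moreover have "Bi 1 / p = b / 2"
    using p_gt_1 by (simp add: Bi1 Beta_reflection pi_hat_def)
  moreover have "\<forall>\<^sub>F t in at_top. Bi (X t) / p = arctanp t"
    using eventually_gt_at_top[of 0] by eventually_elim (simp add: eq)
  ultimately show ?thesis using tendsto_cong by force
qed

lemma arctanp_less: "arctanp t < b / 2"
proof -
  have "arctanp (t + 1) \<le> b / 2"
    using eventually_ge_at_top[of "t+1"]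
    by (intro tendsto_lowerbound[OF arctanp_tendsto])
       (auto elim!: eventually_mono simp: not_less[symmetric] arctanp_less_iff)
  thus ?thesis using arctanp_strict_mono[of t "t+1"] by simp
qed

section \<open>Generalised tangent, cosine and sine on one strip\<close>

definition tanp :: "real \<Rightarrow> real" where "tanp = inv arctanp"

lemma tanp_arctanp: "tanp (arctanp t) = t"
  unfolding tanp_def by (rule inv_f_f) (metis arctanp_less_iff injI less_irrefl linorder_cases)

lemma arctanp_tanp: assumes "\<bar>y\<bar> < b / 2" shows "arctanp (tanp y) = y"
proof -
  have ex: "\<exists>t. arctanp t > z" if "z < b/2" for z
    using order_tendstoD(1)[OF arctanp_tendsto that] eventually_happens'[OF trivial_limit_at_top_linorder] by blast
  obtain t1 t2 where t: "arctanp t1 > y" "arctanp t2 > - y" using ex[of y] ex[of "-y"] assms by (meson abs_less_iff)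
  hence t2: "arctanp (- t2) < y" by (simp add: arctanp_minus)
  with t have "- t2 < t1" by (metis arctanp_less_iff less_trans)
  hence "\<exists>t\<ge>-t2. t \<le> t1 \<and> arctanp t = y"
    using t t2 isCont_arctanp by (intro IVT') (auto simp: continuous_at_imp_continuous_on)
  thus ?thesis using tanp_arctanp by metis
qed

lemma tanp_deriv:
  assumes "\<bar>y\<bar> < b / 2"
  shows "(tanp has_real_derivative 1 + \<bar>tanp y\<bar> powr p) (at y)"
proof -
  have "isCont tanp (arctanp (tanp y))"
    using isCont_inverse_function2[of "tanp y - 1" "tanp y" "tanp y + 1" tanp arctanp]
    by (simp add: tanp_arctanp isCont_arctanp)
  hence c: "isCont tanp y" by (simp add: arctanp_tanp[OF assms])
  have "(tanp has_real_derivative inverse (1 / (1 + \<bar>tanp y\<bar> powr p))) (at y)"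
    by (rule DERIV_inverse_function[OF arctanp_deriv _ _ _ arctanp_tanp c, of "-b/2" "b/2"])
       (use assms one_plus_powr_pos[of "tanp y"] in auto)
  thus ?thesis by simp
qed

lemma tanp_at_left: "filterlim tanp at_top (at_left (b / 2))"
  unfolding filterlim_at_top
proof
  fix Z
  have "\<forall>\<^sub>F u in at_left (b/2). u \<in> {max 0 (arctanp Z)<..<b/2}"
    using arctanp_less[of Z] b_pos by (intro eventually_at_left_real) auto
  thus "\<forall>\<^sub>F u in at_left (b/2). Z \<le> tanp u"
  proof eventually_elim
    case (elim u)
    hence "arctanp (tanp u) = u" by (intro arctanp_tanp) auto
    hence "arctanp Z < arctanp (tanp u)" using elim by auto
    thus ?case by (simp add: arctanp_less_iff)
  qed
qed

lemma tanp_minus: "\<bar>y\<bar> < b / 2 \<Longrightarrow> tanp (- y) = - tanp y"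
  using arctanp_minus[of "tanp y"] arctanp_tanp[of y] tanp_arctanp[of "- tanp y"] by simp

lemma tanp_0 [simp]: "tanp 0 = 0" using tanp_arctanp[of 0] by simp

text \<open>The quotient sine by cosine must be \<open>tanp\<close> and the p-th powers of the
  moduli must add up to \<open>1\<close>; this determines both functions. At the left end of the
  strip the tangent is infinite, and the limits \<open>0\<close> and \<open>- 1\<close> are
  prescribed.\<close>

definition cosp0 :: "real \<Rightarrow> real" where
  "cosp0 u = (if u = - b / 2 then 0 else (1 + \<bar>tanp u\<bar> powr p) powr (- 1 / p))"

definition sinp0 :: "real \<Rightarrow> real" where
  "sinp0 u = (if u = - b / 2 then - 1 else tanp u * (1 + \<bar>tanp u\<bar> powr p) powr (- 1 / p))"

section \<open>Antiperiodic extension from the strip to the line\<close>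

definition antiperiodic_ext :: "(real \<Rightarrow> real) \<Rightarrow> real \<Rightarrow> real" where
  "antiperiodic_ext g y = (let n = \<lfloor>y / b + 1/2\<rfloor> in (if even n then 1 else - 1) * g (y - of_int n * b))"

lemma antiperiodic_ext_eq:
  assumes "- b / 2 \<le> u" "u < b / 2"
  shows "antiperiodic_ext g (u + of_int k * b) = (if even k then 1 else - 1) * g u"
proof -
  have "\<lfloor>(u + of_int k * b) / b + 1/2\<rfloor> = k"
    using assms b_pos by (intro floor_unique) (auto simp: field_simps)
  thus ?thesis by (simp add: antiperiodic_ext_def)
qed

lemma antiperiodic_ext_base: "- b / 2 \<le> u \<Longrightarrow> u < b / 2 \<Longrightarrow> antiperiodic_ext g u = g u"
  using antiperiodic_ext_eq[of u g 0] by simp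

lemma strip_decomp: obtains u k where "- b / 2 \<le> u" "u < b / 2" "y = u + of_int k * b"
proof -
  define k where "k = \<lfloor>y / b + 1/2\<rfloor>"
  have "of_int k \<le> y / b + 1/2" "y / b + 1/2 < of_int k + 1" by (auto simp: k_def)
  hence "of_int k * b \<le> y + b/2" "y + b/2 < (of_int k + 1) * b"
    using b_pos by (simp_all add: field_simps)
  thus ?thesis by (intro that[of "y - of_int k * b" k]) (auto simp: algebra_simps)
qed

lemma antiperiodic_ext_shift:
  "antiperiodic_ext g (y + of_int k * b) = (if even k then 1 else - 1) * antiperiodic_ext g y"
proof -
  obtain u j where u: "- b / 2 \<le> u" "u < b / 2" "y = u + of_int j * b" by (rule strip_decomp)
  have "y + of_int k * b = u + of_int (j + k) * b" using u by (simp add: algebra_simps)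
  thus ?thesis by (simp only: antiperiodic_ext_eq[OF u(1,2)]) (simp add: u(3) antiperiodic_ext_eq[OF u(1,2)])
qed

text \<open>Only the gluing points matter. Passing from one strip to the next flips the sign, so
  opposite one-sided limits at the two ends of the strip fit together. Every point is moved to the
  basic strip by a shift.\<close>

lemma antiperiodic_ext_isCont:
  assumes c: "\<And>u. \<bar>u\<bar> < b / 2 \<Longrightarrow> isCont g u" and l: "(g \<longlongrightarrow> L) (at_left (b / 2))"
    and r: "(g \<longlongrightarrow> - L) (at_right (- b / 2))" and v: "g (- b / 2) = - L"
  shows "isCont (antiperiodic_ext g) y"
proof -
  obtain u k where u: "- b / 2 \<le> u" "u < b / 2" "y = u + of_int k * b" by (rule strip_decomp)
  have "isCont (antiperiodic_ext g) u"
  proof (cases "u = - b / 2")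
    case False
    have "\<forall>\<^sub>F z in nhds u. antiperiodic_ext g z = g z"
      using eventually_nhds_in_open[of "{-b/2<..<b/2}" u] False u
      by (auto elim!: eventually_mono simp: antiperiodic_ext_base)
    thus ?thesis using isCont_cong c[of u] False u by fastforce
  next
    case True
    have "(antiperiodic_ext g \<longlongrightarrow> - L) (at_right u)"
    proof (rule Lim_transform_eventually)
      show "\<forall>\<^sub>F z in at_right u. g z = antiperiodic_ext g z"
        using eventually_at_right_real[of u "b/2"] u True
        by (auto elim!: eventually_mono simp: antiperiodic_ext_base)
    qed (use r True in simp)
    moreover have "(antiperiodic_ext g \<longlongrightarrow> - L) (at_left u)"
    proof (rule Lim_transform_eventually)
      have "filterlim (\<lambda>z. z + b) (at_left (b/2)) (at_left u)"
        unfolding True by (auto simp: filterlim_at eventually_at_filter intro!: tendsto_eq_intros)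
      from filterlim_compose[OF l this] show "((\<lambda>z. - g (z + b)) \<longlongrightarrow> - L) (at_left u)"
        by (intro tendsto_minus)
      have "\<forall>\<^sub>F z in at_left u. z \<in> {u - b<..<u}" using b_pos by (intro eventually_at_left_real) auto
      thus "\<forall>\<^sub>F z in at_left u. - g (z + b) = antiperiodic_ext g z"
      proof eventually_elim
        case (elim z)
        have "antiperiodic_ext g (z + b) = g (z + b)"
          using elim True by (intro antiperiodic_ext_base) auto
        moreover have "antiperiodic_ext g (z + b) = - antiperiodic_ext g z"
          using antiperiodic_ext_shift[of g z 1] by simp
        ultimately show ?case by simp
      qed
    qed
    moreover have "antiperiodic_ext g u = - L"
      using antiperiodic_ext_base[of u g] True v u by simp
    ultimately show ?thesis by (simp add: isCont_def filterlim_at_split)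
  qed
  hence "isCont (\<lambda>z. (if even k then 1 else - 1) * antiperiodic_ext g (z - of_int k * b)) y"
    using u(3) isCont_o2[of y "\<lambda>z. z - of_int k * b" "antiperiodic_ext g"] by (intro continuous_intros) auto
  moreover have "(if even k then 1 else - 1) * antiperiodic_ext g (z - of_int k * b) = antiperiodic_ext g z" for z
    using antiperiodic_ext_shift[of g "z - of_int k * b" k] by simp
  ultimately show ?thesis by simp
qed

lemma antiperiodic_ext_deriv:
  assumes d: "(g has_real_derivative d) (at u)" and u: "\<bar>u\<bar> < b / 2"
  shows "(antiperiodic_ext g has_real_derivative (if even k then 1 else - 1) * d) (at (u + of_int k * b))"
proof -
  have "\<forall>\<^sub>F z in nhds u. antiperiodic_ext g z = g z"
    using eventually_nhds_in_open[of "{-b/2<..<b/2}" u] u[unfolded abs_less_iff]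
    by (auto elim!: eventually_mono simp: antiperiodic_ext_base)
  hence "(antiperiodic_ext g has_real_derivative d) (at u)"
    using d by (simp add: DERIV_cong_ev[OF refl _ refl])
  hence "((\<lambda>z. antiperiodic_ext g (z - of_int k * b)) has_real_derivative d * 1) (at (u + of_int k * b))"
    by (intro DERIV_chain2[of "antiperiodic_ext g"]) (auto intro!: derivative_eq_intros)
  from DERIV_cmult[OF this, of "if even k then 1 else - 1"]
  have "((\<lambda>z. (if even k then 1 else - 1) * antiperiodic_ext g (z - of_int k * b)) has_real_derivative
     (if even k then 1 else - 1) * d) (at (u + of_int k * b))" by simp
  moreover have "(if even k then 1 else - 1) * antiperiodic_ext g (z - of_int k * b) = antiperiodic_ext g z" for z
    using antiperiodic_ext_shift[of g "z - of_int k * b" k] by simp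
  ultimately show ?thesis by simp
qed

text \<open>\<open>S\<close> is the generalised sine and \<open>C\<close> its derivative; \<open>pi_hat p / 2\<close> is the limit of \<open>arctanp\<close> at infinity.\<close>

definition S :: "real \<Rightarrow> real" where "S = antiperiodic_ext sinp0"
definition C :: "real \<Rightarrow> real" where "C = antiperiodic_ext cosp0"

lemma Z_deriv:
  assumes "\<bar>u\<bar> < b / 2"
  shows "((\<lambda>u. 1 + \<bar>tanp u\<bar> powr p) has_real_derivative
    p * spow (p - 1) (tanp u) * (1 + \<bar>tanp u\<bar> powr p)) (at u)"
  using DERIV_add[OF DERIV_const DERIV_chain2[OF abs_powr_has_derivative[OF p_gt_1] tanp_deriv[OF assms]]]
  by simp

lemma cosp0_eq: "\<bar>u\<bar> < b / 2 \<Longrightarrow> cosp0 u = (1 + \<bar>tanp u\<bar> powr p) powr (- 1 / p)"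
  and sinp0_eq: "\<bar>u\<bar> < b / 2 \<Longrightarrow> sinp0 u = tanp u * (1 + \<bar>tanp u\<bar> powr p) powr (- 1 / p)"
  by (auto simp: cosp0_def sinp0_def)

lemma ev_strip:
  assumes "\<bar>u\<bar> < b / 2" shows "\<forall>\<^sub>F z in nhds u. \<bar>z\<bar> < b / 2"
  using eventually_nhds_in_open[of "{-b/2<..<b/2}" u] assms[unfolded abs_less_iff]
  by (auto elim!: eventually_mono simp: abs_less_iff)

lemma sinp0_deriv:
  assumes u: "\<bar>u\<bar> < b / 2"
  shows "(sinp0 has_real_derivative cosp0 u) (at u)"
proof -
  define Z where "Z = 1 + \<bar>tanp u\<bar> powr p"
  have Z: "Z > 0" by (simp add: Z_def one_plus_powr_pos)
  have "((\<lambda>u. tanp u * (1 + \<bar>tanp u\<bar> powr p) powr (- 1 / p)) has_real_derivative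
      Z * Z powr (- 1 / p) + tanp u * (- 1 / p * Z powr (- 1 / p - 1) * (p * spow (p - 1) (tanp u) * Z))) (at u)"
    using DERIV_mult[OF tanp_deriv[OF u] DERIV_fun_powr[OF Z_deriv[OF u] one_plus_powr_pos, of "- 1 / p"]]
    by (simp add: Z_def algebra_simps)
  also have "tanp u * (- 1 / p * Z powr (- 1 / p - 1) * (p * spow (p - 1) (tanp u) * Z)) =
     - (tanp u * spow (p - 1) (tanp u)) * (Z powr (- 1 / p - 1) * Z)"
    using p_gt_1 by (simp add: field_simps)
  also have "Z powr (- 1 / p - 1) * Z = Z powr (- 1 / p)"
    using Z by (simp add: powr_diff)
  also have "tanp u * spow (p - 1) (tanp u) = Z - 1" by (simp add: mult_spow Z_def)
  also have "Z * Z powr (- 1 / p) + - (Z - 1) * Z powr (- 1 / p) = cosp0 u"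
    using u by (simp add: cosp0_eq Z_def algebra_simps)
  finally show ?thesis
    using ev_strip[OF u] sinp0_eq
    by (subst DERIV_cong_ev[OF refl _ refl]) (auto elim!: eventually_mono)
qed

lemma spow_cosp0_deriv:
  assumes u: "\<bar>u\<bar> < b / 2"
  shows "((\<lambda>u. spow (p - 1) (cosp0 u)) has_real_derivative - (p - 1) * spow (p - 1) (sinp0 u)) (at u)"
proof -
  define Z where "Z = 1 + \<bar>tanp u\<bar> powr p"
  have Z: "Z > 0" by (simp add: Z_def one_plus_powr_pos)
  have "((\<lambda>u. (1 + \<bar>tanp u\<bar> powr p) powr (- (p - 1) / p)) has_real_derivative
      - (p - 1) / p * Z powr (- (p - 1) / p - 1) * (p * spow (p - 1) (tanp u) * Z)) (at u)"
    using DERIV_fun_powr[OF Z_deriv[OF u] one_plus_powr_pos, of "- (p - 1) / p"] by (simp add: Z_def)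
  also have "- (p - 1) / p * Z powr (- (p - 1) / p - 1) * (p * spow (p - 1) (tanp u) * Z) =
     - (p - 1) * spow (p - 1) (tanp u) * (Z powr (- (p - 1) / p - 1) * Z)"
    using p_gt_1 by (simp add: field_simps)
  also have "Z powr (- (p - 1) / p - 1) * Z = Z powr (- (p - 1) / p)"
    using Z by (simp add: powr_diff)
  also have "- (p - 1) * spow (p - 1) (tanp u) * Z powr (- (p - 1) / p) = - (p - 1) * spow (p - 1) (sinp0 u)"
  proof -
    have e: "(- 1 / p) * (p - 1) = - (p - 1) / p" using p_gt_1 by (simp add: field_simps)
    show ?thesis using u Z by (simp only: sinp0_eq Z_def[symmetric] spow_mult) (simp add: spow_pos powr_powr e del: minus_diff_eq)
  qed
  finally have *: "((\<lambda>u. (1 + \<bar>tanp u\<bar> powr p) powr (- (p - 1) / p)) has_real_derivative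
     - (p - 1) * spow (p - 1) (sinp0 u)) (at u)" .
  have "spow (p - 1) (cosp0 z) = (1 + \<bar>tanp z\<bar> powr p) powr (- (p - 1) / p)" if "\<bar>z\<bar> < b / 2" for z
  proof -
    have e: "(- 1 / p) * (p - 1) = - (p - 1) / p" using p_gt_1 by (simp add: field_simps)
    show ?thesis using that one_plus_powr_pos[of "tanp z"]
      by (simp only: cosp0_eq) (simp add: spow_pos powr_powr e del: minus_diff_eq)
  qed
  thus ?thesis
    using ev_strip[OF u] * by (subst DERIV_cong_ev[OF refl _ refl]) (auto elim!: eventually_mono)
qed

lemma cosp0_pos: "\<bar>u\<bar> < b / 2 \<Longrightarrow> cosp0 u > 0"
  using one_plus_powr_pos[of "tanp u"] by (simp add: cosp0_eq)

lemma isCont_cosp0: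
  assumes u: "\<bar>u\<bar> < b / 2" shows "isCont cosp0 u"
proof -
  have "isCont (\<lambda>u. spow (1 / (p - 1)) (spow (p - 1) (cosp0 u))) u"
    using p_gt_1 by (intro isCont_o2[OF DERIV_isCont[OF spow_cosp0_deriv[OF u]]] isCont_spow) auto
  thus ?thesis using p_gt_1 by (simp add: spow_spow)
qed

lemma sinp0_cosp0: 
  assumes "- b / 2 \<le> u" "u < b / 2" shows "\<bar>sinp0 u\<bar> powr p + \<bar>cosp0 u\<bar> powr p = 1"
proof (cases "u = - b / 2")
  case True thus ?thesis using p_gt_1 by (simp add: sinp0_def cosp0_def)
next
  case False
  define Z where "Z = 1 + \<bar>tanp u\<bar> powr p"
  have Z: "Z > 0" by (simp add: Z_def one_plus_powr_pos)
  have "\<bar>cosp0 u\<bar> powr p = Z powr (-1)"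
    using False p_gt_1 by (simp add: cosp0_def powr_powr Z_def)
  moreover have "\<bar>sinp0 u\<bar> powr p = (Z - 1) * Z powr (-1)"
    using False p_gt_1 by (simp add: sinp0_def abs_mult powr_mult powr_powr Z_def)
  moreover have "Z powr (-1) = 1 / Z" using Z by (simp add: powr_minus_divide)
  ultimately show ?thesis using Z by (simp add: add_divide_distrib[symmetric])
qed

lemma cosp0_minus: "\<bar>u\<bar> < b / 2 \<Longrightarrow> cosp0 (- u) = cosp0 u"
  and sinp0_minus: "\<bar>u\<bar> < b / 2 \<Longrightarrow> sinp0 (- u) = - sinp0 u"
  by (simp_all add: cosp0_eq sinp0_eq tanp_minus)

lemma cosp0_at_left: "(cosp0 \<longlongrightarrow> 0) (at_left (b / 2))"
proof (rule Lim_transform_eventually)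
  have "filterlim (\<lambda>u. tanp u powr p) at_top (at_left (b / 2))"
    by (rule filterlim_compose[OF powr_p_at_top tanp_at_left])
  hence "filterlim (\<lambda>u. 1 + tanp u powr p) at_top (at_left (b / 2))"
    by (intro filterlim_tendsto_add_at_top[OF tendsto_const])
  thus "((\<lambda>u. (1 + tanp u powr p) powr (- 1 / p)) \<longlongrightarrow> 0) (at_left (b / 2))"
    using p_gt_1 by (intro tendsto_neg_powr) auto
  have "\<forall>\<^sub>F u in at_left (b/2). tanp u \<ge> 0" using tanp_at_left by (simp add: filterlim_at_top)
  moreover have "\<forall>\<^sub>F u in at_left (b/2). u \<in> {0<..<b/2}" using b_pos by (intro eventually_at_left_real) auto
  ultimately show "\<forall>\<^sub>F u in at_left (b/2). (1 + tanp u powr p) powr (- 1 / p) = cosp0 u"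
    by eventually_elim (auto simp: cosp0_eq)
qed

lemma sinp0_at_left: "(sinp0 \<longlongrightarrow> 1) (at_left (b / 2))"
proof (rule Lim_transform_eventually)
  have "((\<lambda>u. (1 - \<bar>cosp0 u\<bar> powr p) powr (1 / p)) \<longlongrightarrow> (1 - \<bar>0\<bar> powr p) powr (1 / p)) (at_left (b / 2))"
    using p_gt_1 by (intro tendsto_intros tendsto_powr' cosp0_at_left) auto
  thus "((\<lambda>u. (1 - \<bar>cosp0 u\<bar> powr p) powr (1 / p)) \<longlongrightarrow> 1) (at_left (b / 2))" by simp
  have "\<forall>\<^sub>F u in at_left (b/2). tanp u \<ge> 0" using tanp_at_left by (simp add: filterlim_at_top)
  moreover have "\<forall>\<^sub>F u in at_left (b/2). u \<in> {0<..<b/2}" using b_pos by (intro eventually_at_left_real) auto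
  ultimately show "\<forall>\<^sub>F u in at_left (b/2). (1 - \<bar>cosp0 u\<bar> powr p) powr (1 / p) = sinp0 u"
  proof eventually_elim
    case (elim u)
    have "1 - \<bar>cosp0 u\<bar> powr p = \<bar>sinp0 u\<bar> powr p" using sinp0_cosp0[of u] elim by auto
    moreover have "sinp0 u \<ge> 0" using elim by (simp add: sinp0_eq)
    ultimately show ?case using p_gt_1 by (simp add: powr_powr)
  qed
qed

lemma at_right_of_at_left:
  fixes g :: "real \<Rightarrow> real"
  assumes "(g \<longlongrightarrow> L) (at_left (b / 2))" and "\<And>u. \<bar>u\<bar> < b / 2 \<Longrightarrow> g (- u) = s * g u"
  shows "(g \<longlongrightarrow> s * L) (at_right (- b / 2))"
proof -
  have "((\<lambda>u. g (- u)) \<longlongrightarrow> s * L) (at_left (b / 2))"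
  proof (rule Lim_transform_eventually)
    show "((\<lambda>u. s * g u) \<longlongrightarrow> s * L) (at_left (b / 2))" by (rule tendsto_mult_left[OF assms(1)])
    have "\<forall>\<^sub>F u in at_left (b/2). u \<in> {0<..<b/2}" using b_pos by (intro eventually_at_left_real) auto
    thus "\<forall>\<^sub>F u in at_left (b/2). s * g u = g (- u)"
      by eventually_elim (simp add: assms(2))
  qed
  moreover have "at_right (- b / 2) = filtermap uminus (at_left (b / 2))"
    using at_right_minus[of "- b / 2"] by simp
  ultimately show ?thesis by (simp only: filterlim_filtermap)
qed

lemma isCont_S: "isCont S y"
  unfolding S_def
  using at_right_of_at_left[OF sinp0_at_left, of "-1"] sinp0_minus DERIV_isCont[OF sinp0_deriv]
  by (intro antiperiodic_ext_isCont[OF _ sinp0_at_left]) (auto simp: sinp0_def)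

lemma isCont_C: "isCont C y"
  unfolding C_def
  using at_right_of_at_left[OF cosp0_at_left, of 1] cosp0_minus isCont_cosp0
  by (intro antiperiodic_ext_isCont[OF _ cosp0_at_left]) (auto simp: cosp0_def)

text \<open>The ends of the strips form a countable set and the candidate derivative is continuous,
  so no difference quotient has to be computed at the ends.\<close>

lemma deriv_off_strip_ends:
  assumes c: "\<And>x. isCont F x" "\<And>x. isCont G x"
    and d: "\<And>u k. \<bar>u\<bar> < b / 2 \<Longrightarrow> (F has_real_derivative G (u + of_int k * b)) (at (u + of_int k * b))"
  shows "(F has_real_derivative G x) (at x)"
proof -
  define N where "N = range (\<lambda>k::int. - b / 2 + of_int k * b)"
  have "(F has_real_derivative G x) (at x within {x-1..x+1})"
  proof (rule deriv_everywhere_of_off_countable[where N=N])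
    show "countable N" by (simp add: N_def)
    fix y assume y: "y \<in> {x-1<..<x+1} - N"
    obtain u k where u: "- b / 2 \<le> u" "u < b / 2" "y = u + of_int k * b" by (rule strip_decomp)
    with y have "u \<noteq> - b/2" by (auto simp: N_def)
    thus "(F has_real_derivative G y) (at y)" using d[of u k] u by auto
  qed (auto intro!: continuous_at_imp_continuous_on simp: c)
  thus ?thesis by (subst (asm) at_within_Icc_at) auto
qed

lemma S_deriv: "(S has_real_derivative C x) (at x)"
proof (rule deriv_off_strip_ends[OF isCont_S isCont_C])
  fix u k assume u: "\<bar>u\<bar> < b / 2"
  have "C (u + of_int k * b) = (if even k then 1 else - 1) * cosp0 u"
    unfolding C_def using u by (intro antiperiodic_ext_eq) auto
  thus "(S has_real_derivative C (u + of_int k * b)) (at (u + of_int k * b))"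
    using antiperiodic_ext_deriv[OF sinp0_deriv[OF u] u, of k] by (simp add: S_def)
qed

lemma spow_C_eq: "spow (p - 1) (C x) = antiperiodic_ext (\<lambda>u. spow (p - 1) (cosp0 u)) x"
  by (auto simp: C_def antiperiodic_ext_def Let_def spow_minus)

lemma spow_C_deriv: "((\<lambda>x. spow (p - 1) (C x)) has_real_derivative - (p - 1) * spow (p - 1) (S x)) (at x)"
proof (rule deriv_off_strip_ends)
  show "isCont (\<lambda>x. spow (p - 1) (C x)) x" for x
    using p_gt_1 by (intro isCont_o2[OF isCont_C] isCont_spow) auto
  show "isCont (\<lambda>x. - (p - 1) * spow (p - 1) (S x)) x" for x
    using p_gt_1 by (intro continuous_intros isCont_o2[OF isCont_S] isCont_spow) auto
  fix u k assume u: "\<bar>u\<bar> < b / 2"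
  have "S (u + of_int k * b) = (if even k then 1 else - 1) * sinp0 u"
    unfolding S_def using u by (intro antiperiodic_ext_eq) auto
  thus "((\<lambda>x. spow (p - 1) (C x)) has_real_derivative - (p - 1) * spow (p - 1) (S (u + of_int k * b)))
     (at (u + of_int k * b))"
    using antiperiodic_ext_deriv[OF spow_cosp0_deriv[OF u] u, of k] by (auto simp: spow_C_eq spow_minus)
qed

lemma S_C_identity: "\<bar>S x\<bar> powr p + \<bar>C x\<bar> powr p = 1"
proof -
  obtain u k where u: "- b / 2 \<le> u" "u < b / 2" "x = u + of_int k * b" by (rule strip_decomp)
  show ?thesis unfolding S_def C_def u(3) antiperiodic_ext_eq[OF u(1,2)]
    using sinp0_cosp0[OF u(1,2)] by auto
qed

section \<open>Symmetries, signs and bounds of the generalised sine\<close>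

lemma S_shift: "S (x + of_int k * b) = (if even k then 1 else - 1) * S x"
  and C_shift: "C (x + of_int k * b) = (if even k then 1 else - 1) * C x"
  by (simp_all add: S_def C_def antiperiodic_ext_shift)

lemma S_minus: "S (- x) = - S x" and C_minus: "C (- x) = C x"
proof -
  obtain u k where u: "- b / 2 \<le> u" "u < b / 2" "x = u + of_int k * b" by (rule strip_decomp)
  have "S (- x) = - S x \<and> C (- x) = C x"
  proof (cases "u = - b / 2")
    case True
    have "- x = u + of_int (1 - k) * b" using True u by (simp add: algebra_simps)
    moreover have "even (1 - k) \<longleftrightarrow> odd k" by simp
    ultimately show ?thesis using u(1,2) u(3)
      by (simp only: S_def C_def antiperiodic_ext_eq[OF u(1,2)]) (simp add: True sinp0_def cosp0_def)
  next
    case False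
    hence u': "\<bar>u\<bar> < b / 2" "- b / 2 \<le> - u" "- u < b / 2" using u by auto
    have "- x = - u + of_int (- k) * b" using u by simp
    thus ?thesis using u'
      by (simp only: S_def C_def antiperiodic_ext_eq[OF u(1,2)] antiperiodic_ext_eq[OF u'(2,3)] u(3))
         (simp add: sinp0_minus cosp0_minus)
  qed
  thus "S (- x) = - S x" "C (- x) = C x" by auto
qed

lemma S_0 [simp]: "S 0 = 0"
  using S_minus[of 0] by simp

lemma C_pos: "\<bar>x\<bar> < b / 2 \<Longrightarrow> C x > 0"
  unfolding C_def using cosp0_pos by (subst antiperiodic_ext_base) auto

lemma C_0 [simp]: "C 0 = 1"
  unfolding C_def using b_pos by (subst antiperiodic_ext_base) (auto simp: cosp0_eq)

lemma S_plus_b: "S (x + b) = - S x" and C_plus_b: "C (x + b) = - C x"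
  using S_shift[of x 1] C_shift[of x 1] by auto

lemma S_reflect: "S (b - x) = S x" and C_reflect: "C (b - x) = - C x"
  using S_plus_b[of "-x"] C_plus_b[of "-x"] by (simp_all add: S_minus C_minus)

lemma S_strict_mono_half:
  assumes "- b / 2 \<le> x" "x < y" "y \<le> b / 2" shows "S x < S y"
  using assms C_pos S_deriv isCont_S
  by (intro DERIV_pos_imp_increasing_open[of x y S]) (auto simp: continuous_at_imp_continuous_on intro!: exI)

lemma S_pos: assumes "0 < x" "x < b" shows "S x > 0"
proof (cases "x \<le> b / 2")
  case True thus ?thesis using S_strict_mono_half[of 0 x] assms by simp
next
  case False thus ?thesis using S_strict_mono_half[of 0 "b - x"] assms by (simp add: S_reflect)
qed

lemma C_half [simp]: "C (b / 2) = 0"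
  using C_reflect[of "b/2"] by simp

lemma S_half [simp]: "S (b / 2) = 1"
  using S_C_identity[of "b/2"] S_pos[of "b/2"] b_pos p_gt_1
    powr_less_mono2[of p "S (b/2)" 1] powr_less_mono2[of p 1 "S (b/2)"]
  by (cases "S (b/2)" "1::real" rule: linorder_cases) auto

definition f :: "real \<Rightarrow> real" where "f x = \<bar>S x\<bar> powr p"

lemma f_deriv: "(f has_real_derivative p * spow (p - 1) (S x) * C x) (at x)"
  unfolding f_def[abs_def] by (rule DERIV_chain2[OF abs_powr_has_derivative[OF p_gt_1] S_deriv])

lemma isCont_f: "isCont f x" using f_deriv DERIV_isCont by blast

lemma continuous_on_f [continuous_intros]: "continuous_on A g \<Longrightarrow> continuous_on A (\<lambda>x. f (g x))"
  using continuous_on_compose2[of UNIV f A g] isCont_f by (auto simp: continuous_at_imp_continuous_on)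

lemma f_nonneg [simp]: "f x \<ge> 0" by (simp add: f_def)

lemma f_le_1: "f x \<le> 1" using S_C_identity[of x] by (simp add: f_def) (smt (verit) powr_ge_zero)

lemma abs_S_le_1: "\<bar>S x\<bar> \<le> 1" and abs_C_le_1: "\<bar>C x\<bar> \<le> 1"
proof -
  have *: "\<bar>t\<bar> \<le> 1" if "\<bar>t\<bar> powr p \<le> 1" for t :: real
    using that p_gt_1 powr_less_mono2[of p 1 "\<bar>t\<bar>"] by (smt (verit) powr_one_eq_one)
  have "\<bar>S x\<bar> powr p \<le> 1" "\<bar>C x\<bar> powr p \<le> 1" using S_C_identity[of x] by (smt (verit) powr_ge_zero)+
  thus "\<bar>S x\<bar> \<le> 1" "\<bar>C x\<bar> \<le> 1" using * by auto
qed

text \<open>The derivative is bounded by \<open>p\<close> because \<open>S\<close> and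
  \<open>C\<close> have modulus at most \<open>1\<close>. This global bound for every
  \<open>p > 1\<close> is what the angle equation has and the first-order system for
  \<open>y\<close> lacks.\<close>

lemma f_lipschitz: "\<bar>f x - f y\<bar> \<le> p * \<bar>x - y\<bar>"
proof -
  have "norm (f x - f y) \<le> p * norm (x - y)"
  proof (rule field_differentiable_bound[of UNIV])
    fix z
    have "\<bar>spow (p - 1) (S z)\<bar> \<le> 1" using abs_S_le_1[of z] p_gt_1 by (simp add: abs_spow powr_le1)
    hence "\<bar>spow (p - 1) (S z)\<bar> * \<bar>C z\<bar> \<le> 1 * 1" using abs_C_le_1[of z] by (intro mult_mono) auto
    thus "norm (p * spow (p - 1) (S z) * C z) \<le> p" using p_gt_1 by (simp add: abs_mult mult_left_le mult.assoc)
  qed (auto intro: f_deriv)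
  thus ?thesis by simp
qed

lemma f_shift [simp]: "f (x + of_int k * b) = f x" by (simp add: f_def S_shift abs_mult)
lemma f_minus [simp]: "f (- x) = f x" by (simp add: f_def S_minus)
lemma f_reflect: "f (of_int k * b - x) = f x" using f_shift[of "-x" k] by simp

lemma f_pos: "0 < x \<Longrightarrow> x < b \<Longrightarrow> f x > 0" using S_pos[of x] by (simp add: f_def)

lemma f_eq_0D: assumes "f x = 0" obtains k :: int where "x = of_int k * b"
proof -
  obtain u k where u: "- b / 2 \<le> u" "u < b / 2" "x = u + of_int k * b" by (rule strip_decomp)
  have "f u = 0" using assms u by simp
  moreover have "f u > 0" if "u \<noteq> 0"
    using that f_pos[of u] f_pos[of "-u"] u b_pos by (cases "u > 0") auto
  ultimately have "u = 0" by force
  thus ?thesis using u that by auto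
qed

lemma f_mult_b [simp]: "f (of_int k * b) = 0" using f_shift[of 0 k] p_gt_1 by (simp add: f_def)

lemma f_0 [simp]: "f 0 = 0" using p_gt_1 by (simp add: f_def)

text \<open>On \<open>{0..b}\<close> the function increases up to \<open>b / 2\<close> and is
  symmetric about it; the hypotheses say that \<open>y\<close> is at least as far from both ends as
  \<open>x\<close> is from \<open>0\<close>.\<close>

lemma f_mono_half: assumes "0 \<le> x" "x \<le> y" "y \<le> b - x" shows "f x \<le> f y"
proof -
  have m: "f u \<le> f v" if "0 \<le> u" "u \<le> v" "v \<le> b/2" for u v
  proof -
    have "S u \<le> S v" using S_strict_mono_half[of u v] that b_pos by (cases "u = v") auto
    moreover have "S u \<ge> 0" using S_pos[of u] that b_pos by (cases "u = 0") auto
    ultimately show ?thesis using p_gt_1 by (simp add: f_def powr_mono2)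
  qed
  show ?thesis
  proof (cases "y \<le> b/2")
    case True thus ?thesis using m assms by auto
  next
    case False
    hence "f x \<le> f (b - y)" using assms by (intro m) auto
    thus ?thesis using f_reflect[of 1 y] by simp
  qed
qed

end

section \<open>The angle equation\<close>

context half_linear
begin

text \<open>The angle at scale \<open>s\<close>: solutions are \<open>y = r S(\<theta>)\<close>, \<open>y' = s r C(\<theta>)\<close>, and \<open>a = s^(1-p) (\<lambda> - q) - s\<close>.\<close>

definition pruefer :: "real \<Rightarrow> (real \<Rightarrow> real) \<Rightarrow> real \<Rightarrow> (real \<Rightarrow> real) \<Rightarrow> bool" where
  "pruefer s a c \<theta> \<longleftrightarrow> (\<exists>M. \<forall>x\<in>{0..c}. \<bar>a x\<bar> \<le> M) \<and> continuous_on {0..c} \<theta> \<and> \<theta> 0 = 0 \<and>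
     (\<exists>N. countable N \<and> (\<forall>x\<in>{0<..<c} - N. (\<theta> has_real_derivative s + a x * f (\<theta> x)) (at x)))"

text \<open>Covers the single-well potentials as well as the steps they are compared with. Countably
  many discontinuities are what lets the integral equation be differentiated off a countable
  set.\<close>

definition admissible :: "real \<Rightarrow> (real \<Rightarrow> real) \<Rightarrow> bool" where
  "admissible c a \<longleftrightarrow> (\<exists>M. \<forall>x\<in>{0..c}. \<bar>a x\<bar> \<le> M) \<and> a absolutely_integrable_on {0..c} \<and>
     (\<exists>N. countable N \<and> (\<forall>x\<in>{0<..<c} - N. isCont a x))"

lemma admissible_mult_integrable:
  assumes "admissible c a" "continuous_on {0..c} g" "0 \<le> x" "x \<le> c"
  shows "(\<lambda>t. a t * g t) integrable_on {0..x}"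
proof -
  have cg: "continuous_on {0..x} g" using assms by (auto intro: continuous_on_subset)
  have "a absolutely_integrable_on {0..x}"
    using assms by (auto simp: admissible_def intro: absolutely_integrable_on_subinterval)
  hence "(\<lambda>t. g t * a t) absolutely_integrable_on {0..x}"
    using cg by (intro absolutely_integrable_bounded_measurable_product_real)
      (auto intro!: continuous_imp_measurable_on_sets_lebesgue compact_imp_bounded compact_continuous_image)
  thus ?thesis using set_lebesgue_integral_eq_integral(1) by (simp add: mult.commute)
qed

lemma admissible_integral_deriv:
  assumes a: "admissible c a" and g: "continuous_on {0..c} g"
  obtains N where "countable N"
    "\<And>x. x \<in> {0<..<c} - N \<Longrightarrow> ((\<lambda>x. integral {0..x} (\<lambda>t. a t * g t)) has_real_derivative a x * g x) (at x)"
proof -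
  obtain N where N: "countable N" "\<And>x. x \<in> {0<..<c} - N \<Longrightarrow> isCont a x"
    using a by (auto simp: admissible_def)
  have "((\<lambda>x. integral {0..x} (\<lambda>t. a t * g t)) has_real_derivative a x * g x) (at x)" if x: "x \<in> {0<..<c} - N" for x
  proof -
    have "isCont g x" using continuous_on_interior[OF g, of x] x by simp
    hence "isCont (\<lambda>t. a t * g t) x" using N(2)[OF x] by (intro continuous_intros)
    hence "((\<lambda>x. integral {0..x} (\<lambda>t. a t * g t)) has_vector_derivative a x * g x) (at x within {0..c} - {})"
      using x by (intro integral_has_vector_derivative_continuous_at admissible_mult_integrable[OF a g])
        (auto intro: continuous_at_imp_continuous_at_within)
    thus ?thesis using x
      by (simp add: at_within_Icc_at has_real_derivative_iff_has_vector_derivative)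
  qed
  thus ?thesis using that N(1) by blast
qed

lemma admissible_integral_continuous:
  assumes "admissible c a" "continuous_on {0..c} g" "c \<ge> 0"
  shows "continuous_on {0..c} (\<lambda>x. integral {0..x} (\<lambda>t. a t * g t))"
  using assms by (intro indefinite_integral_continuous_1 admissible_mult_integrable[OF assms(1,2)]) auto

text \<open>Picard iteration, contracting in the norm weighted by \<open>exp (- 2 L x)\<close>.\<close>

lemma pruefer_exists:
  assumes a: "admissible c a" and c: "c \<ge> 0"
  shows "\<exists>\<theta>. pruefer s a c \<theta>"
proof -
  obtain M0 where M0: "\<And>x. x \<in> {0..c} \<Longrightarrow> \<bar>a x\<bar> \<le> M0" using a unfolding admissible_def by blast
  define M where "M = \<bar>M0\<bar> + 1"
  have M: "\<And>x. x \<in> {0..c} \<Longrightarrow> \<bar>a x\<bar> \<le> M" "M > 0" using M0 by (force simp: M_def)+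
  define L where "L = M * p"
  have L: "L > 0" using M p_gt_1 by (simp add: L_def)
  define th where "th = rec_nat (\<lambda>x. 0) (\<lambda>_ \<theta> x. s * x + integral {0..x} (\<lambda>t. a t * f (\<theta> t)))"
  have th0: "th 0 = (\<lambda>x. 0)" and thS: "th (Suc n) = (\<lambda>x. s * x + integral {0..x} (\<lambda>t. a t * f (th n t)))" for n
    by (simp_all add: th_def)
  have cth: "continuous_on {0..c} (th n)" for n
  proof (induction n)
    case (Suc n)
    show ?case unfolding thS
      by (intro continuous_intros admissible_integral_continuous[OF a _ c] Suc)
  qed (simp add: th0)
  define A where "A = \<bar>s\<bar> * c + M * c"
  have A: "A \<ge> 0" using M c by (simp add: A_def)
  have bound: "\<bar>th (Suc n) x - th n x\<bar> \<le> A * (1/2)^n * exp (2 * L * x)" if "x \<in> {0..c}" for n x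
    using that
  proof (induction n arbitrary: x)
    case 0
    have "norm (integral {0..x} (\<lambda>t. a t * f (th 0 t))) \<le> M * (x - 0)"
    proof (rule integral_bound)
      show "continuous_on {0..x} (\<lambda>t. a t * f (th 0 t))" by (simp add: th0)
      show "norm (a t * f (th 0 t)) \<le> M" if "t \<in> {0..x}" for t using M by (simp add: th0)
    qed (use 0 in auto)
    hence "\<bar>th (Suc 0) x - th 0 x\<bar> \<le> \<bar>s\<bar> * x + M * x" using 0 by (simp add: thS th0 abs_mult)
    also have "\<dots> \<le> A * 1" unfolding A_def using 0 M by (auto intro!: add_mono mult_left_mono)
    also have "\<dots> \<le> A * exp (2 * L * x)" using A L 0 by (intro mult_left_mono) auto
    finally show ?case by simp
  next
    case (Suc n)
    have int: "(\<lambda>t. a t * f (th k t)) integrable_on {0..x}" for k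
      using Suc.prems by (intro admissible_mult_integrable[OF a]) (auto intro!: continuous_intros cth)
    \<comment> \<open>Integrating the weight gains \<open>1 / (2 * L)\<close> against the Lipschitz
      constant \<open>L\<close>; this is the contraction factor \<open>1/2\<close>.\<close>
    have ie: "((\<lambda>t. L * (A * (1/2)^n * exp (2 * L * t))) has_integral
        A * (1/2)^Suc n * exp (2 * L * x) - A * (1/2)^Suc n * exp (2 * L * 0)) {0..x}"
      using Suc.prems
      by (intro fundamental_theorem_of_calculus)
         (auto simp: has_real_derivative_iff_has_vector_derivative[symmetric] intro!: derivative_eq_intros)
    have "th (Suc (Suc n)) x - th (Suc n) x = integral {0..x} (\<lambda>t. a t * f (th (Suc n) t)) - integral {0..x} (\<lambda>t. a t * f (th n t))"
      by (simp only: thS)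
    also have "\<dots> = integral {0..x} (\<lambda>t. a t * f (th (Suc n) t) - a t * f (th n t))"
      by (rule integral_diff[symmetric, OF int int])
    finally have "\<bar>th (Suc (Suc n)) x - th (Suc n) x\<bar> = norm (integral {0..x} (\<lambda>t. a t * f (th (Suc n) t) - a t * f (th n t)))"
      by simp
    also have "\<dots> \<le> integral {0..x} (\<lambda>t. L * (A * (1/2)^n * exp (2 * L * t)))"
    proof (rule integral_norm_bound_integral)
      fix t assume t: "t \<in> {0..x}"
      have "norm (a t * f (th (Suc n) t) - a t * f (th n t)) = \<bar>a t\<bar> * \<bar>f (th (Suc n) t) - f (th n t)\<bar>"
        by (simp add: right_diff_distrib[symmetric] abs_mult)
      also have "\<dots> \<le> M * (p * \<bar>th (Suc n) t - th n t\<bar>)"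
        using M t Suc.prems by (intro mult_mono f_lipschitz) auto
      also have "\<dots> \<le> M * (p * (A * (1/2)^n * exp (2 * L * t)))"
        using M p_gt_1 t Suc.prems by (intro mult_left_mono Suc.IH) auto
      finally show "norm (a t * f (th (Suc n) t) - a t * f (th n t)) \<le> L * (A * (1/2)^n * exp (2 * L * t))"
        by (simp add: L_def mult.assoc)
    qed (use int ie in \<open>auto intro!: integrable_diff\<close>)
    also have "\<dots> \<le> A * (1/2)^Suc n * exp (2 * L * x)" using integral_unique[OF ie] A by simp
    finally show ?case .
  qed
  define \<theta> where "\<theta> x = (\<Sum>i. th (Suc i) x - th i x)" for x
  have ul: "uniform_limit {0..c} th \<theta> sequentially"
  proof -
    have "uniform_limit {0..c} (\<lambda>n x. \<Sum>i<n. th (Suc i) x - th i x) (\<lambda>x. \<Sum>i. th (Suc i) x - th i x) sequentially"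
    proof (rule Weierstrass_m_test)
      show "summable (\<lambda>n. A * (1/2)^n * exp (2 * L * c))"
        by (intro summable_mult2 summable_mult summable_geometric) simp
      fix n x assume x: "x \<in> {0..c}"
      have "\<bar>th (Suc n) x - th n x\<bar> \<le> A * (1/2)^n * exp (2 * L * x)" by (rule bound[OF x])
      also have "\<dots> \<le> A * (1/2)^n * exp (2 * L * c)" using A L x by (intro mult_left_mono) auto
      finally show "norm (th (Suc n) x - th n x) \<le> A * (1/2)^n * exp (2 * L * c)" by simp
    qed
    thus ?thesis by (simp add: sum_lessThan_telescope[of "\<lambda>n. th n _"] th0 \<theta>_def[abs_def])
  qed
  have c\<theta>: "continuous_on {0..c} \<theta>"
    by (rule uniform_limit_theorem[OF _ ul]) (simp_all add: cth)
  have eq: "\<theta> x = s * x + integral {0..x} (\<lambda>t. a t * f (\<theta> t))" if x: "x \<in> {0..c}" for x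
  proof (rule LIMSEQ_unique)
    have "(\<lambda>n. th n x) \<longlonglongrightarrow> \<theta> x" using tendsto_uniform_limitI[OF ul x] .
    thus "(\<lambda>n. th (Suc n) x) \<longlonglongrightarrow> \<theta> x" by (rule LIMSEQ_Suc)
    have "(\<lambda>n. integral {0..x} (\<lambda>t. a t * f (th n t))) \<longlonglongrightarrow> integral {0..x} (\<lambda>t. a t * f (\<theta> t))"
    proof (rule LIMSEQ_I)
      fix r :: real assume r: "r > 0"
      \<comment> \<open>The summand \<open>1\<close> keeps the denominator positive for
        \<open>c = 0\<close> and makes the final estimate strict.\<close>
      define e where "e = r / (L * (c + 1))"
      have e: "e > 0" using r L c by (simp add: e_def)
      obtain n0 where n0: "\<And>n t. n \<ge> n0 \<Longrightarrow> t \<in> {0..c} \<Longrightarrow> dist (th n t) (\<theta> t) < e"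
        using uniform_limitD[OF ul e] unfolding eventually_sequentially by blast
      have "norm (integral {0..x} (\<lambda>t. a t * f (th n t)) - integral {0..x} (\<lambda>t. a t * f (\<theta> t))) < r" if n: "n \<ge> n0" for n
      proof -
        have i1: "(\<lambda>t. a t * f (th n t)) integrable_on {0..x}" and i2: "(\<lambda>t. a t * f (\<theta> t)) integrable_on {0..x}"
          using x by (auto intro!: admissible_mult_integrable[OF a] continuous_intros cth c\<theta>)
        have "norm (integral {0..x} (\<lambda>t. a t * f (th n t)) - integral {0..x} (\<lambda>t. a t * f (\<theta> t))) =
           norm (integral {0..x} (\<lambda>t. a t * f (th n t) - a t * f (\<theta> t)))"
          by (simp add: integral_diff[OF i1 i2])
        also have "\<dots> \<le> integral {0..x} (\<lambda>t. L * e)"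
        proof (rule integral_norm_bound_integral)
          fix t assume t: "t \<in> {0..x}"
          have "norm (a t * f (th n t) - a t * f (\<theta> t)) = \<bar>a t\<bar> * \<bar>f (th n t) - f (\<theta> t)\<bar>"
            by (simp add: right_diff_distrib[symmetric] abs_mult)
          also have "\<dots> \<le> M * (p * \<bar>th n t - \<theta> t\<bar>)"
            using M t x by (intro mult_mono f_lipschitz) auto
          also have "\<dots> \<le> M * (p * e)"
            using M p_gt_1 t x n0[OF n, of t] by (intro mult_left_mono) (auto simp: dist_real_def)
          finally show "norm (a t * f (th n t) - a t * f (\<theta> t)) \<le> L * e" by (simp add: L_def)
        qed (use i1 i2 in \<open>auto intro!: integrable_diff\<close>)
        also have "\<dots> \<le> L * e * c" using x L e by simp
        also have "\<dots> < L * e * (c + 1)" using L e by simp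
        also have "\<dots> = r" using L c by (simp add: e_def)
        finally show ?thesis .
      qed
      thus "\<exists>no. \<forall>n\<ge>no. norm (integral {0..x} (\<lambda>t. a t * f (th n t)) - integral {0..x} (\<lambda>t. a t * f (\<theta> t))) < r" by blast
    qed
    thus "(\<lambda>n. th (Suc n) x) \<longlonglongrightarrow> s * x + integral {0..x} (\<lambda>t. a t * f (\<theta> t))"
      unfolding thS by (intro tendsto_intros)
  qed
  have cf: "continuous_on {0..c} (\<lambda>t. f (\<theta> t))" by (intro continuous_intros c\<theta>)
  obtain N where N: "countable N"
    "\<And>x. x \<in> {0<..<c} - N \<Longrightarrow> ((\<lambda>x. integral {0..x} (\<lambda>t. a t * f (\<theta> t))) has_real_derivative a x * f (\<theta> x)) (at x)"
    using admissible_integral_deriv[OF a cf] by blast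
  have "(\<theta> has_real_derivative s + a x * f (\<theta> x)) (at x)" if x: "x \<in> {0<..<c} - N" for x
  proof -
    have "((\<lambda>x. s * x + integral {0..x} (\<lambda>t. a t * f (\<theta> t))) has_real_derivative s + a x * f (\<theta> x)) (at x)"
      using DERIV_add[OF DERIV_cmult_Id[of s] N(2)[OF x]] by simp
    moreover have "\<forall>\<^sub>F y in nhds x. \<theta> y = s * y + integral {0..y} (\<lambda>t. a t * f (\<theta> t))"
      using eventually_nhds_in_open[of "{0<..<c}" x] x eq by (auto elim!: eventually_mono)
    ultimately show ?thesis by (simp add: DERIV_cong_ev[OF refl _ refl])
  qed
  moreover have "\<theta> 0 = 0" using eq[of 0] c by simp
  ultimately show ?thesis using c\<theta> N(1) a unfolding pruefer_def admissible_def by blast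
qed

section \<open>Comparison, crossings, rigidity and dependence on the coefficient\<close>

lemma pruefer_bound:
  assumes "pruefer s a c \<theta>"
  obtains M where "M > 0" "\<And>x. x \<in> {0..c} \<Longrightarrow> \<bar>a x\<bar> \<le> M"
proof -
  obtain M where M: "\<And>x. x \<in> {0..c} \<Longrightarrow> \<bar>a x\<bar> \<le> M" using assms unfolding pruefer_def by blast
  show ?thesis by (rule that[of "\<bar>M\<bar> + 1"]) (use M in force)+
qed

lemma pruefer_cont: "pruefer s a c \<theta> \<Longrightarrow> continuous_on {0..c} \<theta>"
  and pruefer_0: "pruefer s a c \<theta> \<Longrightarrow> \<theta> 0 = 0"
  by (auto simp: pruefer_def)

lemma pruefer_deriv:
  assumes "pruefer s a c \<theta>"
  obtains N where "countable N" "\<And>x. x \<in> {0<..<c} - N \<Longrightarrow> (\<theta> has_real_derivative s + a x * f (\<theta> x)) (at x)"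
  using assms by (auto simp: pruefer_def)

lemma pruefer_restrict: "pruefer s a c \<theta> \<Longrightarrow> c' \<le> c \<Longrightarrow> pruefer s a c' \<theta>"
  unfolding pruefer_def by (force intro: continuous_on_subset)

lemma pruefer_cong:
  assumes "pruefer s a c \<theta>" "\<And>x. x \<in> {0..c} \<Longrightarrow> a x = a' x"
  shows "pruefer s a' c \<theta>"
  using assms unfolding pruefer_def by (metis (no_types, lifting) DiffD1 atLeastAtMost_iff greaterThanLessThan_iff less_imp_le)

text \<open>\<open>f\<close> is even and has period \<open>b\<close>, so reflecting both the
  variable and the angle preserves the equation. The angle must end at a multiple of
  \<open>b\<close> for the reflected one to start at \<open>0\<close>.\<close>

lemma pruefer_reverse:
  assumes "pruefer s a c \<theta>" "\<theta> c = of_int n * b" "c \<ge> 0"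
  shows "pruefer s (\<lambda>x. a (c - x)) c (\<lambda>x. of_int n * b - \<theta> (c - x))"
proof -
  obtain M where M: "\<And>x. x \<in> {0..c} \<Longrightarrow> \<bar>a x\<bar> \<le> M" using assms unfolding pruefer_def by blast
  obtain N where N: "countable N" "\<And>x. x \<in> {0<..<c} - N \<Longrightarrow> (\<theta> has_real_derivative s + a x * f (\<theta> x)) (at x)"
    using pruefer_deriv[OF assms(1)] by blast
  have "\<forall>x\<in>{0..c}. \<bar>a (c - x)\<bar> \<le> M" using M by auto
  moreover have "continuous_on {0..c} (\<lambda>x. of_int n * b - \<theta> (c - x))"
    by (intro continuous_intros continuous_on_compose2[OF pruefer_cont[OF assms(1)]]) auto
  moreover have "((\<lambda>x. of_int n * b - \<theta> (c - x)) has_real_derivative s + a (c - x) * f (of_int n * b - \<theta> (c - x))) (at x)"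
    if x: "x \<in> {0<..<c} - (\<lambda>x. c - x) ` N" for x
  proof -
    have "c - x \<notin> N" using x by force
    hence "(\<theta> has_real_derivative s + a (c - x) * f (\<theta> (c - x))) (at (c - x))" using x N(2)[of "c - x"] by auto
    hence "((\<lambda>x. \<theta> (c - x)) has_real_derivative (s + a (c - x) * f (\<theta> (c - x))) * (- 1)) (at x)"
      by (rule DERIV_chain2) (auto intro!: derivative_eq_intros)
    from DERIV_diff[OF DERIV_const[of "of_int n * b"] this] show ?thesis by (simp add: f_reflect add.commute)
  qed
  ultimately show ?thesis using assms N(1) unfolding pruefer_def
    by (intro conjI exI[of _ M] exI[of _ "(\<lambda>x. c - x) ` N"]) auto
qed

text \<open>The difference of the right-hand sides is
  \<open>(a2 - a1) * f \<theta>2 + a1 * (f \<theta>2 - f \<theta>1)\<close>. The first term is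
  nonnegative because \<open>f\<close> is, the second is controlled by the Lipschitz bound; this is
  the form that both Gronwall lemmas accept.\<close>

lemma pruefer_diff_deriv:
  assumes P1: "pruefer s a1 c \<theta>1" and P2: "pruefer s a2 c \<theta>2" and x0: "0 \<le> x0" "x1 \<le> c"
    and le: "\<And>x. x \<in> {x0<..<x1} \<Longrightarrow> a1 x \<le> a2 x"
  obtains K N where "countable N" "\<And>x. x \<in> {x0<..<x1} - N \<Longrightarrow>
     \<exists>d. ((\<lambda>x. \<theta>2 x - \<theta>1 x) has_real_derivative d) (at x) \<and> d \<ge> - K * \<bar>\<theta>2 x - \<theta>1 x\<bar>"
proof -
  obtain N1 where N1: "countable N1" "\<And>x. x \<in> {0<..<c} - N1 \<Longrightarrow> (\<theta>1 has_real_derivative s + a1 x * f (\<theta>1 x)) (at x)"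
    using pruefer_deriv[OF P1] by blast
  obtain N2 where N2: "countable N2" "\<And>x. x \<in> {0<..<c} - N2 \<Longrightarrow> (\<theta>2 has_real_derivative s + a2 x * f (\<theta>2 x)) (at x)"
    using pruefer_deriv[OF P2] by blast
  obtain M where M: "M > 0" "\<And>x. x \<in> {0..c} \<Longrightarrow> \<bar>a1 x\<bar> \<le> M" using pruefer_bound[OF P1] by blast
  show ?thesis
  proof (rule that[of "N1 \<union> N2" "M * p"])
    fix x assume x: "x \<in> {x0<..<x1} - (N1 \<union> N2)"
    have d: "((\<lambda>x. \<theta>2 x - \<theta>1 x) has_real_derivative (s + a2 x * f (\<theta>2 x)) - (s + a1 x * f (\<theta>1 x))) (at x)"
      using x x0 by (intro DERIV_diff N1(2) N2(2)) auto
    have "a1 x * f (\<theta>2 x) \<le> a2 x * f (\<theta>2 x)" using x le by (intro mult_right_mono) auto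
    moreover have "\<bar>a1 x * (f (\<theta>2 x) - f (\<theta>1 x))\<bar> \<le> M * (p * \<bar>\<theta>2 x - \<theta>1 x\<bar>)"
      unfolding abs_mult using x x0 M by (intro mult_mono f_lipschitz) auto
    ultimately have "(s + a2 x * f (\<theta>2 x)) - (s + a1 x * f (\<theta>1 x)) \<ge> - (M * p) * \<bar>\<theta>2 x - \<theta>1 x\<bar>"
      by (simp add: algebra_simps abs_le_iff)
    with d show "\<exists>d. ((\<lambda>x. \<theta>2 x - \<theta>1 x) has_real_derivative d) (at x) \<and> d \<ge> - (M * p) * \<bar>\<theta>2 x - \<theta>1 x\<bar>" by blast
  qed (use N1 N2 in auto)
qed

lemma pruefer_le:
  assumes P1: "pruefer s a1 c \<theta>1" and P2: "pruefer s a2 c \<theta>2" and x0: "0 \<le> x0" "x1 \<le> c"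
    and le: "\<And>x. x \<in> {x0<..<x1} \<Longrightarrow> a1 x \<le> a2 x" and i: "\<theta>1 x0 \<le> \<theta>2 x0" and x: "x \<in> {x0..x1}"
  shows "\<theta>1 x \<le> \<theta>2 x"
proof -
  obtain N K where KN: "countable N" "\<And>x. x \<in> {x0<..<x1} - N \<Longrightarrow>
     \<exists>d. ((\<lambda>x. \<theta>2 x - \<theta>1 x) has_real_derivative d) (at x) \<and> d \<ge> - K * \<bar>\<theta>2 x - \<theta>1 x\<bar>"
    by (rule pruefer_diff_deriv[OF P1 P2 x0 le], assumption) (rule that, assumption, blast)
  have c: "continuous_on {x0..x1} (\<lambda>x. \<theta>2 x - \<theta>1 x)"
    using x0 by (intro continuous_intros continuous_on_subset[OF pruefer_cont[OF P1]] continuous_on_subset[OF pruefer_cont[OF P2]]) auto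
  have "\<theta>2 x - \<theta>1 x \<ge> 0"
    by (rule gronwall_nonneg[OF c KN(1) _ KN(2) x]) (use i in auto)
  thus ?thesis by simp
qed

lemma pruefer_less:
  assumes P1: "pruefer s a1 c \<theta>1" and P2: "pruefer s a2 c \<theta>2" and x0: "0 \<le> x0" "x1 \<le> c"
    and le: "\<And>x. x \<in> {x0<..<x1} \<Longrightarrow> a1 x \<le> a2 x" and i: "\<theta>1 x0 < \<theta>2 x0" and x: "x \<in> {x0..x1}"
  shows "\<theta>1 x < \<theta>2 x"
proof -
  obtain N K where KN: "countable N" "\<And>x. x \<in> {x0<..<x1} - N \<Longrightarrow>
     \<exists>d. ((\<lambda>x. \<theta>2 x - \<theta>1 x) has_real_derivative d) (at x) \<and> d \<ge> - K * \<bar>\<theta>2 x - \<theta>1 x\<bar>"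
    by (rule pruefer_diff_deriv[OF P1 P2 x0 le], assumption) (rule that, assumption, blast)
  have c: "continuous_on {x0..x1} (\<lambda>x. \<theta>2 x - \<theta>1 x)"
    using x0 by (intro continuous_intros continuous_on_subset[OF pruefer_cont[OF P1]] continuous_on_subset[OF pruefer_cont[OF P2]]) auto
  have "\<theta>2 x - \<theta>1 x > 0"
    by (rule gronwall_pos[OF c KN(1) _ KN(2) x]) (use i in auto)
  thus ?thesis by simp
qed

lemma pruefer_unique:
  assumes "pruefer s a c \<theta>1" "pruefer s a c \<theta>2" "x \<in> {0..c}"
  shows "\<theta>1 x = \<theta>2 x"
  using pruefer_le[OF assms(1,2), of 0 c x] pruefer_le[OF assms(2,1), of 0 c x] assms
  by (simp add: pruefer_0)

lemma nonempty_interval_minus_countable: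
  assumes "countable N" "x0 < (x1::real)" obtains x where "x \<in> {x0<..<x1} - N"
  using assms uncountable_minus_countable[OF _ assms(1), of "{x0<..<x1}"]
  by (metis countable_empty ex_in_conv uncountable_open_interval)

text \<open>\<open>f\<close> vanishes at multiples of \<open>b\<close>, so the angle passes them
  with slope \<open>s > 0\<close> whatever the coefficient is. As the crossing point may be
  exceptional, the argument is indirect: by Gronwall the angle cannot fall below the multiple, and
  if it met it again it would stay on it, against the slope \<open>s\<close> at a nearby regular
  point.\<close>

lemma pruefer_crossing:
  assumes P: "pruefer s a c \<theta>" and s: "s > 0" and x: "0 \<le> x0" "x0 < x1" "x1 \<le> c"
    and j: "\<theta> x0 \<ge> of_int j * b"
  shows "\<theta> x1 > of_int j * b"
proof -
  define D where "D x = \<theta> x - of_int j * b" for x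
  obtain N where N: "countable N" "\<And>x. x \<in> {0<..<c} - N \<Longrightarrow> (\<theta> has_real_derivative s + a x * f (\<theta> x)) (at x)"
    using pruefer_deriv[OF P] by blast
  obtain M where M: "M > 0" "\<And>x. x \<in> {0..c} \<Longrightarrow> \<bar>a x\<bar> \<le> M" using pruefer_bound[OF P] by blast
  have dD: "(D has_real_derivative s + a x * f (\<theta> x)) (at x)" if "x \<in> {0<..<c} - N" for x
    using DERIV_diff[OF N(2)[OF that] DERIV_const, of "of_int j * b"] by (simp add: D_def[abs_def])
  have bd: "\<bar>a x * f (\<theta> x)\<bar> \<le> M * p * \<bar>D x\<bar>" if "x \<in> {0..c}" for x
  proof -
    have "\<bar>f (\<theta> x) - f (of_int j * b)\<bar> \<le> p * \<bar>D x\<bar>" unfolding D_def by (rule f_lipschitz)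
    hence "\<bar>a x\<bar> * \<bar>f (\<theta> x)\<bar> \<le> M * (p * \<bar>D x\<bar>)" using M(2)[OF that] M(1) by (intro mult_mono) auto
    thus ?thesis by (simp add: abs_mult)
  qed
  have cD: "continuous_on {x0..x1} D" unfolding D_def using x
    by (intro continuous_intros continuous_on_subset[OF pruefer_cont[OF P]]) auto
  have der: "\<exists>d. (D has_real_derivative d) (at x) \<and> d \<ge> - (M * p) * \<bar>D x\<bar>" if "x \<in> {x0<..<x1} - N" for x
    using dD[of x] bd[of x] that x s by (intro exI[of _ "s + a x * f (\<theta> x)"]) (auto simp: abs_le_iff)
  have nn: "D x \<ge> 0" if "x \<in> {x0..x1}" for x
    by (rule gronwall_nonneg[OF cD N(1) _ der that]) (use j in \<open>simp_all add: D_def\<close>)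
  have "D x1 > 0"
  proof (rule ccontr)
    assume "\<not> D x1 > 0"
    hence 0: "D x1 = 0" using nn[of x1] x by simp
    have z: "D x = 0" if xx: "x \<in> {x0..x1}" for x
    proof (rule ccontr)
      assume "D x \<noteq> 0" hence "D x > 0" using nn[OF xx] by simp
      hence "D x1 > 0" using xx
        by (intro gronwall_pos[of x x1 D N "M * p" x1] N(1) der) (auto intro: continuous_on_subset[OF cD])
      thus False using 0 by simp
    qed
    obtain y where y: "y \<in> {x0<..<x1} - N" using nonempty_interval_minus_countable[OF N(1) x(2)] by blast
    have "\<forall>\<^sub>F t in nhds y. D t = 0"
      using eventually_nhds_in_open[of "{x0<..<x1}" y] y z by (auto elim!: eventually_mono)
    hence "(D has_real_derivative 0) (at y)" by (simp add: DERIV_cong_ev[OF refl _ refl])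
    moreover have "(D has_real_derivative s + a y * f (\<theta> y)) (at y)" using dD[of y] y x by auto
    ultimately have "s + a y * f (\<theta> y) = 0" using DERIV_unique by blast
    moreover have "\<bar>a y * f (\<theta> y)\<bar> \<le> 0" using bd[of y] z[of y] y x by auto
    ultimately show False using s by simp
  qed
  thus ?thesis by (simp add: D_def)
qed

lemma pruefer_pos:
  assumes "pruefer s a c \<theta>" "s > 0" "0 < x" "x \<le> c" shows "\<theta> x > 0"
  using pruefer_crossing[OF assms(1,2), of 0 x 0] assms pruefer_0[OF assms(1)] by simp

text \<open>By \<open>pruefer_crossing\<close> each multiple of \<open>b\<close> is attained at most
  once.\<close>

lemma pruefer_zeros_countable:
  assumes P: "pruefer s a c \<theta>" and s: "s > 0"
  shows "countable {x \<in> {0..c}. f (\<theta> x) = 0}"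
proof (rule countable_subset)
  show "{x \<in> {0..c}. f (\<theta> x) = 0} \<subseteq> (\<Union>k::int. {x \<in> {0..c}. \<theta> x = of_int k * b})"
    by (auto elim: f_eq_0D)
  have "countable {x \<in> {0..c}. \<theta> x = of_int k * b}" for k :: int
  proof -
    have "x = y" if "x \<in> {0..c}" "y \<in> {0..c}" "\<theta> x = of_int k * b" "\<theta> y = of_int k * b" for x y
      using pruefer_crossing[OF P s, of x y k] pruefer_crossing[OF P s, of y x k] that
      by (cases x y rule: linorder_cases) auto
    hence "{x \<in> {0..c}. \<theta> x = of_int k * b} = {} \<or> (\<exists>x. {x \<in> {0..c}. \<theta> x = of_int k * b} = {x})" by blast
    thus ?thesis by (metis countable_empty countable_insert)
  qed
  thus "countable (\<Union>k::int. {x \<in> {0..c}. \<theta> x = of_int k * b})" by auto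
qed

text \<open>A strict ordering at some point would persist up to \<open>x1\<close>, so the angles
  agree on the whole interval. Then their derivatives agree, and \<open>f\<close> of the angle can
  be cancelled off its countable zero set.\<close>

lemma pruefer_rigid:
  assumes P1: "pruefer s a1 c \<theta>1" and P2: "pruefer s a2 c \<theta>2" and s: "s > 0" and x0: "0 \<le> x0" "x0 < x1" "x1 \<le> c"
    and le: "\<And>x. x \<in> {x0<..<x1} \<Longrightarrow> a1 x \<le> a2 x" and i: "\<theta>1 x0 \<le> \<theta>2 x0" and e: "\<theta>1 x1 = \<theta>2 x1"
  obtains N where "countable N" "\<And>x. x \<in> {x0<..<x1} - N \<Longrightarrow> a1 x = a2 x"
proof -
  obtain N1 where N1: "countable N1" "\<And>x. x \<in> {0<..<c} - N1 \<Longrightarrow> (\<theta>1 has_real_derivative s + a1 x * f (\<theta>1 x)) (at x)"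
    using pruefer_deriv[OF P1] by blast
  obtain N2 where N2: "countable N2" "\<And>x. x \<in> {0<..<c} - N2 \<Longrightarrow> (\<theta>2 has_real_derivative s + a2 x * f (\<theta>2 x)) (at x)"
    using pruefer_deriv[OF P2] by blast
  have eq: "\<theta>1 x = \<theta>2 x" if x: "x \<in> {x0..x1}" for x
  proof (rule antisym)
    show "\<theta>1 x \<le> \<theta>2 x" by (rule pruefer_le[OF P1 P2 x0(1,3) le i x])
    show "\<theta>2 x \<le> \<theta>1 x"
    proof (rule ccontr)
      assume "\<not> \<theta>2 x \<le> \<theta>1 x"
      hence "\<theta>1 x1 < \<theta>2 x1" using x x0 le by (intro pruefer_less[OF P1 P2, of x x1 x1]) auto
      thus False using e by simp
    qed
  qed
  show ?thesis
  proof (rule that[of "N1 \<union> N2 \<union> {x \<in> {0..c}. f (\<theta>1 x) = 0}"])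
    fix x assume x: "x \<in> {x0<..<x1} - (N1 \<union> N2 \<union> {x \<in> {0..c}. f (\<theta>1 x) = 0})"
    have "\<forall>\<^sub>F t in nhds x. \<theta>1 t = \<theta>2 t"
      using eventually_nhds_in_open[of "{x0<..<x1}" x] x eq by (auto elim!: eventually_mono)
    moreover have "(\<theta>2 has_real_derivative s + a2 x * f (\<theta>2 x)) (at x)" using N2(2)[of x] x x0 by auto
    ultimately have "(\<theta>1 has_real_derivative s + a2 x * f (\<theta>2 x)) (at x)" by (simp add: DERIV_cong_ev[OF refl _ refl])
    moreover have "(\<theta>1 has_real_derivative s + a1 x * f (\<theta>1 x)) (at x)" using N1(2)[of x] x x0 by auto
    ultimately have "s + a2 x * f (\<theta>2 x) = s + a1 x * f (\<theta>1 x)" using DERIV_unique by blast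
    thus "a1 x = a2 x" using eq[of x] x x0 by auto
  qed (use N1(1) N2(1) pruefer_zeros_countable[OF P1 s] in auto)
qed

lemma pruefer_less_strict:
  assumes P1: "pruefer s a1 c \<theta>1" and P2: "pruefer s a2 c \<theta>2" and s: "s > 0" and x0: "0 \<le> x0" "x0 < x1" "x1 \<le> c"
    and less: "\<And>x. x \<in> {x0<..<x1} \<Longrightarrow> a1 x < a2 x" and i: "\<theta>1 x0 \<le> \<theta>2 x0"
  shows "\<theta>1 x1 < \<theta>2 x1"
proof (rule ccontr)
  assume "\<not> ?thesis"
  moreover have "\<theta>1 x1 \<le> \<theta>2 x1"
    by (rule pruefer_le[OF P1 P2 x0(1,3) less_imp_le[OF less] i]) (use x0 in auto)
  ultimately have "\<theta>1 x1 = \<theta>2 x1" by simp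
  then obtain N where "countable N" "\<And>x. x \<in> {x0<..<x1} - N \<Longrightarrow> a1 x = a2 x"
    using pruefer_rigid[OF P1 P2 s x0 less_imp_le[OF less] i] by blast
  thus False using nonempty_interval_minus_countable[of N x0 x1] less x0 by (metis DiffD1 less_irrefl)
qed

text \<open>The bound is a supersolution of \<open>u' = e + M * p * u\<close>, the inequality that
  the modulus of the difference obeys. The factor \<sigma> treats both signs of the difference at
  once.\<close>

lemma pruefer_cont_dependence:
  assumes P1: "pruefer s a1 c \<theta>1" and P2: "pruefer s a2 c \<theta>2"
    and M: "\<And>x. x \<in> {0..c} \<Longrightarrow> \<bar>a1 x\<bar> \<le> M" "M \<ge> 0"
    and e: "\<And>x. x \<in> {0..c} \<Longrightarrow> \<bar>a2 x - a1 x\<bar> \<le> e" "e \<ge> 0" and x: "x \<in> {0..c}"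
  shows "\<bar>\<theta>2 x - \<theta>1 x\<bar> \<le> e * x * exp (M * p * x)"
proof -
  define L where "L = M * p"
  have L: "L \<ge> 0" using M p_gt_1 by (simp add: L_def)
  obtain N1 where N1: "countable N1" "\<And>x. x \<in> {0<..<c} - N1 \<Longrightarrow> (\<theta>1 has_real_derivative s + a1 x * f (\<theta>1 x)) (at x)"
    using pruefer_deriv[OF P1] by blast
  obtain N2 where N2: "countable N2" "\<And>x. x \<in> {0<..<c} - N2 \<Longrightarrow> (\<theta>2 has_real_derivative s + a2 x * f (\<theta>2 x)) (at x)"
    using pruefer_deriv[OF P2] by blast
  have main: "\<sigma> * (\<theta>2 x - \<theta>1 x) \<le> e * x * exp (L * x)" if \<sigma>: "\<bar>\<sigma>\<bar> = 1" for \<sigma>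
  proof -
    define E where "E x = e * x * exp (L * x) - \<sigma> * (\<theta>2 x - \<theta>1 x)" for x
    have "E x \<ge> 0"
    proof (rule gronwall_nonneg[where N="N1 \<union> N2" and K=L, OF _ _ _ _ x])
      show "continuous_on {0..c} E" unfolding E_def
        by (intro continuous_intros pruefer_cont[OF P1] pruefer_cont[OF P2])
      show "0 \<le> E 0" using pruefer_0[OF P1] pruefer_0[OF P2] by (simp add: E_def)
      fix y assume y: "y \<in> {0<..<c} - (N1 \<union> N2)" and neg: "E y < 0"
      define d where "d = \<sigma> * ((s + a2 y * f (\<theta>2 y)) - (s + a1 y * f (\<theta>1 y)))"
      have dE: "(E has_real_derivative (e * exp (L * y) + e * y * (L * exp (L * y))) - d) (at y)"
        unfolding E_def d_def using y N1(2)[of y] N2(2)[of y]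
        by (intro DERIV_diff DERIV_cmult) (auto intro!: derivative_eq_intros simp: algebra_simps)
      have "d \<le> e + L * (\<sigma> * (\<theta>2 y - \<theta>1 y))"
      proof -
        have "\<sigma> * (\<theta>2 y - \<theta>1 y) > e * y * exp (L * y)" using neg by (simp add: E_def)
        moreover have "e * y * exp (L * y) \<ge> 0" using e y by simp
        ultimately have "\<sigma> * (\<theta>2 y - \<theta>1 y) \<ge> 0" by linarith
        hence ab: "\<bar>\<theta>2 y - \<theta>1 y\<bar> = \<sigma> * (\<theta>2 y - \<theta>1 y)"
          using \<sigma> by (metis abs_mult abs_of_nonneg mult_1)
        have "d = \<sigma> * ((a2 y - a1 y) * f (\<theta>2 y)) + \<sigma> * (a1 y * (f (\<theta>2 y) - f (\<theta>1 y)))"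
          by (simp add: d_def algebra_simps)
        also have "\<dots> \<le> \<bar>\<sigma> * ((a2 y - a1 y) * f (\<theta>2 y))\<bar> + \<bar>\<sigma> * (a1 y * (f (\<theta>2 y) - f (\<theta>1 y)))\<bar>" by linarith
        also have "\<dots> = \<bar>a2 y - a1 y\<bar> * f (\<theta>2 y) + \<bar>a1 y\<bar> * \<bar>f (\<theta>2 y) - f (\<theta>1 y)\<bar>"
          using \<sigma> by (simp add: abs_mult)
        also have "\<dots> \<le> e * 1 + M * (p * \<bar>\<theta>2 y - \<theta>1 y\<bar>)"
          using y e M by (intro add_mono mult_mono f_le_1 f_lipschitz) auto
        finally show ?thesis using ab by (simp add: L_def)
      qed
      moreover have "e \<le> e * exp (L * y)" using e L y by (simp add: mult_le_cancel_left1)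
      ultimately have "(e * exp (L * y) + e * y * (L * exp (L * y))) - d \<ge> - L * \<bar>E y\<bar>"
        using neg by (simp add: E_def algebra_simps abs_if)
      with dE show "\<exists>d. (E has_real_derivative d) (at y) \<and> d \<ge> - L * \<bar>E y\<bar>" by blast
    qed (use N1 N2 in auto)
    thus ?thesis by (simp add: E_def)
  qed
  show ?thesis using main[of 1] main[of "-1"] by (simp add: L_def abs_le_iff)
qed

text \<open>Makes the angle at a fixed point continuous in a parameter of the coefficient.
  Eigenvalues and matching constants are then found by the intermediate value theorem.\<close>

lemma pruefer_param_continuous:
  assumes P: "\<And>\<mu>. \<mu> \<in> I \<Longrightarrow> pruefer s (a \<mu>) c (\<theta> \<mu>)"
    and K: "\<And>\<mu> \<nu> x. \<mu> \<in> I \<Longrightarrow> \<nu> \<in> I \<Longrightarrow> x \<in> {0..c} \<Longrightarrow> \<bar>a \<nu> x - a \<mu> x\<bar> \<le> K * \<bar>\<nu> - \<mu>\<bar>" and K0: "K \<ge> 0"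
    and x: "x \<in> {0..c}"
  shows "continuous_on I (\<lambda>\<mu>. \<theta> \<mu> x)"
  unfolding continuous_on_def
proof
  fix \<mu> :: real assume \<mu>: "\<mu> \<in> I"
  obtain M where M: "M > 0" "\<And>x. x \<in> {0..c} \<Longrightarrow> \<bar>a \<mu> x\<bar> \<le> M" using pruefer_bound[OF P[OF \<mu>]] by blast
  show "((\<lambda>\<mu>. \<theta> \<mu> x) \<longlongrightarrow> \<theta> \<mu> x) (at \<mu> within I)"
  proof (rule tendsto_dist_iff[THEN iffD2], rule tendsto_0_le[where K=1])
    have "((\<lambda>\<nu>. (K * \<bar>\<nu> - \<mu>\<bar>) * x * exp (M * p * x)) \<longlongrightarrow> (K * \<bar>\<mu> - \<mu>\<bar>) * x * exp (M * p * x)) (at \<mu> within I)"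
      by (intro tendsto_intros)
    thus "((\<lambda>\<nu>. (K * \<bar>\<nu> - \<mu>\<bar>) * x * exp (M * p * x)) \<longlongrightarrow> 0) (at \<mu> within I)" by simp
    have "norm (dist (\<theta> \<nu> x) (\<theta> \<mu> x)) \<le> norm ((K * \<bar>\<nu> - \<mu>\<bar>) * x * exp (M * p * x)) * 1" if \<nu>: "\<nu> \<in> I" for \<nu>
      using pruefer_cont_dependence[OF P[OF \<mu>] P[OF \<nu>] M(2) _ K[OF \<mu> \<nu>] _ x] M(1) K0 x
      by (simp add: dist_real_def)
    thus "\<forall>\<^sub>F \<nu> in at \<mu> within I. norm (dist (\<theta> \<nu> x) (\<theta> \<mu> x)) \<le> norm ((K * \<bar>\<nu> - \<mu>\<bar>) * x * exp (M * p * x)) * 1"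
      by (auto simp: eventually_at_filter)
  qed
qed

end

section \<open>Absolute continuity\<close>

lemma abs_powr_local_lipschitz:
  fixes u v :: real
  assumes r: "r > 1" and uv: "\<bar>u\<bar> \<le> R" "\<bar>v\<bar> \<le> R"
  shows "\<bar>\<bar>u\<bar> powr r - \<bar>v\<bar> powr r\<bar> \<le> r * R powr (r - 1) * \<bar>u - v\<bar>"
proof -
  have "norm (\<bar>u\<bar> powr r - \<bar>v\<bar> powr r) \<le> r * R powr (r - 1) * norm (u - v)"
  proof (rule field_differentiable_bound[of "{-R..R}"])
    fix z assume z: "z \<in> {-R..R}"
    show "((\<lambda>z. \<bar>z\<bar> powr r) has_field_derivative r * spow (r - 1) z) (at z within {-R..R})"
      by (rule has_field_derivative_at_within[OF abs_powr_has_derivative[OF r]])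
    have "\<bar>z\<bar> powr (r - 1) \<le> R powr (r - 1)" using z r by (intro powr_mono2) auto
    thus "norm (r * spow (r - 1) z) \<le> r * R powr (r - 1)" using r by (simp add: abs_mult abs_spow)
  qed (use uv in auto)
  thus ?thesis by simp
qed

text \<open>Continuous solutions on a compact interval stay in a bounded range, where the power with
  exponent \<open>r > 1\<close> is Lipschitz, and Gronwall applies to the difference with either
  sign. It serves \<open>y / y'\<close> with \<open>r = p\<close> and the Riccati variable with
  \<open>r = p / (p - 1)\<close>.\<close>

lemma power_ode_unique:
  fixes T1 T2 :: "real \<Rightarrow> real"
  assumes r: "r > 1" and c: "continuous_on {x0..x1} T1" "continuous_on {x0..x1} T2" and i: "T1 x0 = T2 x0"
    and N: "countable N"
    and d1: "\<And>x. x \<in> {x0<..<x1} - N \<Longrightarrow> (T1 has_real_derivative \<alpha> x + \<beta> x * \<bar>T1 x\<bar> powr r) (at x)"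
    and d2: "\<And>x. x \<in> {x0<..<x1} - N \<Longrightarrow> (T2 has_real_derivative \<alpha> x + \<beta> x * \<bar>T2 x\<bar> powr r) (at x)"
    and M: "\<And>x. x \<in> {x0<..<x1} \<Longrightarrow> \<bar>\<beta> x\<bar> \<le> M" and x: "x \<in> {x0..x1}"
  shows "T1 x = T2 x"
proof -
  have "bounded (T1 ` {x0..x1})" "bounded (T2 ` {x0..x1})"
    using c by (auto intro!: compact_imp_bounded compact_continuous_image)
  then obtain R1 R2 where R: "\<And>x. x \<in> {x0..x1} \<Longrightarrow> \<bar>T1 x\<bar> \<le> R1" "\<And>x. x \<in> {x0..x1} \<Longrightarrow> \<bar>T2 x\<bar> \<le> R2"
    unfolding bounded_iff by (metis imageI real_norm_def)
  define R where "R = max R1 R2"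
  define K where "K = M * (r * R powr (r - 1))"
  have main: "\<sigma> * (T1 x - T2 x) \<ge> 0" if \<sigma>: "\<bar>\<sigma>\<bar> = 1" for \<sigma>
  proof (rule gronwall_nonneg[where D="\<lambda>x. \<sigma> * (T1 x - T2 x)" and K=K, OF _ N _ _ x])
    show "continuous_on {x0..x1} (\<lambda>x. \<sigma> * (T1 x - T2 x))" by (intro continuous_intros c)
    fix y assume y: "y \<in> {x0<..<x1} - N"
    have "((\<lambda>x. \<sigma> * (T1 x - T2 x)) has_real_derivative \<sigma> * ((\<alpha> y + \<beta> y * \<bar>T1 y\<bar> powr r) - (\<alpha> y + \<beta> y * \<bar>T2 y\<bar> powr r))) (at y)"
      by (intro DERIV_cmult DERIV_diff d1[OF y] d2[OF y])
    moreover have "\<bar>\<sigma> * ((\<alpha> y + \<beta> y * \<bar>T1 y\<bar> powr r) - (\<alpha> y + \<beta> y * \<bar>T2 y\<bar> powr r))\<bar> \<le> K * \<bar>\<sigma> * (T1 y - T2 y)\<bar>"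
    proof -
      have "\<bar>\<beta> y\<bar> * \<bar>\<bar>T1 y\<bar> powr r - \<bar>T2 y\<bar> powr r\<bar> \<le> M * (r * R powr (r - 1) * \<bar>T1 y - T2 y\<bar>)"
        using y M[of y] R[of y] by (intro mult_mono abs_powr_local_lipschitz[OF r]) (auto simp: R_def)
      thus ?thesis using \<sigma> by (simp add: abs_mult right_diff_distrib[symmetric] K_def mult.assoc)
    qed
    ultimately show "\<exists>d. ((\<lambda>x. \<sigma> * (T1 x - T2 x)) has_real_derivative d) (at y) \<and> d \<ge> - K * \<bar>\<sigma> * (T1 y - T2 y)\<bar>"
      by (intro exI conjI) (assumption, simp add: abs_le_iff)
  qed (use i in auto)
  show ?thesis using main[of 1] main[of "-1"] by simp
qed

lemma abs_continuous_on_lipschitz: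
  assumes K: "\<And>x y. a \<le> x \<Longrightarrow> x \<le> y \<Longrightarrow> y \<le> c \<Longrightarrow> \<bar>g y - g x\<bar> \<le> K * (y - x)"
  shows "abs_continuous_on {a..c} g"
  unfolding abs_continuous_on_def
proof (intro allI impI)
  fix e :: real assume e: "e > 0"
  define d where "d = e / (\<bar>K\<bar> + 1)"
  show "\<exists>d>0. \<forall>D. D division_of \<Union>D \<and> \<Union>D \<subseteq> {a..c} \<and> (\<Sum>k\<in>D. measure lborel k) < d
        \<longrightarrow> (\<Sum>k\<in>D. \<bar>g (Sup k) - g (Inf k)\<bar>) < e"
  proof (intro exI[of _ d] conjI allI impI)
    show "d > 0" using e by (simp add: d_def)
    fix D :: "real set set" assume D: "D division_of \<Union>D \<and> \<Union>D \<subseteq> {a..c} \<and> (\<Sum>k\<in>D. measure lborel k) < d"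
    have "(\<Sum>k\<in>D. \<bar>g (Sup k) - g (Inf k)\<bar>) \<le> (\<Sum>k\<in>D. \<bar>K\<bar> * measure lborel k)"
    proof (rule sum_mono)
      fix k assume k: "k \<in> D"
      obtain u v where uv: "k = cbox u v" "k \<noteq> {}"
        using division_ofD(3,4)[of D "\<Union>D" k] D k by metis
      hence "u \<le> v" "k = {u..v}" by auto
      moreover have "k \<subseteq> {a..c}" using D k by auto
      ultimately have "\<bar>g (Sup k) - g (Inf k)\<bar> \<le> K * (v - u)" "measure lborel k = v - u" using K[of u v] by auto
      moreover have "K * (v - u) \<le> \<bar>K\<bar> * (v - u)" using \<open>u \<le> v\<close> by (intro mult_right_mono) auto
      ultimately show "\<bar>g (Sup k) - g (Inf k)\<bar> \<le> \<bar>K\<bar> * measure lborel k" by simp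
    qed
    also have "\<dots> = \<bar>K\<bar> * (\<Sum>k\<in>D. measure lborel k)" by (simp add: sum_distrib_left)
    also have "\<dots> \<le> \<bar>K\<bar> * d" using D by (intro mult_left_mono) auto
    also have "\<dots> < e" using e by (simp add: d_def field_simps)
    finally show "(\<Sum>k\<in>D. \<bar>g (Sup k) - g (Inf k)\<bar>) < e" .
  qed
qed

lemma abs_continuous_onE:
  assumes "abs_continuous_on A g" "e > 0"
  obtains d where "d > 0" "\<And>D. D division_of \<Union>D \<Longrightarrow> \<Union>D \<subseteq> A \<Longrightarrow> (\<Sum>k\<in>D. measure lborel k) < d \<Longrightarrow>
     (\<Sum>k\<in>D. \<bar>g (Sup k) - g (Inf k)\<bar>) < e"
proof -
  from assms(1)[unfolded abs_continuous_on_def, rule_format, OF assms(2)]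
  obtain d where "d > 0" and d: "\<forall>D. D division_of \<Union>D \<and> \<Union>D \<subseteq> A \<and> (\<Sum>k\<in>D. measure lborel k) < d
        \<longrightarrow> (\<Sum>k\<in>D. \<bar>g (Sup k) - g (Inf k)\<bar>) < e" by (elim exE conjE)
  show ?thesis by (rule that[OF \<open>d > 0\<close>]) (rule d[rule_format], intro conjI)
qed

lemma abs_continuous_on_diff:
  assumes "abs_continuous_on A g" "abs_continuous_on A h"
  shows "abs_continuous_on A (\<lambda>x. g x - h x)"
  unfolding abs_continuous_on_def
proof (intro allI impI)
  fix e :: real assume e: "e > 0"
  obtain d1 where d1: "d1 > 0" "\<And>D. D division_of \<Union>D \<Longrightarrow> \<Union>D \<subseteq> A \<Longrightarrow> (\<Sum>k\<in>D. measure lborel k) < d1 \<Longrightarrow>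
     (\<Sum>k\<in>D. \<bar>g (Sup k) - g (Inf k)\<bar>) < e/2"
    by (rule abs_continuous_onE[OF assms(1) half_gt_zero[OF e]]) (rule that, assumption)
  obtain d2 where d2: "d2 > 0" "\<And>D. D division_of \<Union>D \<Longrightarrow> \<Union>D \<subseteq> A \<Longrightarrow> (\<Sum>k\<in>D. measure lborel k) < d2 \<Longrightarrow>
     (\<Sum>k\<in>D. \<bar>h (Sup k) - h (Inf k)\<bar>) < e/2"
    by (rule abs_continuous_onE[OF assms(2) half_gt_zero[OF e]]) (rule that, assumption)
  show "\<exists>d>0. \<forall>D. D division_of \<Union>D \<and> \<Union>D \<subseteq> A \<and> (\<Sum>k\<in>D. measure lborel k) < d
        \<longrightarrow> (\<Sum>k\<in>D. \<bar>g (Sup k) - h (Sup k) - (g (Inf k) - h (Inf k))\<bar>) < e"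
  proof (intro exI[of _ "min d1 d2"] conjI allI impI)
    fix D :: "real set set" assume D: "D division_of \<Union>D \<and> \<Union>D \<subseteq> A \<and> (\<Sum>k\<in>D. measure lborel k) < min d1 d2"
    have "(\<Sum>k\<in>D. \<bar>g (Sup k) - h (Sup k) - (g (Inf k) - h (Inf k))\<bar>) \<le>
       (\<Sum>k\<in>D. \<bar>g (Sup k) - g (Inf k)\<bar> + \<bar>h (Sup k) - h (Inf k)\<bar>)" by (intro sum_mono) linarith
    also have "\<dots> < e" using d1(2)[of D] d2(2)[of D] D by (simp add: sum.distrib)
    finally show "(\<Sum>k\<in>D. \<bar>g (Sup k) - h (Sup k) - (g (Inf k) - h (Inf k))\<bar>) < e" .
  qed (use d1 d2 in auto)
qed

lemma abs_continuous_on_imp_continuous_on: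
  assumes "abs_continuous_on {a..c} g"
  shows "continuous_on {a..c} g"
  unfolding continuous_on_iff
proof (intro ballI allI impI)
  fix x e :: real assume x: "x \<in> {a..c}" and e: "e > 0"
  obtain d where d: "d > 0" "\<And>D. D division_of \<Union>D \<Longrightarrow> \<Union>D \<subseteq> {a..c} \<Longrightarrow> (\<Sum>k\<in>D. measure lborel k) < d \<Longrightarrow>
     (\<Sum>k\<in>D. \<bar>g (Sup k) - g (Inf k)\<bar>) < e"
    by (rule abs_continuous_onE[OF assms e]) (rule that, assumption)
  have "\<bar>g v - g u\<bar> < e" if "u \<le> v" "v - u < d" "a \<le> u" "v \<le> c" for u v
    using d(2)[of "{{u..v}}"] that division_of_self[of u v] by auto
  from this[of x] this[of _ x] have "dist (g x') (g x) < e" if "x' \<in> {a..c}" "dist x' x < d" for x'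
    using that x by (cases "x \<le> x'") (auto simp: dist_real_def abs_minus_commute)
  thus "\<exists>d>0. \<forall>x'\<in>{a..c}. dist x' x < d \<longrightarrow> dist (g x') (g x) < e" using d(1) by blast
qed

text \<open>The null set \<open>B\<close> of bad points is covered by an open set \<open>U\<close>
  of measure less than \<open>d\<close>. In a fine tagged division the intervals with tag in
  \<open>B\<close> lie in \<open>U\<close>, and absolute continuity makes their contribution less
  than \<open>e1\<close>; the others contribute at most \<open>e1\<close> times their
  length.\<close>

lemma abs_continuous_on_zero_deriv:
  assumes ac: "abs_continuous_on {0..c} g"
    and ae: "AE x in lebesgue. x \<in> {0<..<c} \<longrightarrow> (g has_real_derivative 0) (at x)"
    and x: "x \<in> {0..c}"
  shows "g x = g 0"
proof -
  have "\<bar>g x - g 0\<bar> \<le> 0 + e" if e0: "e > 0" for e :: real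
  proof -
    define e1 where "e1 = e / (1 + c)"
    have c0: "c \<ge> 0" using x by auto
    have e1: "e1 > 0" using e0 c0 by (simp add: e1_def)
    obtain d where d: "d > 0" "\<And>D. D division_of \<Union>D \<Longrightarrow> \<Union>D \<subseteq> {0..c} \<Longrightarrow> (\<Sum>k\<in>D. measure lborel k) < d \<Longrightarrow>
       (\<Sum>k\<in>D. \<bar>g (Sup k) - g (Inf k)\<bar>) < e1"
      by (rule abs_continuous_onE[OF ac e1]) (rule that, assumption)
    define B where "B = {t \<in> {0..c}. \<not> (g has_real_derivative 0) (at t)}"
    have "negligible B"
    proof -
      obtain N where N: "N \<in> null_sets lebesgue" "\<And>t. t \<in> space lebesgue - N \<Longrightarrow> t \<in> {0<..<c} \<longrightarrow> (g has_real_derivative 0) (at t)"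
        by (rule AE_E3[OF ae]) (rule that)
      have "negligible N" using N(1) by (simp add: negligible_iff_null_sets)
      hence "negligible (N \<union> {0,c})" by (rule negligible_Un) simp
      moreover have "B \<subseteq> N \<union> {0,c}" using N(2) by (force simp: B_def)
      ultimately show ?thesis by (rule negligible_subset)
    qed
    hence B: "B \<in> null_sets lebesgue" "B \<in> sets lebesgue" "B \<in> lmeasurable"
      by (auto simp: negligible_iff_null_sets fmeasurableI_null_sets)
    obtain U where U: "open U" "B \<subseteq> U" "U - B \<in> lmeasurable" "measure lebesgue (U - B) < d"
      using sets_lebesgue_outer_open[OF B(2) d(1)]
      by (metis emeasure_eq_measure2 ennreal_leI linorder_not_le)
    have "U = B \<union> (U - B)" using U(2) by auto
    hence Um: "U \<in> lmeasurable" using fmeasurable.Un[OF B(3) U(3)] by simp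
    have Ud: "measure lebesgue U < d" using U(4) B(1) Um by (simp add: measure_Diff_null_set)
    have "\<exists>r>0. (t \<in> B \<longrightarrow> ball t r \<subseteq> U) \<and> (t \<notin> B \<longrightarrow> t \<in> {0..c} \<longrightarrow> (\<forall>s. \<bar>s - t\<bar> < r \<longrightarrow> \<bar>g s - g t\<bar> \<le> e1 * \<bar>s - t\<bar>))" for t
    proof (cases "t \<in> B")
      case True thus ?thesis using U by (meson openE subsetD)
    next
      case False
      show ?thesis
      proof (cases "t \<in> {0..c}")
        case True
        hence "(g has_derivative (*) 0) (at t)" using False by (simp add: B_def has_field_derivative_def)
        then obtain r where "r > 0" "\<And>s. norm (s - t) < r \<Longrightarrow> norm (g s - g t - 0 * (s - t)) \<le> e1 * norm (s - t)"
          using e1 unfolding has_derivative_at_alt by blast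
        thus ?thesis using False by (intro exI[of _ r]) auto
      qed (use False in \<open>auto intro: exI[of _ 1]\<close>)
    qed
    then obtain r where r: "\<And>t. r t > 0" "\<And>t. t \<in> B \<Longrightarrow> ball t (r t) \<subseteq> U"
      "\<And>t s. t \<notin> B \<Longrightarrow> t \<in> {0..c} \<Longrightarrow> \<bar>s - t\<bar> < r t \<Longrightarrow> \<bar>g s - g t\<bar> \<le> e1 * \<bar>s - t\<bar>"
      by metis
    have "gauge (\<lambda>t. ball t (r t))" using r(1) by (simp add: gauge_def)
    then obtain P where P: "P tagged_division_of {0..x}" "(\<lambda>t. ball t (r t)) fine P"
      using fine_division_exists_real by blast
    have finP: "finite P" using P(1) by blast
    define P1 where "P1 = {(t,k) \<in> P. t \<in> B}"
    define P2 where "P2 = {(t,k) \<in> P. t \<notin> B}"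
    have split: "P = P1 \<union> P2" "P1 \<inter> P2 = {}" "finite P1" "finite P2"
      using finP by (auto simp: P1_def P2_def intro: finite_subset[of _ P])
    have tag: "\<exists>u v. k = {u..v} \<and> u \<le> v \<and> t \<in> {u..v} \<and> k \<subseteq> {0..x} \<and> k \<subseteq> ball t (r t)" if tk: "(t,k) \<in> P" for t k
    proof -
      obtain u v where "k = cbox u v" using tagged_division_ofD(4)[OF P(1) tk] by blast
      moreover have "t \<in> k" "k \<subseteq> {0..x}" using tagged_division_ofD(2,3)[OF P(1) tk] by auto
      moreover have "k \<subseteq> ball t (r t)" using P(2) tk by (auto simp: fine_def)
      ultimately show ?thesis by (intro exI[of _ u] exI[of _ v]) auto
    qed
    have "(\<Sum>(t,k)\<in>P2. \<bar>g (Sup k) - g (Inf k)\<bar>) \<le> (\<Sum>(t,k)\<in>P2. e1 * measure lborel k)"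
    proof (rule sum_mono, clarify)
      fix t k assume "(t,k) \<in> P2"
      hence tk: "(t,k) \<in> P" "t \<notin> B" by (auto simp: P2_def)
      obtain u v where uv: "k = {u..v}" "u \<le> v" "t \<in> {u..v}" "k \<subseteq> {0..x}" "k \<subseteq> ball t (r t)" using tag[OF tk(1)] by blast
      have t: "t \<in> {0..c}" using uv x by auto
      have "u \<in> k" "v \<in> k" using uv by auto
      hence "u \<in> ball t (r t)" "v \<in> ball t (r t)" using uv(5) by blast+
      hence bnds: "\<bar>g u - g t\<bar> \<le> e1 * \<bar>u - t\<bar>" "\<bar>g v - g t\<bar> \<le> e1 * \<bar>v - t\<bar>"
        using r(3)[OF tk(2) t, of u] r(3)[OF tk(2) t, of v] by (auto simp: dist_real_def abs_minus_commute)
      have eqs: "\<bar>u - t\<bar> = t - u" "\<bar>v - t\<bar> = v - t" using uv(3) by auto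
      have "\<bar>g v - g u\<bar> \<le> e1 * (t - u) + e1 * (v - t)" using bnds[unfolded eqs] by linarith
      hence "\<bar>g v - g u\<bar> \<le> e1 * (v - u)" by (simp add: algebra_simps)
      thus "\<bar>g (Sup k) - g (Inf k)\<bar> \<le> e1 * measure lborel k" using uv by simp
    qed
    also have "\<dots> \<le> (\<Sum>(t,k)\<in>P. e1 * measure lborel k)"
      using split finP e1 by (intro sum_mono2) auto
    also have "\<dots> = e1 * (\<Sum>(t,k)\<in>P. measure lborel k)" by (simp add: sum_distrib_left case_prod_unfold)
    also have "(\<Sum>(t,k)\<in>P. measure lborel k) = x - 0"
      using additive_content_tagged_division[of P 0 x] P(1) x by (simp add: content_real)
    finally have S2: "(\<Sum>(t,k)\<in>P2. \<bar>g (Sup k) - g (Inf k)\<bar>) \<le> e1 * x" by simp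
    have P1d: "P1 tagged_division_of (\<Union>(snd ` P1))"
      by (rule tagged_partial_division_of_Union_self[of _ "{0..x}"])
         (use P(1) split in \<open>metis Un_upper1 tagged_division_of_def tagged_partial_division_subset\<close>)
    define D where "D = snd ` P1"
    have Dd: "D division_of \<Union>D" unfolding D_def using division_of_tagged_division[OF P1d] .
    have "(\<Sum>k\<in>D. measure lborel k) = measure lebesgue (\<Union>D)"
    proof -
      have "measure lborel k = measure lebesgue k" if kD: "k \<in> D" for k
      proof -
        obtain u v where "k = cbox u v" using division_ofD(4)[OF Dd kD] by blast
        thus ?thesis by (simp add: measure_completion)
      qed
      hence "(\<Sum>k\<in>D. measure lborel k) = (\<Sum>k\<in>D. measure lebesgue k)" by (intro sum.cong) auto
      thus ?thesis using content_division[OF Dd] by simp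
    qed
    also have "\<dots> \<le> measure lebesgue U"
    proof (rule measure_mono_fmeasurable)
      show "\<Union>D \<subseteq> U" using tag r(2) by (fastforce simp: D_def P1_def)
      show "\<Union>D \<in> sets lebesgue" using lmeasurable_division[OF Dd] fmeasurableD by blast
    qed (rule Um)
    also have "\<dots> < d" by (rule Ud)
    finally have sumd: "(\<Sum>k\<in>D. measure lborel k) < d" .
    have "k \<subseteq> {0..c}" if "k \<in> D" for k
    proof -
      obtain t where "(t,k) \<in> P" using \<open>k \<in> D\<close> by (auto simp: D_def P1_def)
      from tag[OF this] x show ?thesis by auto
    qed
    hence "\<Union>D \<subseteq> {0..c}" by blast
    hence "(\<Sum>k\<in>D. \<bar>g (Sup k) - g (Inf k)\<bar>) < e1"
      using sumd by (rule d(2)[OF Dd])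
    moreover have "(\<Sum>(t,k)\<in>P1. \<bar>g (Sup k) - g (Inf k)\<bar>) = (\<Sum>k\<in>D. \<bar>g (Sup k) - g (Inf k)\<bar>)"
    proof -
      \<comment> \<open>\<open>Sup\<close> and \<open>Inf\<close> carry no information on the empty
        interval, so the value there is set to \<open>0\<close>. With this, degenerate intervals
        count nothing, and passing from tagged pairs to intervals loses nothing even if two tags
        share one.\<close>
      define w where "w k = (if k = {} then 0 else \<bar>g (Sup k) - g (Inf k)\<bar>)" for k
      have ne: "k \<noteq> {}" if "(t,k) \<in> P1" for t k
      proof -
        have "(t,k) \<in> P" using that by (auto simp: P1_def)
        from tag[OF this] show ?thesis by auto
      qed
      have "(\<Sum>(t,k)\<in>P1. \<bar>g (Sup k) - g (Inf k)\<bar>) = (\<Sum>(t,k)\<in>P1. w k)"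
        using ne by (intro sum.cong) (auto simp: w_def)
      also have "\<dots> = (\<Sum>k\<in>D. w k)"
        unfolding D_def by (rule sum.over_tagged_division_lemma[OF P1d]) (auto simp: w_def)
      also have "\<dots> = (\<Sum>k\<in>D. \<bar>g (Sup k) - g (Inf k)\<bar>)"
        using ne by (intro sum.cong) (auto simp: w_def D_def)
      finally show ?thesis .
    qed
    ultimately have S1: "(\<Sum>(t,k)\<in>P1. \<bar>g (Sup k) - g (Inf k)\<bar>) < e1" by simp
    have "g x - g 0 = (\<Sum>(t,k)\<in>P. g (Sup k) - g (Inf k))"
      using additive_tagged_division_1[OF _ P(1), of g] x by simp
    hence "\<bar>g x - g 0\<bar> \<le> (\<Sum>(t,k)\<in>P. \<bar>g (Sup k) - g (Inf k)\<bar>)"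
      using sum_abs[of "\<lambda>(t,k). g (Sup k) - g (Inf k)" P] by (simp add: case_prod_unfold)
    also have "\<dots> = (\<Sum>(t,k)\<in>P1. \<bar>g (Sup k) - g (Inf k)\<bar>) + (\<Sum>(t,k)\<in>P2. \<bar>g (Sup k) - g (Inf k)\<bar>)"
      using split by (simp add: sum.union_disjoint)
    also have "\<dots> \<le> e1 + e1 * x" using S1 S2 by simp
    also have "\<dots> \<le> e1 * (1 + c)" using x e1 by (simp add: algebra_simps)
    also have "\<dots> = e" using c0 by (simp add: e1_def)
    finally show ?thesis by simp
  qed
  thus ?thesis using field_le_epsilon[of "\<bar>g x - g 0\<bar>" 0] by simp
qed

section \<open>Half-linear equations and eigenvalues\<close>

lemma spow_eq_iff: "r > 0 \<Longrightarrow> spow r x = spow r y \<longleftrightarrow> x = y"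
  using spow_less_iff[of r x y] spow_less_iff[of r y x] by (cases x y rule: linorder_cases) auto

context half_linear
begin

text \<open>All potentials that occur are continuous off a countable set, so that the equation can be required there instead
  of almost everywhere.\<close>

definition hsol :: "real \<Rightarrow> (real \<Rightarrow> real) \<Rightarrow> (real \<Rightarrow> real) \<Rightarrow> (real \<Rightarrow> real) \<Rightarrow> bool" where
  "hsol c h y y' \<longleftrightarrow> (\<exists>M. \<forall>x\<in>{0..c}. \<bar>h x\<bar> \<le> M) \<and>
     (\<forall>x\<in>{0..c}. (y has_real_derivative y' x) (at x within {0..c})) \<and>
     continuous_on {0..c} (\<lambda>x. spow (p - 1) (y' x)) \<and>
     (\<exists>N. countable N \<and> (\<forall>x\<in>{0<..<c} - N.
        ((\<lambda>x. spow (p - 1) (y' x)) has_real_derivative - (p - 1) * h x * spow (p - 1) (y x)) (at x)))"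

lemma hsol_bound:
  assumes "hsol c h y y'"
  obtains M where "\<And>x. x \<in> {0..c} \<Longrightarrow> \<bar>h x\<bar> \<le> M"
  using assms unfolding hsol_def by blast

lemma hsol_deriv:
  assumes "hsol c h y y'"
  obtains N where "countable N" "\<And>x. x \<in> {0<..<c} - N \<Longrightarrow>
    ((\<lambda>x. spow (p - 1) (y' x)) has_real_derivative - (p - 1) * h x * spow (p - 1) (y x)) (at x)"
  using assms unfolding hsol_def by blast

lemma hsol_y_deriv: "hsol c h y y' \<Longrightarrow> x \<in> {0<..<c} \<Longrightarrow> (y has_real_derivative y' x) (at x)"
  unfolding hsol_def by (metis at_within_Icc_at atLeastAtMost_iff greaterThanLessThan_iff less_imp_le)

lemma hsol_cont: "hsol c h y y' \<Longrightarrow> continuous_on {0..c} y"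
  unfolding hsol_def by (auto intro: DERIV_continuous_on)

lemma hsol_cont_v: "hsol c h y y' \<Longrightarrow> continuous_on {0..c} (\<lambda>x. spow (p - 1) (y' x))"
  unfolding hsol_def by blast

lemma hsol_cont': assumes "hsol c h y y'" shows "continuous_on {0..c} y'"
proof -
  have "continuous_on {0..c} (\<lambda>x. spow (1 / (p - 1)) (spow (p - 1) (y' x)))"
    using p_gt_1 by (intro continuous_intros hsol_cont_v[OF assms]) auto
  thus ?thesis using p_gt_1 by (simp add: spow_spow)
qed

lemma young_crude: "\<bar>u\<bar> powr (p - 1) * \<bar>w\<bar> \<le> \<bar>u\<bar> powr p + \<bar>w\<bar> powr p"
proof -
  define m where "m = max \<bar>u\<bar> \<bar>w\<bar>"
  have m: "m \<ge> 0" "\<bar>u\<bar> \<le> m" "\<bar>w\<bar> \<le> m" by (auto simp: m_def)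
  have "\<bar>u\<bar> powr (p - 1) * \<bar>w\<bar> \<le> m powr (p - 1) * m"
    using m p_gt_1 by (intro mult_mono powr_mono2) auto
  also have "\<dots> = m powr p"
    using m by (cases "m = 0") (auto simp: powr_diff)
  also have "\<dots> \<le> \<bar>u\<bar> powr p + \<bar>w\<bar> powr p" by (auto simp: m_def max_def)
  finally show ?thesis .
qed

lemma conj_exp: "p / (p - 1) > 1" "p / (p - 1) - 1 = 1 / (p - 1)" "(p - 1) * (p / (p - 1)) = p" "(p - 1) * (1 / (p - 1)) = 1"
  using p_gt_1 by (auto simp: field_simps)

lemma hsol_energy:
  assumes H: "hsol c h y y'"
  defines "E \<equiv> \<lambda>x. \<bar>y x\<bar> powr p + \<bar>y' x\<bar> powr p"
  obtains N K where "countable N" "continuous_on {0..c} E" "\<And>x. x \<in> {0<..<c} - N \<Longrightarrow> \<exists>d. (E has_real_derivative d) (at x) \<and> \<bar>d\<bar> \<le> K * E x"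
proof -
  obtain M where M: "\<And>x. x \<in> {0..c} \<Longrightarrow> \<bar>h x\<bar> \<le> M" by (rule hsol_bound[OF H]) (rule that)
  obtain N where N: "countable N" "\<And>x. x \<in> {0<..<c} - N \<Longrightarrow>
    ((\<lambda>x. spow (p - 1) (y' x)) has_real_derivative - (p - 1) * h x * spow (p - 1) (y x)) (at x)"
    by (rule hsol_deriv[OF H]) (rule that)
  have E_eq: "E = (\<lambda>x. \<bar>y x\<bar> powr p + \<bar>spow (p - 1) (y' x)\<bar> powr (p / (p - 1)))"
    unfolding E_def using p_gt_1 by (simp add: abs_spow powr_powr conj_exp)
  show ?thesis
  proof (rule that[of N "p * (1 + M)"])
    show "countable N" by (rule N(1))
    show "continuous_on {0..c} E" unfolding E_def using p_gt_1
      by (intro continuous_intros hsol_cont[OF H] hsol_cont'[OF H] continuous_on_powr') auto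
    fix x assume x: "x \<in> {0<..<c} - N"
    have "(E has_real_derivative p * spow (p - 1) (y x) * y' x +
       p / (p - 1) * spow (p / (p - 1) - 1) (spow (p - 1) (y' x)) * (- (p - 1) * h x * spow (p - 1) (y x))) (at x)"
      unfolding E_eq using x
      by (intro DERIV_add DERIV_chain2[OF abs_powr_has_derivative[OF p_gt_1] hsol_y_deriv[OF H]]
          DERIV_chain2[OF abs_powr_has_derivative[OF conj_exp(1)] N(2)]) auto
    also have "spow (p / (p - 1) - 1) (spow (p - 1) (y' x)) = y' x"
      unfolding conj_exp(2) spow_spow conj_exp(4) by simp
    also have "p * spow (p - 1) (y x) * y' x + p / (p - 1) * y' x * (- (p - 1) * h x * spow (p - 1) (y x))
      = p * (1 - h x) * (spow (p - 1) (y x) * y' x)"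
      using p_gt_1 by (simp add: field_simps)
    finally have d: "(E has_real_derivative p * (1 - h x) * (spow (p - 1) (y x) * y' x)) (at x)" .
    have "\<bar>p * (1 - h x) * (spow (p - 1) (y x) * y' x)\<bar> = (p * \<bar>1 - h x\<bar>) * (\<bar>y x\<bar> powr (p - 1) * \<bar>y' x\<bar>)"
      using p_gt_1 by (simp add: abs_mult abs_spow)
    also have "\<dots> \<le> (p * (1 + M)) * E x"
      unfolding E_def using p_gt_1 M[of x] x by (intro mult_mono young_crude) auto
    finally show "\<exists>d. (E has_real_derivative d) (at x) \<and> \<bar>d\<bar> \<le> p * (1 + M) * E x" using d by blast
  qed
qed

text \<open>The derivative of the energy is bounded by a multiple of the energy, so an exponential
  factor makes it monotone in either direction and positivity at one point spreads to the whole
  interval.\<close>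

lemma hsol_nonvanishing:
  assumes H: "hsol c h y y'" and x0: "x0 \<in> {0..c}" "y x0 \<noteq> 0 \<or> y' x0 \<noteq> 0" and x: "x \<in> {0..c}"
  shows "y x \<noteq> 0 \<or> y' x \<noteq> 0"
proof -
  define E where "E x = \<bar>y x\<bar> powr p + \<bar>y' x\<bar> powr p" for x
  obtain N K where E: "countable N" "continuous_on {0..c} E" "\<And>x. x \<in> {0<..<c} - N \<Longrightarrow> \<exists>d. (E has_real_derivative d) (at x) \<and> \<bar>d\<bar> \<le> K * E x"
    using hsol_energy[OF H] unfolding E_def by blast
  have nn: "E x \<ge> 0" for x by (simp add: E_def)
  have Epos: "E t > 0 \<longleftrightarrow> y t \<noteq> 0 \<or> y' t \<noteq> 0" for t
  proof
    assume "E t > 0" thus "y t \<noteq> 0 \<or> y' t \<noteq> 0" using p_gt_1 by (auto simp: E_def)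
  next
    assume "y t \<noteq> 0 \<or> y' t \<noteq> 0"
    hence "\<bar>y t\<bar> powr p > 0 \<or> \<bar>y' t\<bar> powr p > 0" by auto
    thus "E t > 0" unfolding E_def by (smt (verit) powr_ge_zero)
  qed
  have "E x > 0"
  proof (cases "x0 \<le> x")
    case True
    have "E x0 * exp (K * x0) \<le> E x * exp (K * x)"
    proof (rule mono_of_nonneg_deriv_off_countable[where f="\<lambda>x. E x * exp (K * x)", OF True _ E(1)])
      show "continuous_on {x0..x} (\<lambda>x. E x * exp (K * x))"
        using x0 x by (intro continuous_intros continuous_on_subset[OF E(2)]) auto
      fix t assume t: "t \<in> {x0<..<x} - N"
      then obtain d where d: "(E has_real_derivative d) (at t)" "\<bar>d\<bar> \<le> K * E t" using E(3)[of t] x0 x by auto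
      have "((\<lambda>x. E x * exp (K * x)) has_real_derivative (d + K * E t) * exp (K * t)) (at t)"
        using d(1) by (auto intro!: derivative_eq_intros simp: algebra_simps)
      thus "\<exists>d\<ge>0. ((\<lambda>x. E x * exp (K * x)) has_real_derivative d) (at t)"
        using d(2) by (intro exI[of _ "(d + K * E t) * exp (K * t)"]) auto
    qed
    moreover have "E x0 * exp (K * x0) > 0" using Epos[of x0] x0 by simp
    ultimately show ?thesis by (smt (verit) exp_gt_zero zero_less_mult_pos2)
  next
    case False
    have "- (E x * exp (- K * x)) \<le> - (E x0 * exp (- K * x0))"
    proof (rule mono_of_nonneg_deriv_off_countable[where f="\<lambda>x. - (E x * exp (- K * x))", OF _ _ E(1)])
      show "continuous_on {x..x0} (\<lambda>x. - (E x * exp (- K * x)))"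
        using x0 x by (intro continuous_intros continuous_on_subset[OF E(2)]) auto
      fix t assume t: "t \<in> {x<..<x0} - N"
      then obtain d where d: "(E has_real_derivative d) (at t)" "\<bar>d\<bar> \<le> K * E t" using E(3)[of t] x0 x by auto
      have "((\<lambda>x. - (E x * exp (- K * x))) has_real_derivative (K * E t - d) * exp (- K * t)) (at t)"
        using d(1) by (auto intro!: derivative_eq_intros simp: algebra_simps)
      thus "\<exists>d\<ge>0. ((\<lambda>x. - (E x * exp (- K * x))) has_real_derivative d) (at t)"
        using d(2) by (intro exI[of _ "(K * E t - d) * exp (- K * t)"]) auto
    qed (use False in auto)
    moreover have "E x0 * exp (- K * x0) > 0" using Epos[of x0] x0 by simp
    ultimately show ?thesis by (smt (verit) exp_gt_zero zero_less_mult_pos2)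
  qed
  thus ?thesis using Epos by simp
qed

text \<open>Where \<open>y'\<close> does not vanish it can be recovered from its signed power by the
  inverse power, which is differentiable there. The quotient then obeys the generalised tangent
  equation with coefficient \<open>h\<close>.\<close>

lemma hsol_tan_deriv:
  assumes H: "hsol c h y y'" and x: "x \<in> {0<..<c}" "y' x \<noteq> 0"
    and v: "((\<lambda>x. spow (p - 1) (y' x)) has_real_derivative - (p - 1) * h x * spow (p - 1) (y x)) (at x)"
  shows "((\<lambda>x. y x / y' x) has_real_derivative 1 + h x * \<bar>y x / y' x\<bar> powr p) (at x)"
proof -
  define v0 where "v0 = spow (p - 1) (y' x)"
  have v0: "v0 \<noteq> 0" using x by (simp add: v0_def)
  have "((\<lambda>x. spow (1 / (p - 1)) (spow (p - 1) (y' x))) has_real_derivative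
     (1 / (p - 1) * \<bar>v0\<bar> powr (1 / (p - 1) - 1)) * (- (p - 1) * h x * spow (p - 1) (y x))) (at x)"
    unfolding v0_def by (rule DERIV_chain2[OF spow_has_derivative v]) (use x in auto)
  moreover have "(\<lambda>x. spow (1 / (p - 1)) (spow (p - 1) (y' x))) = y'"
    unfolding spow_spow conj_exp(4) by simp
  moreover have "\<bar>v0\<bar> powr (1 / (p - 1) - 1) = \<bar>y' x\<bar> powr (2 - p)"
  proof -
    have "(p - 1) * (1 / (p - 1) - 1) = 2 - p" using p_gt_1 by (simp add: field_simps)
    thus ?thesis unfolding v0_def abs_spow powr_powr by simp
  qed
  ultimately have "(y' has_real_derivative (1 / (p - 1) * \<bar>y' x\<bar> powr (2 - p)) * (- (p - 1) * h x * spow (p - 1) (y x))) (at x)"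
    by simp
  also have "(1 / (p - 1) * \<bar>y' x\<bar> powr (2 - p)) * (- (p - 1) * h x * spow (p - 1) (y x)) =
      - h x * \<bar>y' x\<bar> powr (2 - p) * spow (p - 1) (y x)" using p_gt_1 by (simp add: field_simps)
  finally have d2: "(y' has_real_derivative - h x * \<bar>y' x\<bar> powr (2 - p) * spow (p - 1) (y x)) (at x)" .
  have "((\<lambda>x. y x / y' x) has_real_derivative
     (y' x * y' x - y x * (- h x * \<bar>y' x\<bar> powr (2 - p) * spow (p - 1) (y x))) / (y' x * y' x)) (at x)"
    by (rule DERIV_divide[OF hsol_y_deriv[OF H x(1)] d2 x(2)])
  also have "(y' x * y' x - y x * (- h x * \<bar>y' x\<bar> powr (2 - p) * spow (p - 1) (y x))) / (y' x * y' x) =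
     1 + h x * ((y x * spow (p - 1) (y x)) * (\<bar>y' x\<bar> powr (2 - p) / (y' x * y' x)))"
    using x(2) by (simp add: field_simps)
  also have "y x * spow (p - 1) (y x) = \<bar>y x\<bar> powr p" by (simp add: mult_spow)
  also have "\<bar>y' x\<bar> powr (2 - p) / (y' x * y' x) = 1 / \<bar>y' x\<bar> powr p"
  proof -
    have "y' x * y' x = \<bar>y' x\<bar> powr 2" using x(2) by (simp add: powr_numeral power2_eq_square)
    thus ?thesis using x(2) by (simp add: powr_diff)
  qed
  finally show ?thesis by (simp add: abs_divide powr_divide)
qed

lemma hsol_riccati_deriv:
  assumes H: "hsol c h y y'" and x: "x \<in> {0<..<c}" "y x \<noteq> 0"
    and v: "((\<lambda>x. spow (p - 1) (y' x)) has_real_derivative - (p - 1) * h x * spow (p - 1) (y x)) (at x)"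
  shows "((\<lambda>x. spow (p - 1) (y' x) / spow (p - 1) (y x)) has_real_derivative
     - (p - 1) * h x + - (p - 1) * \<bar>spow (p - 1) (y' x) / spow (p - 1) (y x)\<bar> powr (p / (p - 1))) (at x)"
proof -
  have d: "((\<lambda>x. spow (p - 1) (y x)) has_real_derivative ((p - 1) * \<bar>y x\<bar> powr (p - 1 - 1)) * y' x) (at x)"
    by (rule DERIV_chain2[OF spow_has_derivative hsol_y_deriv[OF H x(1)]]) (rule x)
  have s0: "spow (p - 1) (y x) \<noteq> 0" using x by simp
  have "((\<lambda>x. spow (p - 1) (y' x) / spow (p - 1) (y x)) has_real_derivative
     (- (p - 1) * h x * spow (p - 1) (y x) * spow (p - 1) (y x) - spow (p - 1) (y' x) * (((p - 1) * \<bar>y x\<bar> powr (p - 1 - 1)) * y' x))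
      / (spow (p - 1) (y x) * spow (p - 1) (y x))) (at x)"
    by (rule DERIV_divide[OF v d s0])
  also have "(- (p - 1) * h x * spow (p - 1) (y x) * spow (p - 1) (y x) - spow (p - 1) (y' x) * (((p - 1) * \<bar>y x\<bar> powr (p - 1 - 1)) * y' x))
      / (spow (p - 1) (y x) * spow (p - 1) (y x)) =
      - (p - 1) * h x + - (p - 1) * ((y' x * spow (p - 1) (y' x)) * (\<bar>y x\<bar> powr (p - 1 - 1) / (spow (p - 1) (y x) * spow (p - 1) (y x))))"
    using s0 by (simp add: field_simps)
  also have "y' x * spow (p - 1) (y' x) = \<bar>y' x\<bar> powr p" by (simp add: mult_spow)
  also have "\<bar>y x\<bar> powr (p - 1 - 1) / (spow (p - 1) (y x) * spow (p - 1) (y x)) = 1 / \<bar>y x\<bar> powr p"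
  proof -
    have "spow (p - 1) (y x) * spow (p - 1) (y x) = \<bar>y x\<bar> powr (p - 1) * \<bar>y x\<bar> powr (p - 1)"
      by (metis abs_mult_self_eq abs_spow)
    also have "\<dots> = \<bar>y x\<bar> powr (p + (p - 1 - 1))" by (subst powr_add[symmetric]) simp
    also have "\<dots> = \<bar>y x\<bar> powr p * \<bar>y x\<bar> powr (p - 1 - 1)" by (rule powr_add)
    finally show ?thesis using x(2) by simp
  qed
  finally show ?thesis
    unfolding abs_divide abs_spow powr_divide powr_powr conj_exp(3) by simp
qed

text \<open>The system is not Lipschitz for \<open>p \<noteq> 2\<close>; uniqueness is obtained from the equations of \<open>y / y'\<close> and of the Riccati
  variable, one of which is regular at every point.\<close>

lemma hsol_proportional:
  assumes H1: "hsol c h y y'" and H2: "hsol c h z z'"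
    and n1: "\<And>x. x \<in> {0..c} \<Longrightarrow> y x \<noteq> 0 \<or> y' x \<noteq> 0" and n2: "\<And>x. x \<in> {0..c} \<Longrightarrow> z x \<noteq> 0 \<or> z' x \<noteq> 0"
    and i: "y 0 = 0" "z 0 = 0" and x: "x \<in> {0..c}"
  shows "y x * z' x = y' x * z x"
proof -
  define J where "J x = y x * z' x - y' x * z x" for x
  have cJ: "continuous_on {0..c} J" unfolding J_def
    by (intro continuous_intros hsol_cont[OF H1] hsol_cont[OF H2] hsol_cont'[OF H1] hsol_cont'[OF H2])
  obtain M where M: "\<And>x. x \<in> {0..c} \<Longrightarrow> \<bar>h x\<bar> \<le> M" by (rule hsol_bound[OF H1]) (rule that)
  obtain N1 where N1: "countable N1" "\<And>x. x \<in> {0<..<c} - N1 \<Longrightarrow>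
    ((\<lambda>x. spow (p - 1) (y' x)) has_real_derivative - (p - 1) * h x * spow (p - 1) (y x)) (at x)"
    by (rule hsol_deriv[OF H1]) (rule that)
  obtain N2 where N2: "countable N2" "\<And>x. x \<in> {0<..<c} - N2 \<Longrightarrow>
    ((\<lambda>x. spow (p - 1) (z' x)) has_real_derivative - (p - 1) * h x * spow (p - 1) (z x)) (at x)"
    by (rule hsol_deriv[OF H2]) (rule that)
  have N12: "countable (N1 \<union> N2)" using N1 N2 by auto
  have nonzero_near: "\<exists>\<delta>>0. \<forall>t\<in>{x0..x0+\<delta>}. t \<le> c \<longrightarrow> g t \<noteq> 0"
    if gg: "continuous_on {0..c} g" "x0 \<in> {0..c}" "g x0 \<noteq> 0" for g :: "real \<Rightarrow> real" and x0
  proof -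
    obtain \<delta> where \<delta>: "\<delta> > 0" "\<And>t. t \<in> {0..c} \<Longrightarrow> dist t x0 < \<delta> \<Longrightarrow> dist (g t) (g x0) < \<bar>g x0\<bar>"
      using gg unfolding continuous_on_iff by (metis zero_less_abs_iff)
    have "g t \<noteq> 0" if "t \<in> {x0..x0 + \<delta>/2}" "t \<le> c" for t
      using \<delta>(1) \<delta>(2)[of t] that gg(2) by (auto simp: dist_real_def)
    thus ?thesis using \<delta>(1) by (intro exI[of _ "\<delta>/2"]) auto
  qed
  have ext: "\<exists>\<delta>>0. \<forall>t\<in>{x0..x0+\<delta>}. t \<le> c \<longrightarrow> J t = 0" if x0: "x0 \<in> {0..c}" "x0 < c" and J0: "J x0 = 0" for x0
  proof (cases "y' x0 = 0")
    case False
    have "z' x0 \<noteq> 0" using J0 False n2[OF x0(1)] by (auto simp: J_def)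
    obtain \<delta>1 \<delta>2 where d: "\<delta>1 > 0" "\<And>t. t \<in> {x0..x0+\<delta>1} \<Longrightarrow> t \<le> c \<Longrightarrow> y' t \<noteq> 0"
       "\<delta>2 > 0" "\<And>t. t \<in> {x0..x0+\<delta>2} \<Longrightarrow> t \<le> c \<Longrightarrow> z' t \<noteq> 0"
      using nonzero_near[OF hsol_cont'[OF H1] x0(1) False] nonzero_near[OF hsol_cont'[OF H2] x0(1) \<open>z' x0 \<noteq> 0\<close>] by blast
    define x1 where "x1 = min c (x0 + min \<delta>1 \<delta>2)"
    have x1: "x0 < x1" "x1 \<le> c" using d x0 by (auto simp: x1_def)
    have nz: "y' t \<noteq> 0" "z' t \<noteq> 0" if "t \<in> {x0..x1}" for t using that d by (auto simp: x1_def)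
    have eqT: "y t / y' t = z t / z' t" if t: "t \<in> {x0..x1}" for t
    proof (rule power_ode_unique[where \<alpha>="\<lambda>_. 1" and \<beta>=h and r=p and M=M, OF p_gt_1 _ _ _ N12 _ _ _ t])
      show "continuous_on {x0..x1} (\<lambda>t. y t / y' t)" "continuous_on {x0..x1} (\<lambda>t. z t / z' t)"
        using nz x0 x1 by (auto intro!: continuous_intros continuous_on_subset[OF hsol_cont[OF H1]] continuous_on_subset[OF hsol_cont'[OF H1]]
            continuous_on_subset[OF hsol_cont[OF H2]] continuous_on_subset[OF hsol_cont'[OF H2]])
      show "y x0 / y' x0 = z x0 / z' x0" using J0 nz[of x0] x1 by (simp add: J_def field_simps)
      fix s assume s: "s \<in> {x0<..<x1} - (N1 \<union> N2)"
      have sc: "s \<in> {0<..<c}" using s x0 x1 by auto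
      show "((\<lambda>t. y t / y' t) has_real_derivative 1 + h s * \<bar>y s / y' s\<bar> powr p) (at s)"
        using s sc nz[of s] by (intro hsol_tan_deriv[OF H1] N1(2)) auto
      show "((\<lambda>t. z t / z' t) has_real_derivative 1 + h s * \<bar>z s / z' s\<bar> powr p) (at s)"
        using s sc nz[of s] by (intro hsol_tan_deriv[OF H2] N2(2)) auto
    qed (use M x0 x1 in auto)
    have "J t = 0" if "t \<in> {x0..x1}" for t
      using eqT[OF that] nz[OF that] by (simp add: J_def frac_eq_eq mult.commute)
    thus ?thesis using d by (intro exI[of _ "min \<delta>1 \<delta>2"]) (auto simp: x1_def)
  next
    case True
    have y0: "y x0 \<noteq> 0" using n1[OF x0(1)] True by simp
    have z0: "z x0 \<noteq> 0" using J0 True y0 n2[OF x0(1)] by (auto simp: J_def)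
    obtain \<delta>1 \<delta>2 where d: "\<delta>1 > 0" "\<And>t. t \<in> {x0..x0+\<delta>1} \<Longrightarrow> t \<le> c \<Longrightarrow> y t \<noteq> 0"
       "\<delta>2 > 0" "\<And>t. t \<in> {x0..x0+\<delta>2} \<Longrightarrow> t \<le> c \<Longrightarrow> z t \<noteq> 0"
      using nonzero_near[OF hsol_cont[OF H1] x0(1) y0] nonzero_near[OF hsol_cont[OF H2] x0(1) z0] by blast
    define x1 where "x1 = min c (x0 + min \<delta>1 \<delta>2)"
    have x1: "x0 < x1" "x1 \<le> c" using d x0 by (auto simp: x1_def)
    have nz: "y t \<noteq> 0" "z t \<noteq> 0" if "t \<in> {x0..x1}" for t using that d by (auto simp: x1_def)
    have "spow (p - 1) (y' t) / spow (p - 1) (y t) = spow (p - 1) (z' t) / spow (p - 1) (z t)" if t: "t \<in> {x0..x1}" for t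
    proof (rule power_ode_unique[where \<alpha>="\<lambda>s. - (p - 1) * h s" and \<beta>="\<lambda>_. - (p - 1)" and r="p / (p - 1)" and M="p - 1", OF conj_exp(1) _ _ _ N12 _ _ _ t])
      show "continuous_on {x0..x1} (\<lambda>t. spow (p - 1) (y' t) / spow (p - 1) (y t))" "continuous_on {x0..x1} (\<lambda>t. spow (p - 1) (z' t) / spow (p - 1) (z t))"
        using nz x0 x1 p_gt_1 by (auto intro!: continuous_intros continuous_on_subset[OF hsol_cont[OF H1]] continuous_on_subset[OF hsol_cont'[OF H1]]
            continuous_on_subset[OF hsol_cont[OF H2]] continuous_on_subset[OF hsol_cont'[OF H2]])
      show "spow (p - 1) (y' x0) / spow (p - 1) (y x0) = spow (p - 1) (z' x0) / spow (p - 1) (z x0)"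
        using J0 y0 z0 True by (auto simp: J_def)
      fix s assume s: "s \<in> {x0<..<x1} - (N1 \<union> N2)"
      have sc: "s \<in> {0<..<c}" using s x0 x1 by auto
      show "((\<lambda>t. spow (p - 1) (y' t) / spow (p - 1) (y t)) has_real_derivative - (p - 1) * h s + - (p - 1) * \<bar>spow (p - 1) (y' s) / spow (p - 1) (y s)\<bar> powr (p / (p - 1))) (at s)"
        using s sc nz[of s] by (intro hsol_riccati_deriv[OF H1] N1(2)) auto
      show "((\<lambda>t. spow (p - 1) (z' t) / spow (p - 1) (z t)) has_real_derivative - (p - 1) * h s + - (p - 1) * \<bar>spow (p - 1) (z' s) / spow (p - 1) (z s)\<bar> powr (p / (p - 1))) (at s)"
        using s sc nz[of s] by (intro hsol_riccati_deriv[OF H2] N2(2)) auto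
    qed (use p_gt_1 in auto)
    hence "spow (p - 1) (y' t / y t) = spow (p - 1) (z' t / z t)" if "t \<in> {x0..x1}" for t using that by (simp add: spow_divide)
    hence eqT: "y' t / y t = z' t / z t" if "t \<in> {x0..x1}" for t
      using that p_gt_1 spow_eq_iff[of "p - 1" "y' t / y t" "z' t / z t"] by simp
    have "J t = 0" if "t \<in> {x0..x1}" for t
      using eqT[OF that] nz[OF that] by (simp add: J_def frac_eq_eq mult.commute)
    thus ?thesis using d by (intro exI[of _ "min \<delta>1 \<delta>2"]) (auto simp: x1_def)
  qed
  have "J x = 0"
  proof (rule ccontr)
    assume Jx: "J x \<noteq> 0"
    \<comment> \<open>Continuation from the left end: by continuity \<open>J\<close> still vanishes
      at the supremum of \<open>A\<close>, and \<open>ext\<close> carries the identity a little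
      beyond it.\<close>
    define A where "A = {t \<in> {0..x}. \<forall>s\<in>{0..t}. J s = 0}"
    have "0 \<in> A" using x i by (auto simp: A_def J_def)
    have bdd: "bdd_above A" by (rule bdd_aboveI[of _ x]) (auto simp: A_def)
    define x0 where "x0 = Sup A"
    have x0a: "0 \<le> x0" unfolding x0_def by (rule cSup_upper[OF \<open>0 \<in> A\<close> bdd])
    have x0b: "x0 \<le> x" unfolding x0_def
    proof (rule cSup_least)
      show "A \<noteq> {}" using \<open>0 \<in> A\<close> by blast
    qed (simp add: A_def)
    note x0 = x0a x0b
    have below: "J s = 0" if s: "0 \<le> s" "s < x0" for s
    proof -
      have "A \<noteq> {}" using \<open>0 \<in> A\<close> by blast
      then obtain t where "t \<in> A" "s < t" using s(2) less_cSup_iff[OF _ bdd] unfolding x0_def by blast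
      thus ?thesis using s by (auto simp: A_def)
    qed
    have Jx0: "J x0 = 0"
    proof (cases "x0 = 0")
      case True thus ?thesis using i by (simp add: J_def)
    next
      case False
      have "closed ({0..c} \<inter> J -` {0})" by (rule continuous_closed_preimage[OF cJ]) auto
      moreover have "{0..<x0} \<subseteq> {0..c} \<inter> J -` {0}" using below x0 x by auto
      ultimately have "closure {0..<x0} \<subseteq> {0..c} \<inter> J -` {0}" by (rule closure_minimal[rotated])
      thus ?thesis using False x0 by auto
    qed
    have "x0 < x" using Jx0 Jx x0 by (cases "x0 = x") auto
    then obtain \<delta> where \<delta>: "\<delta> > 0" "\<forall>t\<in>{x0..x0+\<delta>}. t \<le> c \<longrightarrow> J t = 0"
      using ext[of x0] Jx0 x0 x by auto
    define t where "t = min x (x0 + \<delta>)"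
    have "J s = 0" if s: "s \<in> {0..t}" for s
    proof (cases "s < x0")
      case True thus ?thesis using below s by auto
    next
      case False thus ?thesis using \<delta>(2) s x by (auto simp: t_def)
    qed
    hence "t \<in> A" using x0 x \<delta>(1) by (auto simp: A_def t_def)
    hence "t \<le> x0" unfolding x0_def by (rule cSup_upper[OF _ bdd])
    thus False using \<open>x0 < x\<close> \<delta> by (auto simp: t_def)
  qed
  thus ?thesis by (simp add: J_def)
qed

end

lemma continuous_on_Icc_boundedE:
  fixes g :: "real \<Rightarrow> real"
  assumes "continuous_on {a..c} g"
  obtains K where "\<And>x. x \<in> {a..c} \<Longrightarrow> \<bar>g x\<bar> \<le> K"
proof -
  have "bounded (g ` {a..c})" by (intro compact_imp_bounded compact_continuous_image assms compact_Icc)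
  then obtain K where "\<forall>x\<in>{a..c}. norm (g x) \<le> K" unfolding bounded_iff by blast
  thus ?thesis by (intro that[of K]) auto
qed

context half_linear
begin

section \<open>Eigenvalues read off from the angle at the right end\<close>

lemma continuous_on_S [continuous_intros]: "continuous_on A g \<Longrightarrow> continuous_on A (\<lambda>x. S (g x))"
  using continuous_on_compose2[of UNIV S A g] isCont_S by (auto simp: continuous_at_imp_continuous_on)

lemma continuous_on_C [continuous_intros]: "continuous_on A g \<Longrightarrow> continuous_on A (\<lambda>x. C (g x))"
  using continuous_on_compose2[of UNIV C A g] isCont_C by (auto simp: continuous_at_imp_continuous_on)

lemma admissible_affine:
  assumes a: "admissible c a"
  shows "admissible c (\<lambda>x. u * a x + w)"
proof -
  obtain M where M: "\<And>x. x \<in> {0..c} \<Longrightarrow> \<bar>a x\<bar> \<le> M" using a unfolding admissible_def by blast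
  obtain N where N: "countable N" "\<And>x. x \<in> {0<..<c} - N \<Longrightarrow> isCont a x" using a unfolding admissible_def by blast
  have "\<bar>u * a x + w\<bar> \<le> \<bar>u\<bar> * M + \<bar>w\<bar>" if "x \<in> {0..c}" for x
  proof -
    have "\<bar>u * a x\<bar> \<le> \<bar>u\<bar> * M" unfolding abs_mult using M[OF that] by (intro mult_left_mono) auto
    thus ?thesis by linarith
  qed
  moreover have "(\<lambda>x. u * a x + w) absolutely_integrable_on {0..c}"
  proof (rule set_integral_add(1))
    show "set_integrable lebesgue {0..c} (\<lambda>x. u * a x)"
      using a by (intro set_integrable_mult_right) (auto simp: admissible_def)
    show "set_integrable lebesgue {0..c} (\<lambda>x. w)"
      by (rule absolutely_integrable_continuous_real) simp
  qed
  moreover have "isCont (\<lambda>x. u * a x + w) x" if "x \<in> {0<..<c} - N" for x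
    by (intro continuous_intros N(2)[OF that])
  ultimately show ?thesis using N(1) unfolding admissible_def by blast
qed

text \<open>The scale is normalised so that the coefficient vanishes when \<open>lam - q\<close> is
  the constant \<open>s powr p\<close>; the angle is then exactly \<open>s * x\<close>. Scales
  \<open>1\<close> and \<open>2\<close> fit the first two eigenvalues of a constant
  potential.\<close>

definition coef :: "real \<Rightarrow> real \<Rightarrow> (real \<Rightarrow> real) \<Rightarrow> real \<Rightarrow> real" where
  "coef s lam q x = s powr (1 - p) * (lam - q x) - s"

lemma admissible_coef: assumes "admissible c q" shows "admissible c (coef s lam q)"
proof -
  have "coef s lam q = (\<lambda>x. - (s powr (1 - p)) * q x + (s powr (1 - p) * lam - s))"
    by (auto simp: coef_def fun_eq_iff algebra_simps)
  thus ?thesis by (simp only: admissible_affine[OF assms])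
qed

lemma pruefer_hsol:
  assumes a: "admissible c a" and P: "pruefer s a c \<theta>" and s: "s > 0" and c: "c \<ge> 0"
  obtains r where "\<And>x. r x > 0"
    "hsol c (\<lambda>x. s powr (p - 1) * (a x + s)) (\<lambda>x. r x * S (\<theta> x)) (\<lambda>x. s * r x * C (\<theta> x))"
proof -
  \<comment> \<open>Inserting the angle equation into \<open>y' = s * r * C \<theta>\<close> leaves
    \<open>r' / r = - a * g\<close>; the same factor also satisfies the equation for the signed
    power of \<open>y'\<close>.\<close>
  define g where "g t = spow (p - 1) (S (\<theta> t)) * C (\<theta> t)" for t
  have c\<theta>: "continuous_on {0..c} \<theta>" by (rule pruefer_cont[OF P])
  have cS: "continuous_on {0..c} (\<lambda>t. S (\<theta> t))" and cC: "continuous_on {0..c} (\<lambda>t. C (\<theta> t))"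
    by (intro continuous_intros c\<theta>)+
  have cg: "continuous_on {0..c} g" unfolding g_def using p_gt_1 by (intro continuous_intros cS cC) auto
  define I where "I x = integral {0..x} (\<lambda>t. a t * g t)" for x
  have cI: "continuous_on {0..c} I" unfolding I_def by (rule admissible_integral_continuous[OF a cg c])
  obtain N1 where N1: "countable N1" "\<And>x. x \<in> {0<..<c} - N1 \<Longrightarrow> (I has_real_derivative a x * g x) (at x)"
    using admissible_integral_deriv[OF a cg] unfolding I_def[abs_def] by blast
  obtain N2 where N2: "countable N2" "\<And>x. x \<in> {0<..<c} - N2 \<Longrightarrow> (\<theta> has_real_derivative s + a x * f (\<theta> x)) (at x)"
    using pruefer_deriv[OF P] by blast
  define r where "r x = exp (- I x)" for x
  have r: "r x > 0" for x by (simp add: r_def)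
  have cr: "continuous_on {0..c} r" unfolding r_def by (intro continuous_intros cI)
  have N: "countable (N1 \<union> N2)" using N1 N2 by auto
  have dy: "((\<lambda>x. r x * S (\<theta> x)) has_real_derivative s * r x * C (\<theta> x)) (at x)" if x: "x \<in> {0<..<c} - (N1 \<union> N2)" for x
  proof -
    have dI: "((\<lambda>x. exp (- I x)) has_real_derivative exp (- I x) * - (a x * g x)) (at x)"
      using N1(2)[of x] x by (intro DERIV_fun_exp DERIV_minus) auto
    have dS: "((\<lambda>x. S (\<theta> x)) has_real_derivative C (\<theta> x) * (s + a x * f (\<theta> x))) (at x)"
      using N2(2)[of x] x by (intro DERIV_chain2[OF S_deriv]) auto
    have "((\<lambda>x. r x * S (\<theta> x)) has_real_derivative (exp (- I x) * - (a x * g x)) * S (\<theta> x) + C (\<theta> x) * (s + a x * f (\<theta> x)) * exp (- I x)) (at x)"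
      unfolding r_def by (rule DERIV_mult[OF dI dS])
    also have "(exp (- I x) * - (a x * g x)) * S (\<theta> x) + C (\<theta> x) * (s + a x * f (\<theta> x)) * exp (- I x) =
       r x * C (\<theta> x) * (s + a x * (f (\<theta> x) - S (\<theta> x) * spow (p - 1) (S (\<theta> x))))"
      by (simp add: g_def r_def algebra_simps)
    also have "S (\<theta> x) * spow (p - 1) (S (\<theta> x)) = f (\<theta> x)" by (simp add: mult_spow f_def)
    finally show ?thesis by (simp add: mult_ac)
  qed
  have cy': "continuous_on {0..c} (\<lambda>x. s * r x * C (\<theta> x))" by (intro continuous_intros cr cC)
  have dv: "((\<lambda>x. spow (p - 1) (s * r x * C (\<theta> x))) has_real_derivative
     - (p - 1) * (s powr (p - 1) * (a x + s)) * spow (p - 1) (r x * S (\<theta> x))) (at x)" if x: "x \<in> {0<..<c} - (N1 \<union> N2)" for x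
  proof -
    have eq: "spow (p - 1) (s * r t * z) = s powr (p - 1) * (exp (- (p - 1) * I t) * spow (p - 1) z)" for t z
      using s r[of t] by (simp add: spow_mult spow_pos r_def powr_def algebra_simps)
    have eq2: "spow (p - 1) (r t * z) = exp (- (p - 1) * I t) * spow (p - 1) z" for t z
      using r[of t] by (simp add: spow_mult spow_pos r_def powr_def algebra_simps)
    have dI: "((\<lambda>x. exp (- (p - 1) * I x)) has_real_derivative exp (- (p - 1) * I x) * (- (p - 1) * (a x * g x))) (at x)"
      using N1(2)[of x] x by (intro DERIV_fun_exp DERIV_cmult) auto
    have dC: "((\<lambda>x. spow (p - 1) (C (\<theta> x))) has_real_derivative - (p - 1) * spow (p - 1) (S (\<theta> x)) * (s + a x * f (\<theta> x))) (at x)"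
      using N2(2)[of x] x by (intro DERIV_chain2[OF spow_C_deriv]) auto
    have "((\<lambda>x. s powr (p - 1) * (exp (- (p - 1) * I x) * spow (p - 1) (C (\<theta> x)))) has_real_derivative
       s powr (p - 1) * ((exp (- (p - 1) * I x) * (- (p - 1) * (a x * g x))) * spow (p - 1) (C (\<theta> x))
          + (- (p - 1) * spow (p - 1) (S (\<theta> x)) * (s + a x * f (\<theta> x))) * exp (- (p - 1) * I x))) (at x)"
      by (intro DERIV_cmult DERIV_mult dI dC)
    also have "s powr (p - 1) * ((exp (- (p - 1) * I x) * (- (p - 1) * (a x * g x))) * spow (p - 1) (C (\<theta> x))
          + (- (p - 1) * spow (p - 1) (S (\<theta> x)) * (s + a x * f (\<theta> x))) * exp (- (p - 1) * I x)) =
      - (p - 1) * s powr (p - 1) * (exp (- (p - 1) * I x) * spow (p - 1) (S (\<theta> x))) *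
         (a x * (C (\<theta> x) * spow (p - 1) (C (\<theta> x)) + f (\<theta> x)) + s)"
      by (simp add: g_def algebra_simps)
    also have "C (\<theta> x) * spow (p - 1) (C (\<theta> x)) + f (\<theta> x) = 1"
      using S_C_identity[of "\<theta> x"] by (simp add: mult_spow f_def)
    finally show ?thesis unfolding eq eq2 by (simp add: mult_ac)
  qed
  have bound: "\<exists>M. \<forall>x\<in>{0..c}. \<bar>s powr (p - 1) * (a x + s)\<bar> \<le> M"
  proof -
    have "admissible c (\<lambda>x. s powr (p - 1) * a x + s powr (p - 1) * s)" by (rule admissible_affine[OF a])
    thus ?thesis unfolding admissible_def by (simp add: distrib_left)
  qed
  show ?thesis
  proof (rule that[of r])
    show "hsol c (\<lambda>x. s powr (p - 1) * (a x + s)) (\<lambda>x. r x * S (\<theta> x)) (\<lambda>x. s * r x * C (\<theta> x))"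
      unfolding hsol_def
    proof (intro conjI ballI exI[of _ "N1 \<union> N2"])
      show "((\<lambda>x. r x * S (\<theta> x)) has_real_derivative s * r x * C (\<theta> x)) (at x within {0..c})" if "x \<in> {0..c}" for x
        by (rule deriv_everywhere_of_off_countable[OF _ cy' N dy that]) (intro continuous_intros cr cS)
      show "continuous_on {0..c} (\<lambda>x. spow (p - 1) (s * r x * C (\<theta> x)))"
        using p_gt_1 by (intro continuous_intros cr cC) auto
    qed (use N dv bound in auto)
  qed (rule r)
qed

lemma AE_of_off_countable:
  assumes "countable N" "\<And>x. x \<notin> N \<Longrightarrow> P x" shows "AE x in lebesgue. P (x::real)"
proof -
  have "N \<in> null_sets lebesgue" using countable_imp_null_set_lborel[OF assms(1)] by (simp add: null_sets_completionI)
  from AE_not_in[OF this] show ?thesis by eventually_elim (rule assms(2))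
qed

lemma hsol_imp_dirichlet_solution:
  assumes H: "hsol b (\<lambda>x. lam - q x) y y'" and bc: "y 0 = 0" "y b = 0"
  shows "dirichlet_solution p b q lam y y'"
proof -
  have b0: "b > 0" by (rule b_pos)
  obtain M where M: "\<And>x. x \<in> {0..b} \<Longrightarrow> \<bar>lam - q x\<bar> \<le> M" by (rule hsol_bound[OF H]) (rule that)
  obtain N where N: "countable N" "\<And>x. x \<in> {0<..<b} - N \<Longrightarrow>
    ((\<lambda>x. spow (p - 1) (y' x)) has_real_derivative - (p - 1) * (lam - q x) * spow (p - 1) (y x)) (at x)"
    by (rule hsol_deriv[OF H]) (rule that)
  obtain K1 where K1: "\<And>x. x \<in> {0..b} \<Longrightarrow> \<bar>y' x\<bar> \<le> K1"
    by (rule continuous_on_Icc_boundedE[OF hsol_cont'[OF H]]) (rule that)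
  have csy: "continuous_on {0..b} (\<lambda>x. spow (p - 1) (y x))" using p_gt_1 by (intro continuous_intros hsol_cont[OF H]) auto
  obtain K2 where K2: "\<And>x. x \<in> {0..b} \<Longrightarrow> \<bar>spow (p - 1) (y x)\<bar> \<le> K2"
    by (rule continuous_on_Icc_boundedE[OF csy]) (rule that)
  have "abs_continuous_on {0..b} y"
  proof (rule abs_continuous_on_lipschitz)
    fix u v assume "0 \<le> u" "u \<le> v" "v \<le> b"
    thus "\<bar>y v - y u\<bar> \<le> K1 * (v - u)"
      using hsol_y_deriv[OF H] K1 by (intro lipschitz_of_bounded_deriv_off_countable[OF hsol_cont[OF H] countable_empty]) (auto intro!: exI)
  qed
  moreover have "abs_continuous_on {0..b} (\<lambda>x. spow (p - 1) (y' x))"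
  proof (rule abs_continuous_on_lipschitz)
    fix u v assume uv: "0 \<le> u" "u \<le> v" "v \<le> b"
    show "\<bar>spow (p - 1) (y' v) - spow (p - 1) (y' u)\<bar> \<le> ((p - 1) * M * K2) * (v - u)"
    proof (rule lipschitz_of_bounded_deriv_off_countable[OF hsol_cont_v[OF H] N(1) _ uv])
      fix x assume x: "x \<in> {0<..<b} - N"
      have "\<bar>- (p - 1) * (lam - q x) * spow (p - 1) (y x)\<bar> = (p - 1) * \<bar>lam - q x\<bar> * \<bar>spow (p - 1) (y x)\<bar>"
        using p_gt_1 by (simp add: abs_mult)
      also have "\<dots> \<le> (p - 1) * M * K2" using x p_gt_1 M[of x] K2[of x] by (intro mult_mono) auto
      finally show "\<exists>d. ((\<lambda>x. spow (p - 1) (y' x)) has_real_derivative d) (at x) \<and> \<bar>d\<bar> \<le> (p - 1) * M * K2" using N(2)[OF x] by blast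
    qed
  qed
  moreover have "AE x in lebesgue. x \<in> {0<..<b} \<longrightarrow>
     ((\<lambda>x. spow (p - 1) (y' x)) has_real_derivative - (p - 1) * (lam - q x) * spow (p - 1) (y x)) (at x)"
    by (rule AE_of_off_countable[OF N(1)]) (use N(2) in auto)
  ultimately show ?thesis using H bc
    unfolding dirichlet_solution_def signed_power_eq_spow hsol_def by blast
qed

text \<open>The signed power of \<open>y'\<close> minus the integral of the right-hand side is
  absolutely continuous with derivative \<open>0\<close> a.e., hence constant. The integral is
  differentiable off a countable set because \<open>q\<close> is continuous off one.\<close>

lemma dirichlet_solution_imp_hsol:
  assumes q: "admissible b q" and D: "dirichlet_solution p b q lam y y'"
  shows "hsol b (\<lambda>x. lam - q x) y y'"
proof -
  define v where "v x = spow (p - 1) (y' x)" for x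
  have dy: "\<forall>x\<in>{0..b}. (y has_real_derivative y' x) (at x within {0..b})"
    and acv: "abs_continuous_on {0..b} v"
    and ae: "AE x in lebesgue. x \<in> {0<..<b} \<longrightarrow> (v has_real_derivative - (p - 1) * (lam - q x) * spow (p - 1) (y x)) (at x)"
    using D unfolding dirichlet_solution_def signed_power_eq_spow v_def[abs_def] by auto
  have cy: "continuous_on {0..b} y" using dy by (auto intro: DERIV_continuous_on)
  have cv: "continuous_on {0..b} v" by (rule abs_continuous_on_imp_continuous_on[OF acv])
  define a where "a x = lam - q x" for x
  have a: "admissible b a" using admissible_affine[OF q, of "-1" lam] by (simp add: a_def[abs_def])
  obtain M where M: "\<And>x. x \<in> {0..b} \<Longrightarrow> \<bar>a x\<bar> \<le> M" using a unfolding admissible_def by blast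
  define g where "g t = - (p - 1) * spow (p - 1) (y t)" for t
  have cg: "continuous_on {0..b} g" unfolding g_def using p_gt_1 by (intro continuous_intros cy) auto
  define H where "H x = integral {0..x} (\<lambda>t. a t * g t)" for x
  have cH: "continuous_on {0..b} H" unfolding H_def using b_pos by (intro admissible_integral_continuous[OF a cg]) auto
  obtain N where N: "countable N" "\<And>x. x \<in> {0<..<b} - N \<Longrightarrow> (H has_real_derivative a x * g x) (at x)"
    using admissible_integral_deriv[OF a cg] unfolding H_def[abs_def] by blast
  obtain K where K: "\<And>x. x \<in> {0..b} \<Longrightarrow> \<bar>g x\<bar> \<le> K"
    by (rule continuous_on_Icc_boundedE[OF cg]) (rule that)
  have acH: "abs_continuous_on {0..b} H"
  proof (rule abs_continuous_on_lipschitz)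
    fix u w assume uv: "0 \<le> u" "u \<le> w" "w \<le> b"
    show "\<bar>H w - H u\<bar> \<le> (M * K) * (w - u)"
    proof (rule lipschitz_of_bounded_deriv_off_countable[OF cH N(1) _ uv])
      fix x assume x: "x \<in> {0<..<b} - N"
      have "\<bar>a x * g x\<bar> \<le> M * K" unfolding abs_mult using x M[of x] K[of x] by (intro mult_mono) auto
      thus "\<exists>d. (H has_real_derivative d) (at x) \<and> \<bar>d\<bar> \<le> M * K" using N(2)[OF x] by blast
    qed
  qed
  have aeN: "AE x in lebesgue. x \<notin> N" by (rule AE_of_off_countable[OF N(1)])
  have ae0: "AE x in lebesgue. x \<in> {0<..<b} \<longrightarrow> ((\<lambda>x. v x - H x) has_real_derivative 0) (at x)"
    using ae aeN
  proof eventually_elim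
    case (elim x)
    show ?case
    proof
      assume x: "x \<in> {0<..<b}"
      have "(H has_real_derivative a x * g x) (at x)" using N(2) x elim by auto
      from DERIV_diff[OF elim(1)[rule_format, OF x] this] show "((\<lambda>x. v x - H x) has_real_derivative 0) (at x)"
        by (simp add: a_def g_def algebra_simps)
    qed
  qed
  have eq: "v x = H x + v 0" if "x \<in> {0..b}" for x
    using abs_continuous_on_zero_deriv[OF abs_continuous_on_diff[OF acv acH] ae0 that] by (simp add: H_def)
  have dv: "(v has_real_derivative - (p - 1) * (lam - q x) * spow (p - 1) (y x)) (at x)" if x: "x \<in> {0<..<b} - N" for x
  proof -
    have "((\<lambda>x. H x + v 0) has_real_derivative - (p - 1) * (lam - q x) * spow (p - 1) (y x)) (at x)"
      using DERIV_add[OF N(2)[OF x] DERIV_const[of "v 0"]] by (simp add: a_def g_def algebra_simps)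
    moreover have "\<forall>\<^sub>F t in nhds x. v t = H t + v 0"
    proof (rule eventually_mono)
      show "\<forall>\<^sub>F t in nhds x. t \<in> {0<..<b}" using x by (intro eventually_nhds_in_open) auto
    qed (rule eq, auto)
    ultimately show ?thesis by (simp add: DERIV_cong_ev[OF refl _ refl])
  qed
  show ?thesis unfolding hsol_def
    using dy cv dv N(1) M unfolding v_def[abs_def] a_def by blast
qed

lemma S_eq_0D: assumes "S x = 0" obtains k :: int where "x = of_int k * b"
proof -
  have "f x = 0" using assms p_gt_1 by (simp add: f_def)
  thus ?thesis using that f_eq_0D by metis
qed

text \<open>A nontrivial solution vanishing at \<open>0\<close> is proportional to the one built
  from the angle, so it vanishes at \<open>b\<close> exactly if the angle there is a multiple of
  \<open>b\<close>. The multiple is positive because the angle is.\<close>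

lemma eigenvalue_iff:
  assumes q: "admissible b q" and s: "s > 0" and P: "pruefer s (coef s lam q) b \<theta>"
  shows "dirichlet_eigenvalue p b q lam \<longleftrightarrow> (\<exists>n::nat. n \<ge> 1 \<and> \<theta> b = real n * b)"
proof -
  have b0: "b > 0" by (rule b_pos)
  have h_eq: "(\<lambda>x. s powr (p - 1) * (coef s lam q x + s)) = (\<lambda>x. lam - q x)"
  proof
    fix x
    have "s powr (p - 1) * s powr (1 - p) = 1" using s by (subst powr_add[symmetric]) simp
    thus "s powr (p - 1) * (coef s lam q x + s) = lam - q x"
      by (simp add: coef_def mult.assoc[symmetric])
  qed
  obtain r where r: "\<And>x. r x > 0" "hsol b (\<lambda>x. s powr (p - 1) * (coef s lam q x + s)) (\<lambda>x. r x * S (\<theta> x)) (\<lambda>x. s * r x * C (\<theta> x))"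
    by (rule pruefer_hsol[OF admissible_coef[OF q] P s less_imp_le[OF b0]]) (rule that)
  note HY = r(2)[unfolded h_eq]
  have \<theta>0: "\<theta> 0 = 0" by (rule pruefer_0[OF P])
  have SC: "S u \<noteq> 0 \<or> C u \<noteq> 0" for u using S_C_identity[of u] p_gt_1 by auto
  show ?thesis
  proof
    assume "dirichlet_eigenvalue p b q lam"
    then obtain y y' x1 where y: "dirichlet_solution p b q lam y y'" "x1 \<in> {0..b}" "y x1 \<noteq> 0"
      by (auto simp: dirichlet_eigenvalue_def)
    have bc: "y 0 = 0" "y b = 0" using y(1) by (auto simp: dirichlet_solution_def)
    have H: "hsol b (\<lambda>x. lam - q x) y y'" by (rule dirichlet_solution_imp_hsol[OF q y(1)])
    have nv: "y x \<noteq> 0 \<or> y' x \<noteq> 0" if "x \<in> {0..b}" for x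
      using hsol_nonvanishing[OF H y(2) _ that] y(3) by blast
    have "y b * (s * r b * C (\<theta> b)) = y' b * (r b * S (\<theta> b))"
      by (rule hsol_proportional[OF H HY nv]) (use bc \<theta>0 b0 s r(1) SC in \<open>auto simp: less_imp_neq[symmetric]\<close>)
    hence "S (\<theta> b) = 0" using bc nv[of b] b0 r(1)[of b] by auto
    then obtain k :: int where k: "\<theta> b = of_int k * b" by (rule S_eq_0D)
    have "\<theta> b > 0" using pruefer_pos[OF P s] b0 by auto
    hence "k > 0" using k b0 by (simp add: zero_less_mult_iff)
    thus "\<exists>n::nat. n \<ge> 1 \<and> \<theta> b = real n * b" using k by (intro exI[of _ "nat k"]) auto
  next
    assume "\<exists>n::nat. n \<ge> 1 \<and> \<theta> b = real n * b"
    then obtain n :: nat where n: "\<theta> b = real n * b" by blast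
    have "S (\<theta> b) = 0" using S_shift[of 0 "int n"] n by simp
    hence D: "dirichlet_solution p b q lam (\<lambda>x. r x * S (\<theta> x)) (\<lambda>x. s * r x * C (\<theta> x))"
      by (intro hsol_imp_dirichlet_solution[OF HY]) (auto simp: \<theta>0)
    obtain x where x: "x \<in> {0<..<b} - {x \<in> {0..b}. f (\<theta> x) = 0}"
      by (rule nonempty_interval_minus_countable[OF pruefer_zeros_countable[OF P s] b0])
    hence "S (\<theta> x) \<noteq> 0" using p_gt_1 by (auto simp: f_def)
    hence "\<exists>x\<in>{0..b}. r x * S (\<theta> x) \<noteq> 0" using x r(1)[of x] by (intro bexI[of _ x]) auto
    thus "dirichlet_eigenvalue p b q lam" using D unfolding dirichlet_eigenvalue_def by blast
  qed
qed

text \<open>Under \<open>neg\<close> the constant \<beta> is a supersolution of the angle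
  equation.\<close>

lemma pruefer_barrier:
  assumes P: "pruefer s a c \<theta>" and x0: "0 \<le> x0" "x1 \<le> c" and i: "\<theta> x0 \<le> \<beta>"
    and neg: "\<And>x. x \<in> {x0<..<x1} \<Longrightarrow> s + a x * f \<beta> \<le> 0" and x: "x \<in> {x0..x1}"
  shows "\<theta> x \<le> \<beta>"
proof -
  obtain N where N: "countable N" "\<And>x. x \<in> {0<..<c} - N \<Longrightarrow> (\<theta> has_real_derivative s + a x * f (\<theta> x)) (at x)"
    using pruefer_deriv[OF P] by blast
  obtain M where M: "M > 0" "\<And>x. x \<in> {0..c} \<Longrightarrow> \<bar>a x\<bar> \<le> M" using pruefer_bound[OF P] by blast
  have "\<beta> - \<theta> x \<ge> 0"
  proof (rule gronwall_nonneg[where D="\<lambda>x. \<beta> - \<theta> x" and K="M * p", OF _ N(1) _ _ x])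
    show "continuous_on {x0..x1} (\<lambda>x. \<beta> - \<theta> x)"
      using x0 by (intro continuous_intros continuous_on_subset[OF pruefer_cont[OF P]]) auto
    fix y assume y: "y \<in> {x0<..<x1} - N"
    have "((\<lambda>x. \<beta> - \<theta> x) has_real_derivative 0 - (s + a y * f (\<theta> y))) (at y)"
      using y x0 by (intro DERIV_diff DERIV_const N(2)) auto
    moreover have "0 - (s + a y * f (\<theta> y)) \<ge> - (M * p) * \<bar>\<beta> - \<theta> y\<bar>"
    proof -
      have "\<bar>a y * (f \<beta> - f (\<theta> y))\<bar> \<le> M * (p * \<bar>\<beta> - \<theta> y\<bar>)"
        unfolding abs_mult using y x0 M by (intro mult_mono f_lipschitz) auto
      thus ?thesis using neg[of y] y by (simp add: algebra_simps abs_le_iff)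
    qed
    ultimately show "\<exists>d. ((\<lambda>x. \<beta> - \<theta> x) has_real_derivative d) (at y) \<and> d \<ge> - (M * p) * \<bar>\<beta> - \<theta> y\<bar>" by blast
  qed (use i in auto)
  thus ?thesis by simp
qed

lemma f_half [simp]: "f (b / 2) = 1" by (simp add: f_def)

text \<open>The final angle is continuous and strictly increasing in the spectral parameter and lies
  below \<open>b\<close> for very negative parameters. So up to a parameter where it equals
  \<open>k * b\<close> it takes each of the values \<open>b\<close>, ..., \<open>k * b\<close>
  exactly once, and eigenvalues are counted by these values.\<close>

lemma nth_eigenvalue_iff:
  assumes q: "admissible b q" and s: "s > 0" and n: "n \<ge> 1"
  shows "nth_dirichlet_eigenvalue p b q n lam \<longleftrightarrow> (\<exists>\<theta>. pruefer s (coef s lam q) b \<theta> \<and> \<theta> b = real n * b)"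
proof -
  have b0: "b > 0" by (rule b_pos)
  define T where "T \<mu> = (SOME \<theta>. pruefer s (coef s \<mu> q) b \<theta>)" for \<mu>
  have T: "pruefer s (coef s \<mu> q) b (T \<mu>)" for \<mu>
    unfolding T_def using pruefer_exists[OF admissible_coef[OF q]] b0 by (metis less_imp_le someI_ex)
  define \<Theta> where "\<Theta> \<mu> = T \<mu> b" for \<mu>
  have mono: "\<Theta> \<mu> < \<Theta> \<nu>" if "\<mu> < \<nu>" for \<mu> \<nu>
    unfolding \<Theta>_def using that s b0
    by (intro pruefer_less_strict[OF T T s, of 0]) (auto simp: coef_def pruefer_0[OF T])
  have inj: "inj_on \<Theta> A" for A by (rule inj_onI) (metis mono linorder_neqE_linordered_idom less_irrefl)
  have cont: "continuous_on UNIV \<Theta>" unfolding \<Theta>_def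
    by (rule pruefer_param_continuous[where c=b and s=s and a="\<lambda>\<mu>. coef s \<mu> q" and K="s powr (1 - p)"])
       (use T b0 in \<open>auto simp: coef_def right_diff_distrib[symmetric] abs_mult\<close>)
  obtain M where M: "\<And>x. x \<in> {0..b} \<Longrightarrow> \<bar>q x\<bar> \<le> M" using q unfolding admissible_def by blast
  \<comment> \<open>At the angle \<open>b / 2\<close>, where \<open>f = 1\<close>, the slope is
    \<open>s powr (1 - p) * (\<mu> - q x)\<close>. It is not positive for \<mu> at most
    \<open>- M\<close>, so \<open>b / 2\<close> is a barrier.\<close>
  have low: "\<Theta> \<mu> \<le> b / 2" if "\<mu> \<le> - M" for \<mu>
    unfolding \<Theta>_def
  proof (rule pruefer_barrier[OF T, of 0 b])
    fix x assume "x \<in> {0<..<b}"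
    hence "\<mu> - q x \<le> 0" using M[of x] that by auto
    thus "s + coef s \<mu> q x * f (b / 2) \<le> 0" by (simp add: coef_def mult_nonneg_nonpos)
  qed (use b0 pruefer_0[OF T] in auto)
  have eig: "dirichlet_eigenvalue p b q \<mu> \<longleftrightarrow> (\<exists>k::nat. k \<ge> 1 \<and> \<Theta> \<mu> = real k * b)" for \<mu>
    unfolding \<Theta>_def by (rule eigenvalue_iff[OF q s T])
  have card: "finite {\<mu>. dirichlet_eigenvalue p b q \<mu> \<and> \<mu> \<le> l} \<and> card {\<mu>. dirichlet_eigenvalue p b q \<mu> \<and> \<mu> \<le> l} = k"
    if l: "\<Theta> l = real k * b" for l k
  proof -
    define A where "A = {\<mu>. dirichlet_eigenvalue p b q \<mu> \<and> \<mu> \<le> l}"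
    have "\<Theta> ` A = (\<lambda>j::nat. real j * b) ` {1..k}"
    proof (intro equalityI subsetI)
      fix t assume "t \<in> \<Theta> ` A"
      then obtain \<mu> where \<mu>: "dirichlet_eigenvalue p b q \<mu>" "\<mu> \<le> l" "t = \<Theta> \<mu>" by (auto simp: A_def)
      then obtain j :: nat where j: "j \<ge> 1" "\<Theta> \<mu> = real j * b" using eig by blast
      have "\<Theta> \<mu> \<le> \<Theta> l" using \<mu>(2) mono[of \<mu> l] by (cases "\<mu> = l") auto
      hence "j \<le> k" using j l b0 by simp
      thus "t \<in> (\<lambda>j::nat. real j * b) ` {1..k}" using j \<mu> by auto
    next
      fix t assume "t \<in> (\<lambda>j::nat. real j * b) ` {1..k}"
      then obtain j :: nat where j: "j \<ge> 1" "j \<le> k" "t = real j * b" by auto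
      define lo where "lo = min (- M) l"
      have "\<Theta> lo \<le> b / 2" by (rule low) (simp add: lo_def)
      also have "b / 2 \<le> real j * b" using j b0 by (simp add: mult_le_cancel_right1 field_simps)
      finally have "\<Theta> lo \<le> t" using j by simp
      moreover have "t \<le> \<Theta> l" using j l b0 by simp
      ultimately have "\<exists>\<mu>\<ge>lo. \<mu> \<le> l \<and> \<Theta> \<mu> = t"
        by (intro IVT') (auto simp: lo_def intro: continuous_on_subset[OF cont])
      then obtain \<mu> where "\<mu> \<le> l" "\<Theta> \<mu> = t" by blast
      moreover have "dirichlet_eigenvalue p b q \<mu>" using eig[of \<mu>] j calculation by auto
      ultimately show "t \<in> \<Theta> ` A" by (auto simp: A_def)
    qed
    moreover have "inj_on (\<lambda>j::nat. real j * b) {1..k}" using b0 by (auto intro: inj_onI)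
    ultimately have "finite (\<Theta> ` A)" "card (\<Theta> ` A) = k" by (simp_all add: card_image)
    thus ?thesis using inj[of A] by (auto simp: A_def[symmetric] card_image dest: finite_imageD)
  qed
  show ?thesis
  proof
    assume nth: "nth_dirichlet_eigenvalue p b q n lam"
    then obtain k :: nat where k: "\<Theta> lam = real k * b" using eig by (auto simp: nth_dirichlet_eigenvalue_def)
    hence "k = n" using card[OF k] nth by (auto simp: nth_dirichlet_eigenvalue_def)
    thus "\<exists>\<theta>. pruefer s (coef s lam q) b \<theta> \<and> \<theta> b = real n * b" using T k unfolding \<Theta>_def by blast
  next
    assume "\<exists>\<theta>. pruefer s (coef s lam q) b \<theta> \<and> \<theta> b = real n * b"
    then obtain \<theta> where \<theta>: "pruefer s (coef s lam q) b \<theta>" "\<theta> b = real n * b" by blast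
    have "\<Theta> lam = real n * b" unfolding \<Theta>_def using pruefer_unique[OF T \<theta>(1), of b] \<theta>(2) b0 by auto
    thus "nth_dirichlet_eigenvalue p b q n lam"
      unfolding nth_dirichlet_eigenvalue_def using card[of lam n] eig[of lam] n by auto
  qed
qed

end

section \<open>Riccati comparison\<close>

text \<open>Increments of fixed length of a convex function grow: the derivative in the base point
  is a difference of values of the increasing function \<open>spow (r - 1)\<close>.\<close>

lemma abs_powr_increment_mono:
  fixes d :: real
  assumes r: "r > 1" and d: "d \<ge> 0" and w: "w2 \<le> w1"
  shows "\<bar>w2\<bar> powr r - \<bar>w2 - d\<bar> powr r \<le> \<bar>w1\<bar> powr r - \<bar>w1 - d\<bar> powr r"
proof (rule DERIV_nonneg_imp_nondecreasing[OF w])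
  fix t
  have 2: "((\<lambda>t. \<bar>t - d\<bar> powr r) has_real_derivative r * spow (r - 1) (t - d) * 1) (at t)"
    by (rule DERIV_chain2[OF abs_powr_has_derivative[OF r]]) (auto intro!: derivative_eq_intros)
  have "((\<lambda>t. \<bar>t\<bar> powr r - \<bar>t - d\<bar> powr r) has_real_derivative r * spow (r - 1) t - r * spow (r - 1) (t - d) * 1) (at t)"
    by (rule DERIV_diff[OF abs_powr_has_derivative[OF r] 2])
  moreover have "spow (r - 1) (t - d) \<le> spow (r - 1) t" using r d by (subst spow_le_iff) auto
  ultimately show "\<exists>y. ((\<lambda>t. \<bar>t\<bar> powr r - \<bar>t - d\<bar> powr r) has_real_derivative y) (at t) \<and> 0 \<le> y"
    using r by (intro exI conjI) auto
qed

lemma abs_powr_increment_strict_mono: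
  fixes d :: real
  assumes r: "r > 1" and d: "d > 0" and w: "w2 < w1"
  shows "\<bar>w2\<bar> powr r - \<bar>w2 - d\<bar> powr r < \<bar>w1\<bar> powr r - \<bar>w1 - d\<bar> powr r"
proof (rule DERIV_pos_imp_increasing[OF w])
  fix t
  have 2: "((\<lambda>t. \<bar>t - d\<bar> powr r) has_real_derivative r * spow (r - 1) (t - d) * 1) (at t)"
    by (rule DERIV_chain2[OF abs_powr_has_derivative[OF r]]) (auto intro!: derivative_eq_intros)
  have "((\<lambda>t. \<bar>t\<bar> powr r - \<bar>t - d\<bar> powr r) has_real_derivative r * spow (r - 1) t - r * spow (r - 1) (t - d) * 1) (at t)"
    by (rule DERIV_diff[OF abs_powr_has_derivative[OF r] 2])
  moreover have "spow (r - 1) (t - d) < spow (r - 1) t" using r d by (subst spow_less_iff) auto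
  ultimately show "\<exists>y. ((\<lambda>t. \<bar>t\<bar> powr r - \<bar>t - d\<bar> powr r) has_real_derivative y) (at t) \<and> 0 < y"
    using r by (intro exI conjI) auto
qed

context half_linear
begin

text \<open>The signed power of the generalised cotangent. For a solution with angle \<theta> at
  scale \<open>1\<close> the Riccati variable is \<open>wp \<theta>\<close>.\<close>

definition wp :: "real \<Rightarrow> real" where "wp x = spow (p - 1) (C x) / spow (p - 1) (S x)"

lemma wp_deriv:
  assumes S0: "S x \<noteq> 0"
  shows "(wp has_real_derivative - (p - 1) * (1 / f x)) (at x)"
proof -
  have dS: "((\<lambda>x. spow (p - 1) (S x)) has_real_derivative ((p - 1) * \<bar>S x\<bar> powr (p - 1 - 1)) * C x) (at x)"
    by (rule DERIV_chain2[OF spow_has_derivative[OF S0] S_deriv])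
  have s0: "spow (p - 1) (S x) \<noteq> 0" using S0 by simp
  have sq: "spow (p - 1) (S x) * spow (p - 1) (S x) = \<bar>S x\<bar> powr p * \<bar>S x\<bar> powr (p - 1 - 1)"
  proof -
    have "spow (p - 1) (S x) * spow (p - 1) (S x) = \<bar>S x\<bar> powr (p - 1) * \<bar>S x\<bar> powr (p - 1)"
      by (metis abs_mult_self_eq abs_spow)
    also have "\<dots> = \<bar>S x\<bar> powr (p + (p - 1 - 1))" by (subst powr_add[symmetric]) simp
    also have "\<dots> = \<bar>S x\<bar> powr p * \<bar>S x\<bar> powr (p - 1 - 1)" by (rule powr_add)
    finally show ?thesis .
  qed
  have "(wp has_real_derivative (- (p - 1) * spow (p - 1) (S x) * spow (p - 1) (S x) -
      spow (p - 1) (C x) * (((p - 1) * \<bar>S x\<bar> powr (p - 1 - 1)) * C x)) / (spow (p - 1) (S x) * spow (p - 1) (S x))) (at x)"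
    unfolding wp_def[abs_def] by (rule DERIV_divide[OF spow_C_deriv dS s0])
  also have "spow (p - 1) (S x) * spow (p - 1) (S x) = \<bar>S x\<bar> powr p * \<bar>S x\<bar> powr (p - 1 - 1)" by (rule sq)
  also have "(- (p - 1) * spow (p - 1) (S x) * spow (p - 1) (S x) -
      spow (p - 1) (C x) * (((p - 1) * \<bar>S x\<bar> powr (p - 1 - 1)) * C x)) =
      - (p - 1) * (spow (p - 1) (S x) * spow (p - 1) (S x) + (C x * spow (p - 1) (C x)) * \<bar>S x\<bar> powr (p - 1 - 1))"
    by (simp add: algebra_simps)
  also note sq
  also have "C x * spow (p - 1) (C x) = \<bar>C x\<bar> powr p" by (simp add: mult_spow)
  also have "\<bar>S x\<bar> powr p * \<bar>S x\<bar> powr (p - 1 - 1) + \<bar>C x\<bar> powr p * \<bar>S x\<bar> powr (p - 1 - 1) = \<bar>S x\<bar> powr (p - 1 - 1)"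
    using S_C_identity[of x] by (simp add: distrib_right[symmetric])
  finally show ?thesis using S0 by (simp add: f_def)
qed

lemma abs_wp_powr: assumes "S x \<noteq> 0" shows "\<bar>wp x\<bar> powr (p / (p - 1)) = 1 / f x - 1"
proof -
  have "\<bar>wp x\<bar> powr (p / (p - 1)) = \<bar>C x\<bar> powr p / \<bar>S x\<bar> powr p"
    unfolding wp_def abs_divide abs_spow powr_divide powr_powr conj_exp(3) by simp
  also have "\<dots> = (1 - f x) / f x" using S_C_identity[of x] by (simp add: f_def)
  also have "\<dots> = 1 / f x - 1" using assms by (simp add: f_def diff_divide_distrib)
  finally show ?thesis .
qed

lemma wp_minus: "wp (- x) = - wp x" by (simp add: wp_def S_minus C_minus spow_minus)
lemma wp_shift: "wp (x + of_int k * b) = wp x" by (simp add: wp_def S_shift C_shift spow_minus)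
lemma wp_reflect: "wp (of_int k * b - x) = - wp x" using wp_shift[of "-x" k] by (simp add: wp_minus)
lemma wp_half [simp]: "wp (b / 2) = 0" by (simp add: wp_def)

lemma S_nz: "0 < x \<Longrightarrow> x < b \<Longrightarrow> S x \<noteq> 0" using S_pos[of x] by simp

lemma wp_strict_antimono: assumes "0 < x" "x < y" "y < b" shows "wp y < wp x"
proof (rule DERIV_neg_imp_decreasing[OF assms(2)])
  fix t assume t: "x \<le> t" "t \<le> y"
  hence "f t > 0" "S t \<noteq> 0" using assms f_pos[of t] S_nz[of t] by auto
  thus "\<exists>d. (wp has_real_derivative d) (at t) \<and> d < 0"
    using wp_deriv[of t] p_gt_1 by (intro exI[of _ "- (p - 1) * (1 / f t)"]) (simp add: divide_neg_pos)
qed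

lemma wp_antimono: "0 < x \<Longrightarrow> x \<le> y \<Longrightarrow> y < b \<Longrightarrow> wp y \<le> wp x"
  using wp_strict_antimono[of x y] by (cases "x = y") auto

lemma wp_less_iff: "0 < x \<Longrightarrow> x < b \<Longrightarrow> 0 < y \<Longrightarrow> y < b \<Longrightarrow> wp y < wp x \<longleftrightarrow> x < y"
  using wp_strict_antimono[of x y] wp_antimono[of y x] by force

lemma isCont_wp: "S x \<noteq> 0 \<Longrightarrow> isCont wp x" using wp_deriv DERIV_isCont by blast

lemma abs_S_le: "\<bar>S x\<bar> \<le> \<bar>x\<bar>"
proof -
  have "norm (S x - S 0) \<le> 1 * norm (x - 0)"
    by (rule field_differentiable_bound[of UNIV S C]) (auto intro: S_deriv abs_C_le_1)
  thus ?thesis by simp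
qed

lemma f_le_powr: "f x \<le> \<bar>x\<bar> powr p"
  unfolding f_def using abs_S_le[of x] p_gt_1 by (intro powr_mono2) auto

lemma S_ge_half_near_0: obtains u0 where "u0 > 0" "u0 < b / 2" "\<And>u. 0 \<le> u \<Longrightarrow> u \<le> u0 \<Longrightarrow> S u \<ge> u / 2"
proof -
  have "\<forall>\<^sub>F u in nhds 0. C u > 1/2"
    using isCont_C[of 0] by (intro order_tendstoD(1)[where y="C 0"]) (auto simp: isCont_def tendsto_nhds_iff)
  then obtain e where e: "e > 0" "\<And>u. dist u 0 < e \<Longrightarrow> C u > 1/2" unfolding eventually_nhds_metric by blast
  define u0 where "u0 = min (e/2) (b/4)"
  show ?thesis
  proof (rule that[of u0])
    fix u :: real assume u: "0 \<le> u" "u \<le> u0"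
    have "S 0 - 0 / 2 \<le> S u - u / 2"
    proof (rule DERIV_nonneg_imp_nondecreasing[OF u(1)])
      fix t assume t: "0 \<le> t" "t \<le> u"
      have "((\<lambda>a. S a - a / 2) has_real_derivative C t - 1 / 2) (at t)"
        by (intro DERIV_diff S_deriv) (auto intro!: derivative_eq_intros)
      moreover have "C t > 1/2" using e t u by (auto simp: u0_def)
      ultimately show "\<exists>y. ((\<lambda>a. S a - a / 2) has_real_derivative y) (at t) \<and> 0 \<le> y" by (intro exI conjI) auto
    qed
    thus "S u \<ge> u / 2" by simp
  qed (use e b_pos in \<open>auto simp: u0_def\<close>)
qed

text \<open>A crude linear bound for the angle comes first; with it, the bound
  \<open>f \<theta> \<le> \<bar>\<theta>\<bar> powr p\<close> makes the deviation of the slope from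
  \<open>1\<close> of order \<open>x powr p\<close>, and integration gives one more power.\<close>

lemma pruefer_near_0:
  assumes P: "pruefer 1 a c \<theta>" and c: "c > 0"
  obtains B where "B > 0" "\<And>x. x \<in> {0..c} \<Longrightarrow> \<bar>\<theta> x - x\<bar> \<le> B * x powr p * x"
proof -
  obtain N where N: "countable N" "\<And>x. x \<in> {0<..<c} - N \<Longrightarrow> (\<theta> has_real_derivative 1 + a x * f (\<theta> x)) (at x)"
    using pruefer_deriv[OF P] by blast
  obtain M where M: "M > 0" "\<And>x. x \<in> {0..c} \<Longrightarrow> \<bar>a x\<bar> \<le> M" using pruefer_bound[OF P] by blast
  have lin: "\<bar>\<theta> x\<bar> \<le> (1 + M) * x" if x: "x \<in> {0..c}" for x
  proof -
    have "\<bar>\<theta> x - \<theta> 0\<bar> \<le> (1 + M) * (x - 0)"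
    proof (rule lipschitz_of_bounded_deriv_off_countable[OF pruefer_cont[OF P] N(1)])
      fix t assume t: "t \<in> {0<..<c} - N"
      have "\<bar>a t\<bar> * f (\<theta> t) \<le> M * 1" using M t f_le_1 by (intro mult_mono) auto
      hence "\<bar>1 + a t * f (\<theta> t)\<bar> \<le> 1 + M" using abs_triangle_ineq[of 1 "a t * f (\<theta> t)"] by (simp add: abs_mult)
      thus "\<exists>d. (\<theta> has_real_derivative d) (at t) \<and> \<bar>d\<bar> \<le> 1 + M" using N(2)[OF t] by blast
    qed (use x in auto)
    thus ?thesis by (simp add: pruefer_0[OF P])
  qed
  define B where "B = M * (1 + M) powr p"
  show ?thesis
  proof (rule that[of B])
    show "B > 0" using M by (simp add: B_def)
    fix x assume x: "x \<in> {0..c}"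
    have "\<bar>(\<theta> x - x) - (\<theta> 0 - 0)\<bar> \<le> (B * x powr p) * (x - 0)"
    proof (rule lipschitz_of_bounded_deriv_off_countable[where f="\<lambda>x. \<theta> x - x" and a=0 and b=x, OF _ N(1)])
      show "continuous_on {0..x} (\<lambda>x. \<theta> x - x)"
        using x by (intro continuous_intros continuous_on_subset[OF pruefer_cont[OF P]]) auto
      fix t assume t: "t \<in> {0<..<x} - N"
      have "((\<lambda>x. \<theta> x - x) has_real_derivative (1 + a t * f (\<theta> t)) - 1) (at t)"
        using t x by (intro DERIV_diff N(2) DERIV_ident) auto
      moreover have "\<bar>(1 + a t * f (\<theta> t)) - 1\<bar> \<le> B * x powr p"
      proof -
        have "f (\<theta> t) \<le> \<bar>\<theta> t\<bar> powr p" by (rule f_le_powr)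
        also have "\<dots> \<le> ((1 + M) * x) powr p"
          using lin[of t] t x M p_gt_1 by (intro powr_mono2) (auto intro: order_trans[OF _ mult_left_mono])
        also have "\<dots> = (1 + M) powr p * x powr p" using M x by (simp add: powr_mult)
        finally have "\<bar>a t\<bar> * f (\<theta> t) \<le> M * ((1 + M) powr p * x powr p)" using M t x by (intro mult_mono) auto
        thus ?thesis by (simp add: B_def abs_mult mult.assoc)
      qed
      ultimately show "\<exists>d. ((\<lambda>x. \<theta> x - x) has_real_derivative d) (at t) \<and> \<bar>d\<bar> \<le> B * x powr p" by blast
    qed (use x in auto)
    thus "\<bar>\<theta> x - x\<bar> \<le> B * x powr p * x" by (simp add: pruefer_0[OF P])
  qed
qed

text \<open>Both terms blow up at \<open>0\<close>. But the angles differ only by a multiple of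
  \<open>x powr (p + 1)\<close>, while the derivative of \<open>wp\<close> is of order
  \<open>x powr (- p)\<close>, so the difference is of order \<open>x\<close>.\<close>

lemma wp_diff_tendsto_0:
  assumes P: "pruefer 1 a c \<phi>" and Q: "pruefer 1 A c \<psi>" and c: "c > 0"
  shows "((\<lambda>x. wp (\<phi> x) - wp (\<psi> x)) \<longlongrightarrow> 0) (at_right 0)"
proof -
  obtain B1 where B1: "B1 > 0" "\<And>x. x \<in> {0..c} \<Longrightarrow> \<bar>\<phi> x - x\<bar> \<le> B1 * x powr p * x"
    by (rule pruefer_near_0[OF P c]) (rule that)
  obtain B2 where B2: "B2 > 0" "\<And>x. x \<in> {0..c} \<Longrightarrow> \<bar>\<psi> x - x\<bar> \<le> B2 * x powr p * x"
    by (rule pruefer_near_0[OF Q c]) (rule that)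
  define B where "B = max B1 B2"
  obtain u0 where u0: "u0 > 0" "u0 < b / 2" "\<And>u. 0 \<le> u \<Longrightarrow> u \<le> u0 \<Longrightarrow> S u \<ge> u / 2"
    by (rule S_ge_half_near_0) (rule that)
  \<comment> \<open>The factor \<open>4 powr p\<close> comes from \<open>S u \<ge> x / 4\<close> for
    \<open>u\<close> in \<open>{x/2..3/2*x}\<close>, the factor \<open>2 * B\<close> from the errors
    of the two angles.\<close>
  define K where "K = (p - 1) * 4 powr p * (2 * B)"
  have ev1: "\<forall>\<^sub>F x in at_right (0::real). B * x powr p < 1 / 2"
  proof -
    have "((\<lambda>x::real. B * x powr p) \<longlongrightarrow> B * 0 powr p) (at_right 0)"
      using p_gt_1 eventually_at_right_less[of "0::real"]
      by (intro tendsto_intros tendsto_powr') (auto elim!: eventually_mono)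
    thus ?thesis by (rule order_tendstoD) simp
  qed
  have ev2: "\<forall>\<^sub>F x in at_right (0::real). x \<in> {0<..<min c (u0/2)}"
    using c u0 by (intro eventually_at_right_real) auto
  have ev: "\<forall>\<^sub>F x in at_right 0. norm (wp (\<phi> x) - wp (\<psi> x)) \<le> K * x"
    using ev1 ev2
  proof eventually_elim
    case (elim x)
    have x: "x > 0" "x \<in> {0..c}" "3 / 2 * x < u0" using elim by auto
    have Bx: "B * x powr p * x \<le> x / 2" using elim(1) x by (simp add: mult_right_mono[of _ "1/2" x, simplified])
    have le: "B1 * x powr p * x \<le> B * x powr p * x" "B2 * x powr p * x \<le> B * x powr p * x"
      using x by (auto simp: B_def intro!: mult_right_mono)
    have d: "\<bar>\<phi> x - x\<bar> \<le> B * x powr p * x" "\<bar>\<psi> x - x\<bar> \<le> B * x powr p * x"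
      using B1(2)[OF x(2)] B2(2)[OF x(2)] le by linarith+
    have I: "\<phi> x \<in> {x/2..3/2*x}" "\<psi> x \<in> {x/2..3/2*x}" using d Bx by (auto simp: abs_le_iff)
    have "norm (wp (\<phi> x) - wp (\<psi> x)) \<le> ((p - 1) * (4 powr p / x powr p)) * norm (\<phi> x - \<psi> x)"
    proof (rule field_differentiable_bound[OF _ _ _ I(1) I(2)])
      fix u assume u: "u \<in> {x/2..3/2*x}"
      have Su: "S u \<ge> x / 4" using u0(3)[of u] u x by auto
      hence S0: "S u \<noteq> 0" using x by auto
      show "(wp has_field_derivative - (p - 1) * (1 / f u)) (at u within {x/2..3/2*x})"
        by (rule has_field_derivative_at_within[OF wp_deriv[OF S0]])
      have "(x / 4) powr p \<le> f u" unfolding f_def using Su x p_gt_1 by (intro powr_mono2) auto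
      hence "1 / f u \<le> 1 / (x / 4) powr p" using x by (intro divide_left_mono) (auto intro!: mult_pos_pos simp: f_def S0)
      also have "\<dots> = 4 powr p / x powr p" using x by (simp add: powr_divide)
      finally show "norm (- (p - 1) * (1 / f u)) \<le> (p - 1) * (4 powr p / x powr p)"
        using p_gt_1 mult_left_mono[of "1 / f u" "4 powr p / x powr p" "p - 1"] by (simp add: abs_mult)
    qed simp
    also have "\<dots> \<le> ((p - 1) * (4 powr p / x powr p)) * (2 * (B * x powr p * x))"
      using d p_gt_1 by (intro mult_left_mono) (auto simp: abs_le_iff)
    also have "\<dots> = K * x" using x by (simp add: K_def field_simps)
    finally show ?case .
  qed
  have "((\<lambda>x::real. K * x) \<longlongrightarrow> K * 0) (at_right 0)" by (intro tendsto_intros)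
  thus ?thesis using Lim_null_comparison[OF ev] by simp
qed

lemma wp_pruefer_deriv:
  assumes d: "(\<theta> has_real_derivative 1 + a x * f (\<theta> x)) (at x)" and r: "0 < \<theta> x" "\<theta> x < b"
  shows "((\<lambda>x. wp (\<theta> x)) has_real_derivative - (p - 1) * (\<bar>wp (\<theta> x)\<bar> powr (p / (p - 1)) + 1 + a x)) (at x)"
proof -
  have S0: "S (\<theta> x) \<noteq> 0" using S_nz r by auto
  have f0: "f (\<theta> x) > 0" using f_pos r by auto
  have "((\<lambda>x. wp (\<theta> x)) has_real_derivative - (p - 1) * (1 / f (\<theta> x)) * (1 + a x * f (\<theta> x))) (at x)"
    by (rule DERIV_chain2[OF wp_deriv[OF S0] d])
  also have "- (p - 1) * (1 / f (\<theta> x)) * (1 + a x * f (\<theta> x)) = - (p - 1) * (1 / f (\<theta> x) + a x)"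
    using f0 by (simp add: field_simps)
  also have "1 / f (\<theta> x) + a x = \<bar>wp (\<theta> x)\<bar> powr (p / (p - 1)) + 1 + a x" using abs_wp_powr[OF S0] by simp
  finally show ?thesis .
qed

lemma continuous_on_wp:
  assumes "continuous_on A g" "\<And>x. x \<in> A \<Longrightarrow> 0 < g x \<and> g x < b" shows "continuous_on A (\<lambda>x. wp (g x))"
  using assms S_nz isCont_wp
  by (intro continuous_on_compose2[of "{0<..<b}" wp A g] continuous_at_imp_continuous_on) auto

end

text \<open>\<phi> belongs to the given coefficient and \<psi> to the comparison; in both, the
  second equation differs from the first by the same \<delta>, which makes the coefficients cancel.
  \<open>b1\<close> and \<open>b2\<close> keep the angles on the first branch, where
  \<open>wp\<close> is decreasing. No such bound is put on \<psi>2, whose being ahead is the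
  goal.\<close>

locale riccati_pair = half_linear +
  fixes a A \<phi>1 \<phi>2 \<psi>1 \<psi>2 :: "real \<Rightarrow> real" and c \<delta> \<zeta> :: real
  assumes P1: "pruefer 1 a c \<phi>1" and P2: "pruefer 1 (\<lambda>x. a x + \<delta>) c \<phi>2"
    and Q1: "pruefer 1 A c \<psi>1" and Q2: "pruefer 1 (\<lambda>x. A x + \<delta>) c \<psi>2"
    and \<delta>: "\<delta> > 0" and \<zeta>: "0 < \<zeta>" "\<zeta> \<le> c"
    and le: "\<And>x. x \<in> {0<..<\<zeta>} \<Longrightarrow> \<phi>1 x \<le> \<psi>1 x"
    and b1: "\<And>x. x \<in> {0<..<\<zeta>} \<Longrightarrow> \<psi>1 x < b" and b2: "\<And>x. x \<in> {0<..<\<zeta>} \<Longrightarrow> \<phi>2 x < b"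
begin

definition D :: "real \<Rightarrow> real" where
  "D x = (wp (\<phi>2 x) - wp (\<psi>2 x)) - (wp (\<phi>1 x) - wp (\<psi>1 x))"

definition d1 :: "real \<Rightarrow> real" where "d1 x = wp (\<phi>1 x) - wp (\<psi>1 x)"

abbreviation g :: "real \<Rightarrow> real" where "g w \<equiv> \<bar>w\<bar> powr (p / (p - 1))"

text \<open>The derivative of \<open>D\<close>, split for the estimate. The first summand compares
  two increments of the convex \<open>g\<close> over the same length \<open>d1\<close> and is
  nonnegative. In the second the two arguments of \<open>g\<close> differ by exactly
  \<open>D\<close>, so it is an error term of Gronwall type.\<close>

definition D' :: "real \<Rightarrow> real" where
  "D' x = (p - 1) * ((g (wp (\<phi>1 x)) - g (wp (\<phi>1 x) - d1 x)) - (g (wp (\<phi>2 x)) - g (wp (\<phi>2 x) - d1 x)))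
     + (p - 1) * (g (wp (\<psi>2 x)) - g (wp (\<phi>2 x) - d1 x))"

lemma pos: "x \<in> {0<..<\<zeta>} \<Longrightarrow> 0 < \<phi>1 x \<and> 0 < \<phi>2 x \<and> 0 < \<psi>1 x \<and> 0 < \<psi>2 x"
  using pruefer_pos[OF P1] pruefer_pos[OF P2] pruefer_pos[OF Q1] pruefer_pos[OF Q2] \<zeta> by auto

lemma \<phi>_less: "x \<in> {0<..<\<zeta>} \<Longrightarrow> \<phi>1 x < \<phi>2 x"
  using \<delta> \<zeta> by (intro pruefer_less_strict[OF P1 P2 _ order_refl]) (auto simp: pruefer_0[OF P1] pruefer_0[OF P2])

lemma w_less: "x \<in> {0<..<\<zeta>} \<Longrightarrow> wp (\<phi>2 x) < wp (\<phi>1 x)"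
  using \<phi>_less[of x] pos[of x] b2[of x] by (intro wp_strict_antimono) auto

lemma d1_nonneg: "x \<in> {0<..<\<zeta>} \<Longrightarrow> d1 x \<ge> 0"
  unfolding d1_def using le[of x] pos[of x] b1[of x] wp_antimono[of "\<phi>1 x" "\<psi>1 x"] by simp

lemma W2_eq: "wp (\<psi>2 x) = wp (\<phi>2 x) - d1 x - D x" and W1_eq: "wp (\<psi>1 x) = wp (\<phi>1 x) - d1 x"
  by (simp_all add: D_def d1_def)

lemma D_deriv:
  obtains N where "countable N" "\<And>x. x \<in> {0<..<\<zeta>} - N \<Longrightarrow> \<psi>2 x < b \<Longrightarrow> (D has_real_derivative D' x) (at x)"
proof -
  obtain N1 where N1: "countable N1" "\<And>x. x \<in> {0<..<c} - N1 \<Longrightarrow> (\<phi>1 has_real_derivative 1 + a x * f (\<phi>1 x)) (at x)"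
    using pruefer_deriv[OF P1] by blast
  obtain N2 where N2: "countable N2" "\<And>x. x \<in> {0<..<c} - N2 \<Longrightarrow> (\<phi>2 has_real_derivative 1 + (a x + \<delta>) * f (\<phi>2 x)) (at x)"
    using pruefer_deriv[OF P2] by blast
  obtain N3 where N3: "countable N3" "\<And>x. x \<in> {0<..<c} - N3 \<Longrightarrow> (\<psi>1 has_real_derivative 1 + A x * f (\<psi>1 x)) (at x)"
    using pruefer_deriv[OF Q1] by blast
  obtain N4 where N4: "countable N4" "\<And>x. x \<in> {0<..<c} - N4 \<Longrightarrow> (\<psi>2 has_real_derivative 1 + (A x + \<delta>) * f (\<psi>2 x)) (at x)"
    using pruefer_deriv[OF Q2] by blast
  show ?thesis
  proof (rule that[of "N1 \<union> N2 \<union> N3 \<union> N4"])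
    fix x assume x: "x \<in> {0<..<\<zeta>} - (N1 \<union> N2 \<union> N3 \<union> N4)" and xb: "\<psi>2 x < b"
    have xc: "x \<in> {0<..<c}" "x \<in> {0<..<\<zeta>}" using x \<zeta> by auto
    have lt: "\<phi>1 x < b" using le[OF xc(2)] b1[OF xc(2)] by simp
    note ps = pos[OF xc(2)]
    have "(D has_real_derivative
       (- (p - 1) * (g (wp (\<phi>2 x)) + 1 + (a x + \<delta>)) - - (p - 1) * (g (wp (\<psi>2 x)) + 1 + (A x + \<delta>)))
       - (- (p - 1) * (g (wp (\<phi>1 x)) + 1 + a x) - - (p - 1) * (g (wp (\<psi>1 x)) + 1 + A x))) (at x)"
      unfolding D_def[abs_def]
      using x xc ps lt xb b1[OF xc(2)] b2[OF xc(2)]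
      by (intro DERIV_diff wp_pruefer_deriv N1(2) N2(2) N3(2) N4(2)) auto
    thus "(D has_real_derivative D' x) (at x)"
      by (simp add: D'_def W1_eq[of x, symmetric] algebra_simps)
  qed (use N1 N2 N3 N4 in auto)
qed

lemma D_cont:
  assumes "\<And>x. x \<in> I \<Longrightarrow> x \<in> {0<..<\<zeta>} \<and> \<psi>2 x < b"
  shows "continuous_on I D"
proof -
  have sub: "I \<subseteq> {0..c}" using assms \<zeta> by force
  have "\<phi>1 x < b" if "x \<in> I" for x using le[of x] b1[of x] assms[OF that] by auto
  hence "continuous_on I (\<lambda>x. wp (\<phi>1 x))" "continuous_on I (\<lambda>x. wp (\<phi>2 x))" "continuous_on I (\<lambda>x. wp (\<psi>1 x))" "continuous_on I (\<lambda>x. wp (\<psi>2 x))"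
    using assms pos b1 b2 le
    by (auto intro!: continuous_on_wp continuous_on_subset[OF pruefer_cont[OF P1] sub] continuous_on_subset[OF pruefer_cont[OF P2] sub]
       continuous_on_subset[OF pruefer_cont[OF Q1] sub] continuous_on_subset[OF pruefer_cont[OF Q2] sub])
  thus ?thesis unfolding D_def[abs_def] by (intro continuous_intros)
qed

lemma convexity_term: "x \<in> {0<..<\<zeta>} \<Longrightarrow> (g (wp (\<phi>1 x)) - g (wp (\<phi>1 x) - d1 x)) - (g (wp (\<phi>2 x)) - g (wp (\<phi>2 x) - d1 x)) \<ge> 0"
  using abs_powr_increment_mono[OF conj_exp(1) d1_nonneg[of x], of "wp (\<phi>2 x)" "wp (\<phi>1 x)"] w_less[of x] by simp

lemma D_tendsto_0: "(D \<longlongrightarrow> 0) (at_right 0)"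
proof -
  have c: "c > 0" using \<zeta> by simp
  have "((\<lambda>x. (wp (\<phi>2 x) - wp (\<psi>2 x)) - (wp (\<phi>1 x) - wp (\<psi>1 x))) \<longlongrightarrow> 0 - 0) (at_right 0)"
    by (intro tendsto_diff wp_diff_tendsto_0[OF P2 Q2 c] wp_diff_tendsto_0[OF P1 Q1 c])
  thus ?thesis by (simp add: D_def[abs_def])
qed

text \<open>Near \<open>0\<close> the Lipschitz constant of \<open>g\<close> blows up, but there monotonicity of \<open>g\<close> on the positive axis gives the sign.\<close>

lemma D_nonneg_near_0:
  obtains \<eta> where "\<eta> > 0" "\<And>x. x \<in> {0<..<\<eta>} \<Longrightarrow> x < \<zeta> \<Longrightarrow> (\<And>t. t \<in> {0<..x} \<Longrightarrow> \<psi>2 t < b) \<Longrightarrow> D x \<ge> 0"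
proof -
  have c: "c > 0" using \<zeta> by simp
  \<comment> \<open>The bounds \<open>d1 < 1\<close> and \<open>wp \<phi>2 \<ge> 1\<close> keep
    \<open>wp \<phi>2 - d1\<close> on the positive axis, where \<open>g\<close> is
    increasing.\<close>
  have evd: "\<forall>\<^sub>F x in at_right 0. wp (\<phi>1 x) - wp (\<psi>1 x) < 1"
    using order_tendstoD(2)[OF wp_diff_tendsto_0[OF P1 Q1 c], of 1] by simp
  have evw: "\<forall>\<^sub>F x in at_right 0. wp (\<phi>2 x) \<ge> 1"
  proof -
    have "\<forall>\<^sub>F u in nhds 0. C u - S u > 0"
      using isCont_C[of 0] isCont_S[of 0]
      by (intro order_tendstoD(1)[where y="C 0 - S 0"] tendsto_diff) (auto simp: isCont_def tendsto_nhds_iff)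
    moreover have "((\<lambda>x. \<phi>2 x) \<longlongrightarrow> 0) (at_right 0)"
      using continuous_on_Icc_at_rightD[OF pruefer_cont[OF P2] c] by (simp add: pruefer_0[OF P2])
    ultimately have "\<forall>\<^sub>F x in at_right 0. C (\<phi>2 x) - S (\<phi>2 x) > 0"
      by (auto simp: filterlim_iff)
    moreover have "\<forall>\<^sub>F x in at_right 0. x \<in> {0<..<\<zeta>}" using \<zeta> by (intro eventually_at_right_real) auto
    ultimately show ?thesis
    proof eventually_elim
      case (elim x)
      have S: "S (\<phi>2 x) > 0" using S_pos[of "\<phi>2 x"] pos[OF elim(2)] b2[OF elim(2)] by auto
      hence "spow (p - 1) (S (\<phi>2 x)) \<le> spow (p - 1) (C (\<phi>2 x))" using elim p_gt_1 by (subst spow_le_iff) auto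
      thus ?case unfolding wp_def using S by (simp add: le_divide_eq)
    qed
  qed
  obtain \<eta> where \<eta>: "\<eta> > 0" "\<And>x. 0 < x \<Longrightarrow> x < \<eta> \<Longrightarrow> wp (\<phi>1 x) - wp (\<psi>1 x) < 1 \<and> wp (\<phi>2 x) \<ge> 1"
    using eventually_conj[OF evd evw] unfolding eventually_at_right_field by blast
  show ?thesis
  proof (rule that[OF \<eta>(1)], rule ccontr)
    fix x1 assume x1: "x1 \<in> {0<..<\<eta>}" "x1 < \<zeta>" and below: "\<And>t. t \<in> {0<..x1} \<Longrightarrow> \<psi>2 t < b" and neg: "\<not> D x1 \<ge> 0"
    obtain N where N: "countable N" "\<And>x. x \<in> {0<..<\<zeta>} - N \<Longrightarrow> \<psi>2 x < b \<Longrightarrow> (D has_real_derivative D' x) (at x)"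
      by (rule D_deriv) (rule that)
    have der: "\<exists>d. (D has_real_derivative d) (at x) \<and> d \<ge> 0" if x: "x \<in> {0<..<x1} - N" and Dx: "D x < 0" for x
    proof -
      have xz: "x \<in> {0<..<\<zeta>}" using x x1 by auto
      have "wp (\<phi>2 x) - d1 x \<ge> 0" using \<eta>(2)[of x] x x1 by (auto simp: d1_def)
      moreover have "wp (\<phi>2 x) - d1 x \<le> wp (\<psi>2 x)" using Dx by (simp add: W2_eq)
      ultimately have "g (wp (\<psi>2 x)) \<ge> g (wp (\<phi>2 x) - d1 x)"
        using p_gt_1 by (intro powr_mono2) auto
      hence "D' x \<ge> 0" unfolding D'_def
        using convexity_term[OF xz] p_gt_1 by (intro add_nonneg_nonneg mult_nonneg_nonneg) auto
      moreover have "(D has_real_derivative D' x) (at x)" using N(2)[of x] x x1 below[of x] by auto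
      ultimately show ?thesis by blast
    qed
    have cD: "continuous_on {e..x1} D" if "e > 0" for e using that x1 below by (intro D_cont) auto
    \<comment> \<open>A nonnegative value could never be lost again, by \<open>der\<close> and
      Gronwall with \<open>K = 0\<close>. So a negative value at \<open>x1\<close> forces
      \<open>D\<close> to be negative, and therefore nondecreasing, all the way down to
      \<open>0\<close>, against its limit \<open>0\<close> there.\<close>
    have Dneg: "D e < 0" if e: "0 < e" "e \<le> x1" for e
    proof (rule ccontr)
      assume "\<not> D e < 0"
      hence De: "D e \<ge> 0" by simp
      have "D x1 \<ge> 0"
      proof (rule gronwall_nonneg[where K=0, OF cD[OF e(1)] N(1) De])
        fix x assume "x \<in> {e<..<x1} - N" "D x < 0"
        with der[of x] e show "\<exists>d. (D has_real_derivative d) (at x) \<and> d \<ge> - 0 * \<bar>D x\<bar>" by auto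
      qed (use e in auto)
      thus False using neg by simp
    qed
    have "D e \<le> D x1" if e: "0 < e" "e \<le> x1" for e
    proof (rule mono_of_nonneg_deriv_off_countable[OF e(2) cD[OF e(1)] N(1)])
      fix x assume x: "x \<in> {e<..<x1} - N"
      hence "D x < 0" using Dneg[of x] e by auto
      with der[of x] x e show "\<exists>d\<ge>0. (D has_real_derivative d) (at x)" by auto
    qed
    moreover have "\<forall>\<^sub>F e in at_right 0. e \<in> {0<..<x1}" using x1 by (intro eventually_at_right_real) auto
    ultimately have "\<forall>\<^sub>F e in at_right 0. D e \<le> D x1" by (auto elim!: eventually_mono)
    hence "0 \<le> D x1" by (intro tendsto_upperbound[OF D_tendsto_0]) auto
    thus False using neg by simp
  qed
qed

text \<open>Beyond a small \<open>x0\<close> the arguments of \<open>g\<close> are bounded and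
  \<open>g\<close> is Lipschitz on their range, so Gronwall carries on from the sign obtained near
  \<open>0\<close>.\<close>

lemma D_nonneg:
  assumes x: "x \<in> {0<..<\<zeta>}" and below: "\<And>t. t \<in> {0<..x} \<Longrightarrow> \<psi>2 t < b"
  shows "D x \<ge> 0"
proof -
  obtain \<eta> where \<eta>: "\<eta> > 0" "\<And>x. x \<in> {0<..<\<eta>} \<Longrightarrow> x < \<zeta> \<Longrightarrow> (\<And>t. t \<in> {0<..x} \<Longrightarrow> \<psi>2 t < b) \<Longrightarrow> D x \<ge> 0"
    by (rule D_nonneg_near_0) (rule that, assumption, blast)
  define x0 where "x0 = min (\<eta> / 2) x"
  have x0: "0 < x0" "x0 < \<eta>" "x0 \<le> x" using \<eta> x by (auto simp: x0_def)
  have D0: "D x0 \<ge> 0" using x0 x below by (intro \<eta>(2)) auto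
  obtain N where N: "countable N" "\<And>x. x \<in> {0<..<\<zeta>} - N \<Longrightarrow> \<psi>2 x < b \<Longrightarrow> (D has_real_derivative D' x) (at x)"
    by (rule D_deriv) (rule that)
  have sub: "{x0..x} \<subseteq> {0..c}" using x0 x \<zeta> by auto
  have cD: "continuous_on {x0..x} D" using x0 x below by (intro D_cont) auto
  have cw: "continuous_on {x0..x} (\<lambda>x. wp (\<psi>2 x))"
    using x0 x below pos by (intro continuous_on_wp continuous_on_subset[OF pruefer_cont[OF Q2] sub]) auto
  obtain R1 where R1: "\<And>t. t \<in> {x0..x} \<Longrightarrow> \<bar>wp (\<psi>2 t)\<bar> \<le> R1" by (rule continuous_on_Icc_boundedE[OF cw]) (rule that)
  obtain R2 where R2: "\<And>t. t \<in> {x0..x} \<Longrightarrow> \<bar>D t\<bar> \<le> R2" by (rule continuous_on_Icc_boundedE[OF cD]) (rule that)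
  define K where "K = (p - 1) * (p / (p - 1) * (R1 + R2) powr (p / (p - 1) - 1))"
  show ?thesis
  proof (rule gronwall_nonneg[OF cD N(1) D0, of K])
    fix t assume t: "t \<in> {x0<..<x} - N"
    have tz: "t \<in> {0<..<\<zeta>}" using t x0 x by auto
    have R: "\<bar>wp (\<psi>2 t)\<bar> \<le> R1 + R2" "\<bar>wp (\<phi>2 t) - d1 t\<bar> \<le> R1 + R2"
      using R1[of t] R2[of t] t W2_eq[of t] by auto
    have "\<bar>g (wp (\<psi>2 t)) - g (wp (\<phi>2 t) - d1 t)\<bar> \<le> p / (p - 1) * (R1 + R2) powr (p / (p - 1) - 1) * \<bar>wp (\<psi>2 t) - (wp (\<phi>2 t) - d1 t)\<bar>"
      by (rule abs_powr_local_lipschitz[OF conj_exp(1) R])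
    also have "\<bar>wp (\<psi>2 t) - (wp (\<phi>2 t) - d1 t)\<bar> = \<bar>D t\<bar>" by (simp add: W2_eq)
    finally have "(p - 1) * \<bar>g (wp (\<psi>2 t)) - g (wp (\<phi>2 t) - d1 t)\<bar> \<le> K * \<bar>D t\<bar>"
      using p_gt_1 mult_left_mono[of _ _ "p - 1"] unfolding K_def mult.assoc by (metis diff_ge_0_iff_ge less_imp_le mult.assoc)
    moreover have "(p - 1) * (g (wp (\<psi>2 t)) - g (wp (\<phi>2 t) - d1 t)) \<ge> - ((p - 1) * \<bar>g (wp (\<psi>2 t)) - g (wp (\<phi>2 t) - d1 t)\<bar>)"
      using p_gt_1 mult_left_mono[of "- \<bar>g (wp (\<psi>2 t)) - g (wp (\<phi>2 t) - d1 t)\<bar>" "g (wp (\<psi>2 t)) - g (wp (\<phi>2 t) - d1 t)" "p - 1"] by simp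
    moreover have "(p - 1) * ((g (wp (\<phi>1 t)) - g (wp (\<phi>1 t) - d1 t)) - (g (wp (\<phi>2 t)) - g (wp (\<phi>2 t) - d1 t))) \<ge> 0"
      using convexity_term[OF tz] p_gt_1 by simp
    ultimately have "D' t \<ge> - K * \<bar>D t\<bar>" unfolding D'_def by linarith
    thus "\<exists>d. (D has_real_derivative d) (at t) \<and> d \<ge> - K * \<bar>D t\<bar>" using N(2)[of t] t tz below[of t] x0 by auto
  qed (use x0 in auto)
qed

text \<open>From \<open>D \<ge> 0\<close> and \<open>d1 \<ge> 0\<close> follows
  \<open>wp \<phi>2 \<ge> wp \<psi>2\<close>, and \<open>wp\<close> is decreasing. If \<psi>2 has
  already left the first branch, it is ahead of \<phi>2 anyway. The end point is reached by
  closure.\<close>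

lemma riccati_compare:
  assumes x: "x \<in> {0..\<zeta>}" shows "\<phi>2 x \<le> \<psi>2 x"
proof -
  have main: "\<phi>2 t \<le> \<psi>2 t" if t: "t \<in> {0<..<\<zeta>}" for t
  proof (rule ccontr)
    assume "\<not> \<phi>2 t \<le> \<psi>2 t"
    hence lt: "\<psi>2 t < \<phi>2 t" by simp
    hence tb: "\<psi>2 t < b" using b2[OF t] by simp
    have below: "\<psi>2 s < b" if s: "s \<in> {0<..t}" for s
    proof (rule ccontr)
      assume "\<not> \<psi>2 s < b"
      hence "\<psi>2 t \<ge> b" using pruefer_crossing[OF Q2, of s t 1] s t \<zeta> by (cases "s = t") auto
      thus False using tb by simp
    qed
    have "D t \<ge> 0" by (rule D_nonneg[OF t below])
    hence "wp (\<phi>2 t) \<ge> wp (\<psi>2 t)" using d1_nonneg[OF t] by (simp add: D_def d1_def)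
    thus False using wp_strict_antimono[of "\<psi>2 t" "\<phi>2 t"] lt pos[OF t] b2[OF t] by auto
  qed
  have "closed ({0..\<zeta>} \<inter> (\<lambda>x. \<psi>2 x - \<phi>2 x) -` {0..})"
    using \<zeta> by (intro continuous_closed_preimage continuous_intros continuous_on_subset[OF pruefer_cont[OF P2]] continuous_on_subset[OF pruefer_cont[OF Q2]]) auto
  moreover have "{0<..<\<zeta>} \<subseteq> {0..\<zeta>} \<inter> (\<lambda>x. \<psi>2 x - \<phi>2 x) -` {0..}" using main by auto
  ultimately have "closure {0<..<\<zeta>} \<subseteq> {0..\<zeta>} \<inter> (\<lambda>x. \<psi>2 x - \<phi>2 x) -` {0..}" by (rule closure_minimal[rotated])
  thus ?thesis using x \<zeta> by auto
qed

text \<open>If both second angles reach \<open>b\<close> at \<zeta>, the singularities cancel there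
  as they do at \<open>0\<close>, so \<open>D\<close> tends to \<open>0\<close> from both sides. A
  strict ordering of the first angles just before \<zeta> would give \<open>D' > 0\<close>,
  impossible for a nonnegative function with that limit. So the first angles meet arbitrarily close
  to \<zeta>.\<close>

lemma riccati_rigid:
  assumes e2: "\<phi>2 \<zeta> = b" "\<psi>2 \<zeta> = b" and e1: "\<phi>1 \<zeta> = \<psi>1 \<zeta>" "\<psi>1 \<zeta> < b" and \<eta>0: "0 \<le> x0" "x0 < \<zeta>"
  obtains x where "x \<in> {x0<..<\<zeta>}" "\<phi>1 x = \<psi>1 x"
proof -
  have "\<exists>x\<in>{x0<..<\<zeta>}. \<phi>1 x = \<psi>1 x"
  proof (rule ccontr)
    assume ne: "\<not> (\<exists>x\<in>{x0<..<\<zeta>}. \<phi>1 x = \<psi>1 x)"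
    have below: "\<psi>2 s < b" if s: "s \<in> {0<..<\<zeta>}" for s
    proof (rule ccontr)
      assume "\<not> \<psi>2 s < b"
      hence "\<psi>2 \<zeta> > b" using pruefer_crossing[OF Q2, of s \<zeta> 1] s \<zeta> by auto
      thus False using e2 by simp
    qed
    \<comment> \<open>Reflection turns the common zero at \<zeta> into an initial zero, where the
      cancellation of the singularities is already known.\<close>
    have lim_rev: "filterlim (\<lambda>x. \<zeta> - x) (at_right 0) (at_left \<zeta>)"
      by (auto simp: filterlim_at eventually_at_filter intro!: tendsto_eq_intros)
    have R2: "pruefer 1 (\<lambda>x. a (\<zeta> - x) + \<delta>) \<zeta> (\<lambda>x. of_int 1 * b - \<phi>2 (\<zeta> - x))"
      using e2 \<zeta> by (intro pruefer_reverse[OF pruefer_restrict[OF P2 \<zeta>(2)]]) auto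
    have S2: "pruefer 1 (\<lambda>x. A (\<zeta> - x) + \<delta>) \<zeta> (\<lambda>x. of_int 1 * b - \<psi>2 (\<zeta> - x))"
      using e2 \<zeta> by (intro pruefer_reverse[OF pruefer_restrict[OF Q2 \<zeta>(2)]]) auto
    have "((\<lambda>x. wp (of_int 1 * b - \<phi>2 (\<zeta> - x)) - wp (of_int 1 * b - \<psi>2 (\<zeta> - x))) \<longlongrightarrow> 0) (at_right 0)"
      by (rule wp_diff_tendsto_0[OF R2 S2 \<zeta>(1)])
    from filterlim_compose[OF this lim_rev] have "((\<lambda>x. wp (\<psi>2 x) - wp (\<phi>2 x)) \<longlongrightarrow> 0) (at_left \<zeta>)"
      unfolding wp_reflect by simp
    from tendsto_minus[OF this] have l2: "((\<lambda>x. wp (\<phi>2 x) - wp (\<psi>2 x)) \<longlongrightarrow> 0) (at_left \<zeta>)" by simp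
    have psi: "\<psi>1 \<zeta> > 0" using pruefer_pos[OF Q1] \<zeta> by auto
    have cw: "isCont wp (\<psi>1 \<zeta>)" using psi e1 S_nz by (intro isCont_wp) auto
    have t1: "(\<phi>1 \<longlongrightarrow> \<psi>1 \<zeta>) (at_left \<zeta>)" "(\<psi>1 \<longlongrightarrow> \<psi>1 \<zeta>) (at_left \<zeta>)"
      using continuous_on_Icc_at_leftD[OF pruefer_cont[OF pruefer_restrict[OF P1 \<zeta>(2)]] \<zeta>(1)]
        continuous_on_Icc_at_leftD[OF pruefer_cont[OF pruefer_restrict[OF Q1 \<zeta>(2)]] \<zeta>(1)] e1 by auto
    have "((\<lambda>x. wp (\<phi>1 x) - wp (\<psi>1 x)) \<longlongrightarrow> wp (\<psi>1 \<zeta>) - wp (\<psi>1 \<zeta>)) (at_left \<zeta>)"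
      by (intro tendsto_diff isCont_tendsto_compose[OF cw] t1)
    hence "((\<lambda>x. (wp (\<phi>2 x) - wp (\<psi>2 x)) - (wp (\<phi>1 x) - wp (\<psi>1 x))) \<longlongrightarrow> 0 - 0) (at_left \<zeta>)"
      by (intro tendsto_diff l2) simp
    hence Dlim: "(D \<longlongrightarrow> 0) (at_left \<zeta>)" by (simp add: D_def[abs_def])
    have "(\<phi>2 \<longlongrightarrow> b) (at_left \<zeta>)"
      using continuous_on_Icc_at_leftD[OF pruefer_cont[OF pruefer_restrict[OF P2 \<zeta>(2)]] \<zeta>(1)] e2 by auto
    \<comment> \<open>Beyond \<open>b / 2\<close> the variable \<open>wp\<close> is negative and
      \<open>g\<close> decreases there, so the error term of \<open>D'\<close> has the favourable
      sign without any Lipschitz bound.\<close>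
    hence "\<forall>\<^sub>F x in at_left \<zeta>. \<phi>2 x > b / 2" using b_pos by (intro order_tendstoD) auto
    then obtain x2 where x2: "x2 < \<zeta>" "\<And>x. x2 < x \<Longrightarrow> x < \<zeta> \<Longrightarrow> \<phi>2 x > b / 2" unfolding eventually_at_left_field by blast
    define x3 where "x3 = (max (max x0 x2) 0 + \<zeta>) / 2"
    have x3: "x0 < x3" "x2 < x3" "0 < x3" "x3 < \<zeta>" using x2 \<eta>0 \<zeta> by (auto simp: x3_def)
    obtain N where N: "countable N" "\<And>x. x \<in> {0<..<\<zeta>} - N \<Longrightarrow> \<psi>2 x < b \<Longrightarrow> (D has_real_derivative D' x) (at x)"
      by (rule D_deriv) (rule that)
    have Dnn: "D x \<ge> 0" if "x \<in> {0<..<\<zeta>}" for x using that below by (intro D_nonneg) auto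
    have der: "\<exists>d. (D has_real_derivative d) (at x) \<and> d > 0" if x: "x \<in> {x3<..<\<zeta>} - N" for x
    proof -
      have xz: "x \<in> {0<..<\<zeta>}" using x x3 by auto
      have "\<phi>1 x \<noteq> \<psi>1 x" using ne x x3 by auto
      hence "\<phi>1 x < \<psi>1 x" using le[OF xz] by simp
      hence d1: "d1 x > 0" unfolding d1_def using pos[OF xz] b1[OF xz] wp_strict_antimono[of "\<phi>1 x" "\<psi>1 x"] by simp
      have "g (wp (\<phi>2 x)) - g (wp (\<phi>2 x) - d1 x) < g (wp (\<phi>1 x)) - g (wp (\<phi>1 x) - d1 x)"
        by (rule abs_powr_increment_strict_mono[OF conj_exp(1) d1 w_less[OF xz]])
      moreover have "wp (\<phi>2 x) < wp (b/2)" using x2(2)[of x] x x3 b2[OF xz] b_pos by (intro wp_strict_antimono) auto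
      hence "wp (\<phi>2 x) - d1 x < 0" "wp (\<psi>2 x) \<le> wp (\<phi>2 x) - d1 x" using d1 Dnn[OF xz] by (auto simp: W2_eq)
      hence "g (wp (\<psi>2 x)) \<ge> g (wp (\<phi>2 x) - d1 x)" using p_gt_1 by (intro powr_mono2) auto
      ultimately have "D' x > 0" unfolding D'_def
        using p_gt_1 by (intro add_pos_nonneg mult_pos_pos mult_nonneg_nonneg) auto
      moreover have "x \<in> {0<..<\<zeta>} - N" using x xz by auto
      ultimately show ?thesis using N(2)[OF _ below[OF xz]] by blast
    qed
    have cD: "continuous_on {u..v} D" if "0 < u" "v < \<zeta>" for u v using that below by (intro D_cont) auto
    have mono: "D u \<le> D v" if "x3 \<le> u" "u \<le> v" "v < \<zeta>" for u v
    proof (rule mono_of_nonneg_deriv_off_countable[OF that(2) cD N(1)])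
      fix x assume "x \<in> {u<..<v} - N"
      thus "\<exists>d\<ge>0. (D has_real_derivative d) (at x)" using der[of x] that by (auto intro: less_imp_le)
    qed (use that x3 in auto)
    have D0: "D u = 0" if u: "x3 \<le> u" "u < \<zeta>" for u
    proof (rule antisym)
      have "\<forall>\<^sub>F v in at_left \<zeta>. v \<in> {u<..<\<zeta>}" using u by (intro eventually_at_left_real) auto
      hence "\<forall>\<^sub>F v in at_left \<zeta>. D u \<le> D v" using mono u by (auto elim!: eventually_mono)
      thus "D u \<le> 0" by (intro tendsto_lowerbound[OF Dlim]) auto
      show "D u \<ge> 0" using Dnn u x3 by auto
    qed
    obtain x where x: "x \<in> {x3<..<\<zeta>} - N" by (rule nonempty_interval_minus_countable[OF N(1) x3(4)])
    obtain d where d: "(D has_real_derivative d) (at x)" "d > 0" using der[OF x] by blast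
    have "\<forall>\<^sub>F t in nhds x. t \<in> {x3<..<\<zeta>}" using x by (intro eventually_nhds_in_open) auto
    hence "\<forall>\<^sub>F t in nhds x. D t = 0" by eventually_elim (auto intro: D0)
    hence "(D has_real_derivative 0) (at x)" by (simp add: DERIV_cong_ev[OF refl _ refl])
    thus False using d DERIV_unique by blast
  qed
  thus ?thesis using that by blast
qed

end

section \<open>Piecewise constant potentials\<close>

lemma powr_midpoint:
  fixes x y :: real
  assumes "p > 1" "x > 0" "y > 0"
  shows "((x + y) / 2) powr p \<le> (x powr p + y powr p) / 2"
  using convex_onD[OF powr_convex[of p], of "1/2" x y] assms by (simp add: field_simps)

context half_linear
begin

lemma admissible_step:
  assumes u: "\<And>x. x \<in> {0..<m} \<Longrightarrow> a x = u" and w: "\<And>x. x \<in> {m<..c} \<Longrightarrow> a x = w"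
  shows "admissible c a"
proof -
  define a' where "a' x = (if x < m then u else if x = m then a m else w)" for x
  have eq: "a x = a' x" if "x \<in> {0..c}" for x using that u w by (auto simp: a'_def)
  define M where "M = max \<bar>u\<bar> (max \<bar>a m\<bar> \<bar>w\<bar>)"
  have bd: "\<bar>a' x\<bar> \<le> M" for x by (auto simp: a'_def M_def)
  have "a' absolutely_integrable_on {0..c}"
  proof (rule measurable_bounded_by_integrable_imp_absolutely_integrable)
    have "a' \<in> borel_measurable borel" unfolding a'_def by measurable
    thus "a' \<in> borel_measurable (lebesgue_on {0..c})" 
      by (intro measurable_restrict_space1 measurable_completion) simp
    show "(\<lambda>x. M) integrable_on {0..c}" by (rule integrable_const_ivl)
  qed (use bd in auto)
  hence "a absolutely_integrable_on {0..c}"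
    by (rule absolutely_integrable_spike[where S="{}"]) (auto simp: eq)
  moreover have "isCont a x" if x: "x \<in> {0<..<c} - {m}" for x
  proof (cases "x < m")
    case True
    have "\<forall>\<^sub>F t in nhds x. a t = u"
      using eventually_nhds_in_open[of "{0<..<m}" x] True x u by (auto elim!: eventually_mono)
    thus ?thesis by (simp add: isCont_cong)
  next
    case False
    have "\<forall>\<^sub>F t in nhds x. a t = w"
      using eventually_nhds_in_open[of "{m<..<c}" x] False x w by (auto elim!: eventually_mono)
    thus ?thesis by (simp add: isCont_cong)
  qed
  moreover have "\<forall>x\<in>{0..c}. \<bar>a x\<bar> \<le> M" using bd eq by simp
  ultimately show ?thesis unfolding admissible_def by (intro conjI exI[of _ M] exI[of _ "{m}"]) auto
qed

lemma admissible_const: "admissible c (\<lambda>x. u)"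
  by (rule admissible_step[of 0 _ u c u]) auto

lemma pruefer_ident: "pruefer s (\<lambda>x. 0) c (\<lambda>x. s * x)"
  unfolding pruefer_def by (auto intro!: continuous_intros derivative_eq_intros exI[of _ "{}"])

text \<open>\<open>S (\<kappa> x)\<close> and the solution built from the angle solve the same
  constant coefficient equation and both vanish at \<open>0\<close>, hence are proportional. The
  positive amplitude drops out.\<close>

lemma const_proportional:
  assumes k: "\<kappa> > 0" and P: "pruefer 1 (\<lambda>x. \<kappa> powr p - 1) c \<theta>" and x: "x \<in> {0..c}"
  shows "S (\<kappa> * x) * C (\<theta> x) = \<kappa> * C (\<kappa> * x) * S (\<theta> x)"
proof -
  have c0: "c \<ge> 0" using x by auto
  obtain r where r: "\<And>x. r x > 0" "hsol c (\<lambda>x. 1 powr (p - 1) * ((\<kappa> powr p - 1) + 1)) (\<lambda>x. r x * S (\<theta> x)) (\<lambda>x. 1 * r x * C (\<theta> x))"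
    by (rule pruefer_hsol[OF admissible_const P zero_less_one c0]) (rule that)
  have H1: "hsol c (\<lambda>x. \<kappa> powr p) (\<lambda>x. r x * S (\<theta> x)) (\<lambda>x. r x * C (\<theta> x))" using r(2) by simp
  have dS: "((\<lambda>x. S (\<kappa> * x)) has_real_derivative C (\<kappa> * t) * \<kappa>) (at t)" for t
    by (rule DERIV_chain2[OF S_deriv]) (auto intro!: derivative_eq_intros)
  have dC: "((\<lambda>x. spow (p - 1) (C (\<kappa> * x))) has_real_derivative - (p - 1) * spow (p - 1) (S (\<kappa> * t)) * \<kappa>) (at t)" for t
    by (rule DERIV_chain2[OF spow_C_deriv]) (auto intro!: derivative_eq_intros)
  have H2: "hsol c (\<lambda>x. \<kappa> powr p) (\<lambda>x. S (\<kappa> * x)) (\<lambda>x. \<kappa> * C (\<kappa> * x))"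
    unfolding hsol_def
  proof (intro conjI ballI exI[of _ "{}"])
    show "((\<lambda>x. S (\<kappa> * x)) has_real_derivative \<kappa> * C (\<kappa> * t)) (at t within {0..c})" for t
      using has_field_derivative_at_within[OF dS[of t]] by (simp add: mult.commute)
    show "continuous_on {0..c} (\<lambda>x. spow (p - 1) (\<kappa> * C (\<kappa> * x)))"
      using p_gt_1 by (intro continuous_intros) auto
    fix t
    have kk: "\<kappa> powr (p - 1) * \<kappa> = \<kappa> powr p" using k by (simp add: powr_diff)
    have eq: "spow (p - 1) \<kappa> * (- (p - 1) * spow (p - 1) (S (\<kappa> * t)) * \<kappa>) = - (p - 1) * \<kappa> powr p * spow (p - 1) (S (\<kappa> * t))"
      unfolding kk[symmetric] using k by (simp add: spow_pos mult_ac)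
    show "((\<lambda>x. spow (p - 1) (\<kappa> * C (\<kappa> * x))) has_real_derivative - (p - 1) * \<kappa> powr p * spow (p - 1) (S (\<kappa> * t))) (at t)"
      using DERIV_cmult[OF dC[of t], of "spow (p - 1) \<kappa>"] unfolding eq spow_mult .
  qed auto
  have SC: "S u \<noteq> 0 \<or> C u \<noteq> 0" for u using S_C_identity[of u] p_gt_1 by auto
  have "S (\<kappa> * x) * (r x * C (\<theta> x)) = \<kappa> * C (\<kappa> * x) * (r x * S (\<theta> x))"
  proof (rule hsol_proportional[OF H2 H1 _ _ _ _ x])
    show "S (\<kappa> * t) \<noteq> 0 \<or> \<kappa> * C (\<kappa> * t) \<noteq> 0" for t using SC[of "\<kappa> * t"] k by auto
    show "r t * S (\<theta> t) \<noteq> 0 \<or> r t * C (\<theta> t) \<noteq> 0" for t using SC[of "\<theta> t"] r(1)[of t] by auto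
  qed (simp_all add: pruefer_0[OF P])
  thus ?thesis using r(1)[of x] by (simp add: mult.left_commute)
qed

lemma const_zero_iff:
  assumes k: "\<kappa> > 0" and P: "pruefer 1 (\<lambda>x. \<kappa> powr p - 1) c \<theta>" and x: "x \<in> {0..c}"
  shows "S (\<theta> x) = 0 \<longleftrightarrow> S (\<kappa> * x) = 0"
proof -
  have SC: "S u \<noteq> 0 \<or> C u \<noteq> 0" for u using S_C_identity[of u] p_gt_1 by auto
  show ?thesis using const_proportional[OF assms] SC[of "\<theta> x"] SC[of "\<kappa> * x"] k by auto
qed

lemma const_wp:
  assumes k: "\<kappa> > 0" and P: "pruefer 1 (\<lambda>x. \<kappa> powr p - 1) c \<theta>" and x: "x \<in> {0..c}" and S0: "S (\<kappa> * x) \<noteq> 0"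
  shows "wp (\<theta> x) = \<kappa> powr (p - 1) * wp (\<kappa> * x)"
proof -
  have "S (\<theta> x) \<noteq> 0" using const_zero_iff[OF k P x] S0 by simp
  hence "C (\<theta> x) / S (\<theta> x) = \<kappa> * (C (\<kappa> * x) / S (\<kappa> * x))"
    using const_proportional[OF k P x] S0 by (simp add: field_simps)
  hence "spow (p - 1) (C (\<theta> x) / S (\<theta> x)) = spow (p - 1) (\<kappa> * (C (\<kappa> * x) / S (\<kappa> * x)))" by simp
  thus ?thesis using k by (simp add: wp_def spow_divide spow_mult spow_pos)
qed

lemma S_mult_b: "S (of_int j * b) = 0" using S_shift[of 0 j] by simp

text \<open>Proportionality determines the angle only modulo \<open>b\<close>. The branch comes from
  continuity: on its way past \<open>b\<close> the angle would meet a zero of \<open>S\<close> at a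
  point where \<open>S (\<kappa> t)\<close> is positive.\<close>

lemma const_branch_less:
  assumes k: "\<kappa> > 0" and P: "pruefer 1 (\<lambda>x. \<kappa> powr p - 1) c \<theta>" and x: "x \<in> {0..c}" and lt: "\<kappa> * x < b"
  shows "\<theta> x < b"
proof (rule ccontr)
  assume "\<not> \<theta> x < b"
  hence "\<exists>t\<ge>0. t \<le> x \<and> \<theta> t = b"
    using x b_pos pruefer_0[OF P] by (intro IVT') (auto intro: continuous_on_subset[OF pruefer_cont[OF P]])
  then obtain t where t: "0 \<le> t" "t \<le> x" "\<theta> t = b" by blast
  have "t > 0" using t pruefer_0[OF P] b_pos by (cases "t = 0") auto
  have "S (\<theta> t) = 0" using t S_mult_b[of 1] by simp
  hence "S (\<kappa> * t) = 0" using const_zero_iff[OF k P, of t] t x by auto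
  moreover have "\<kappa> * t \<le> \<kappa> * x" using k t by simp
  hence "\<kappa> * t < b" using lt by linarith
  ultimately show False using S_pos[of "\<kappa> * t"] \<open>t > 0\<close> k by auto
qed

lemma const_branch_eq:
  assumes k: "\<kappa> > 0" and P: "pruefer 1 (\<lambda>x. \<kappa> powr p - 1) c \<theta>" and x: "x \<in> {0..c}" and eq: "\<kappa> * x = b"
  shows "\<theta> x = b"
proof -
  have x0: "x > 0" using eq k b_pos x by (cases "x = 0") auto
  have "S (\<theta> x) = 0" using const_zero_iff[OF k P x] eq S_mult_b[of 1] by simp
  then obtain j :: int where j: "\<theta> x = of_int j * b" by (rule S_eq_0D)
  have "\<theta> x > 0" using pruefer_pos[OF P] x x0 by auto
  hence "j \<ge> 1" using j b_pos by (simp add: zero_less_mult_iff)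
  have "\<theta> x \<le> b"
  proof (rule ccontr)
    assume gt: "\<not> \<theta> x \<le> b"
    hence "\<exists>t\<ge>0. t \<le> x \<and> \<theta> t = b"
      using x b_pos pruefer_0[OF P] by (intro IVT') (auto intro: continuous_on_subset[OF pruefer_cont[OF P]])
    then obtain t where t: "0 \<le> t" "t \<le> x" "\<theta> t = b" by blast
    have "t < x" using t gt by (cases "t = x") auto
    hence "\<kappa> * t < b" using k eq by (metis mult_strict_left_mono)
    thus False using const_branch_less[OF k P, of t] t x by auto
  qed
  moreover have "of_int j * b \<ge> 1 * b" using \<open>j \<ge> 1\<close> b_pos by (intro mult_right_mono) auto
  ultimately show ?thesis using j by simp
qed

lemma const_branch_greater:
  assumes k: "\<kappa> > 0" and P: "pruefer 1 (\<lambda>x. \<kappa> powr p - 1) c \<theta>" and x: "x \<in> {0..c}" and r: "b < \<kappa> * x" "\<kappa> * x < 2 * b"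
  shows "b < \<theta> x" "\<theta> x < 2 * b"
proof -
  define x1 where "x1 = b / \<kappa>"
  have x1: "\<kappa> * x1 = b" "0 < x1" "x1 < x" using k b_pos r by (auto simp: x1_def field_simps)
  have e: "\<theta> x1 = b" using x x1 by (intro const_branch_eq[OF k P]) auto
  show gt: "b < \<theta> x" using pruefer_crossing[OF P, of x1 x 1] x1 x e by auto
  show "\<theta> x < 2 * b"
  proof (rule ccontr)
    assume "\<not> \<theta> x < 2 * b"
    hence "\<exists>t\<ge>x1. t \<le> x \<and> \<theta> t = 2 * b"
      using x x1 e b_pos by (intro IVT') (auto intro: continuous_on_subset[OF pruefer_cont[OF P]])
    then obtain t where t: "x1 \<le> t" "t \<le> x" "\<theta> t = 2 * b" by blast
    have "x1 < t" using t e b_pos by (cases "t = x1") auto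
    have "S (\<theta> t) = 0" using t S_mult_b[of 2] by simp
    hence "S (\<kappa> * t) = 0" using const_zero_iff[OF k P, of t] t x x1 by auto
    moreover have "\<kappa> * x1 < \<kappa> * t" "\<kappa> * t \<le> \<kappa> * x" using k t \<open>x1 < t\<close> by auto
    moreover have "S (\<kappa> * t) = - S (\<kappa> * t - b)" using S_plus_b[of "\<kappa> * t - b"] by simp
    ultimately show False using S_pos[of "\<kappa> * t - b"] x1 r by auto
  qed
qed

text \<open>At the energies \<open>2 powr p + \<sigma>\<close> and \<open>2 powr p - \<sigma>\<close> the solutions are \<open>S(\<kappa> x)\<close> and \<open>S(l x)\<close>. Convexity of the power function
  gives \<open>\<kappa> + l \<le> 4\<close>, and \<open>\<kappa> < 3\<close> because \<open>\<sigma> < 2 powr p - 1\<close>.\<close>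

lemma step_sum_less:
  assumes \<sigma>: "0 < \<sigma>" "\<sigma> < 2 powr p - 1"
    and P: "pruefer 1 (\<lambda>x. 2 powr p + \<sigma> - 1) b \<theta>" and Q: "pruefer 1 (\<lambda>x. 2 powr p - \<sigma> - 1) b \<xi>"
  shows "\<theta> (b / 2) + \<xi> (b / 2) < 2 * b"
proof -
  define \<kappa> where "\<kappa> = (2 powr p + \<sigma>) powr (1 / p)"
  define l where "l = (2 powr p - \<sigma>) powr (1 / p)"
  have pos: "2 powr p + \<sigma> > 0" "2 powr p - \<sigma> > 0" using \<sigma> by (auto simp: add_pos_pos)
  have k: "\<kappa> > 0" "\<kappa> powr p = 2 powr p + \<sigma>" using pos p_gt_1 by (auto simp: \<kappa>_def powr_powr)
  have l: "l > 0" "l powr p = 2 powr p - \<sigma>" using pos p_gt_1 by (auto simp: l_def powr_powr)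
  have less_iff: "u < v \<longleftrightarrow> u powr p < v powr p" if "u > 0" "v > 0" for u v
    using that p_gt_1 powr_less_mono2[of p u v] powr_less_mono2[of p v u] by (cases u v rule: linorder_cases) auto
  have k2: "\<kappa> > 2" using less_iff[of 2 \<kappa>] k \<sigma> by simp
  have l2: "l < 2" using less_iff[of l 2] l \<sigma> by simp
  \<comment> \<open>Convexity at the midpoint \<open>2\<close> of \<open>1\<close> and
    \<open>3\<close> gives \<open>2 * 2 powr p \<le> 3 powr p + 1\<close>, whence
    \<open>\<kappa> powr p < 2 * 2 powr p - 1 \<le> 3 powr p\<close>.\<close>
  have "((3 + 1) / 2) powr p \<le> (3 powr p + 1 powr p) / 2" by (rule powr_midpoint[OF p_gt_1]) auto
  hence "2 * 2 powr p \<le> 3 powr p + 1" by simp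
  hence k3: "\<kappa> < 3" using less_iff[of \<kappa> 3] k \<sigma> by simp
  have "((\<kappa> + l) / 2) powr p \<le> (\<kappa> powr p + l powr p) / 2" by (rule powr_midpoint[OF p_gt_1 k(1) l(1)])
  hence "((\<kappa> + l) / 2) powr p \<le> 2 powr p" using k l by simp
  hence "(\<kappa> + l) / 2 \<le> 2" using less_iff[of 2 "(\<kappa> + l) / 2"] k l by (simp add: not_less[symmetric])
  hence kl: "\<kappa> + l \<le> 4" by simp
  have b0: "b > 0" by (rule b_pos)
  have P': "pruefer 1 (\<lambda>x. \<kappa> powr p - 1) b \<theta>" using P k by simp
  have Q': "pruefer 1 (\<lambda>x. l powr p - 1) b \<xi>" using Q l by simp
  have h: "b / 2 \<in> {0..b}" using b0 by auto
  have kb: "b < \<kappa> * (b / 2)" "\<kappa> * (b / 2) < 2 * b" using k2 k3 b0 by (auto simp: field_simps)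
  have lb: "0 < l * (b / 2)" "l * (b / 2) < b" using l l2 b0 by (auto simp: field_simps)
  have \<theta>r: "b < \<theta> (b / 2)" "\<theta> (b / 2) < 2 * b" using const_branch_greater[OF k(1) P' h kb] by auto
  have \<xi>r: "0 < \<xi> (b / 2)" "\<xi> (b / 2) < b"
    using const_branch_less[OF l(1) Q' h lb(2)] pruefer_pos[OF Q', of "b/2"] h b0 by auto
  \<comment> \<open>\<open>x\<close> is the phase by which the faster solution is past
    \<open>b\<close> at the midpoint, \<open>x'\<close> the phase by which the slower one falls
    short of it. The sum bound says that \<open>x\<close> is at most \<open>x'\<close>; the factors
    \<open>\<kappa> powr (p - 1)\<close> and \<open>l powr (p - 1)\<close> in front of
    \<open>wp\<close> make the conclusion strict even for \<open>x = x'\<close>.\<close>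
  define x where "x = \<kappa> * (b / 2) - b"
  define x' where "x' = b - l * (b / 2)"
  have x_eq: "x = (\<kappa> - 2) * (b / 2)" "x' = (2 - l) * (b / 2)" by (simp_all add: x_def x'_def field_simps)
  have xx': "x \<le> x'" unfolding x_eq using kl b0 by (intro mult_right_mono) auto
  have "(\<kappa> - 2) * (b / 2) < 1 * (b / 2)" using k3 b0 by (intro mult_strict_right_mono) auto
  hence xr: "0 < x" "x < b / 2" using kb x_eq by (auto simp: x_def)
  have x'r: "x' < b" "0 < x'" using lb by (auto simp: x'_def)
  have wx: "wp x > 0" using wp_strict_antimono[of x "b/2"] xr b0 by simp
  have wx': "wp x' \<le> wp x" using wp_antimono[of x x'] xr xx' x'r by auto
  have "S (\<kappa> * (b / 2)) = - S x" using S_plus_b[of x] by (simp add: x_def)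
  hence "S (\<kappa> * (b / 2)) \<noteq> 0" using S_pos[of x] xr b0 by auto
  from const_wp[OF k(1) P' h this] have "wp (\<theta> (b / 2)) = \<kappa> powr (p - 1) * wp x"
    using wp_shift[of x 1] by (simp add: x_def)
  hence w1: "wp (\<theta> (b / 2) - b) = \<kappa> powr (p - 1) * wp x" using wp_shift[of "\<theta> (b / 2) - b" 1] by simp
  have "S (l * (b / 2)) \<noteq> 0" using S_pos[OF lb] by simp
  from const_wp[OF l(1) Q' h this] have "wp (\<xi> (b / 2)) = - (l powr (p - 1) * wp x')"
    using wp_reflect[of 1 x'] by (simp add: x'_def)
  hence w2: "wp (b - \<xi> (b / 2)) = l powr (p - 1) * wp x'" using wp_reflect[of 1 "\<xi> (b / 2)"] by simp
  have "l powr (p - 1) * wp x' \<le> l powr (p - 1) * wp x" using wx' by (intro mult_left_mono) auto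
  also have "\<dots> < \<kappa> powr (p - 1) * wp x"
    using wx l k2 l2 p_gt_1 by (intro mult_strict_right_mono powr_less_mono2) auto
  finally have "wp (b - \<xi> (b / 2)) < wp (\<theta> (b / 2) - b)" by (simp only: w1 w2)
  hence "\<theta> (b / 2) - b < b - \<xi> (b / 2)" using \<theta>r \<xi>r by (subst (asm) wp_less_iff) auto
  thus ?thesis by simp
qed

text \<open>The sum of the angles minus \<open>2 * x\<close> has derivative
  \<open>\<sigma> * (f \<phi> - f \<xi>)\<close>. Where it is negative, the sum is below
  \<open>b\<close>, and then \<open>f \<xi> \<le> f \<phi>\<close> by the symmetry of
  \<open>f\<close>; so it cannot become negative. It limits the right value of the comparison
  potential.\<close>

lemma step_sum_ge:
  assumes \<sigma>: "\<sigma> \<ge> 0" and P: "pruefer 1 (\<lambda>x. \<sigma>) (b / 2) \<phi>" and Q: "pruefer 1 (\<lambda>x. - \<sigma>) (b / 2) \<xi>"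
  shows "\<phi> (b / 2) + \<xi> (b / 2) \<ge> b"
proof -
  have b0: "b > 0" by (rule b_pos)
  have id: "pruefer 1 (\<lambda>x. 0) (b / 2) (\<lambda>x. 1 * x)" by (rule pruefer_ident)
  have lo: "x \<le> \<phi> x" "\<xi> x \<le> x" if "x \<in> {0..b/2}" for x
    using pruefer_le[OF id P, of 0 "b/2" x] pruefer_le[OF Q id, of 0 "b/2" x] that \<sigma> by (auto simp: pruefer_0[OF P] pruefer_0[OF Q])
  have chi0: "\<xi> x \<ge> 0" if "x \<in> {0..b/2}" for x
    using pruefer_pos[OF Q, of x] pruefer_0[OF Q] that by (cases "x = 0") auto
  obtain N1 where N1: "countable N1" "\<And>x. x \<in> {0<..<b/2} - N1 \<Longrightarrow> (\<phi> has_real_derivative 1 + \<sigma> * f (\<phi> x)) (at x)"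
    using pruefer_deriv[OF P] by blast
  obtain N2 where N2: "countable N2" "\<And>x. x \<in> {0<..<b/2} - N2 \<Longrightarrow> (\<xi> has_real_derivative 1 + - \<sigma> * f (\<xi> x)) (at x)"
    using pruefer_deriv[OF Q] by blast
  have "\<phi> (b/2) + \<xi> (b/2) - 2 * (b/2) \<ge> 0"
  proof (rule gronwall_nonneg[where D="\<lambda>x. \<phi> x + \<xi> x - 2 * x" and N="N1 \<union> N2" and K=0 and a=0 and b="b/2"])
    show "continuous_on {0..b/2} (\<lambda>x. \<phi> x + \<xi> x - 2 * x)" by (intro continuous_intros pruefer_cont[OF P] pruefer_cont[OF Q])
    fix x assume x: "x \<in> {0<..<b/2} - (N1 \<union> N2)" and neg: "\<phi> x + \<xi> x - 2 * x < 0"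
    have "((\<lambda>x. \<phi> x + \<xi> x - 2 * x) has_real_derivative (1 + \<sigma> * f (\<phi> x)) + (1 + - \<sigma> * f (\<xi> x)) - 2) (at x)"
      using x N1(2)[of x] N2(2)[of x] by (intro DERIV_diff DERIV_add) (auto intro!: derivative_eq_intros)
    moreover have "f (\<xi> x) \<le> f (\<phi> x)"
      using x neg lo[of x] chi0[of x] by (intro f_mono_half) auto
    hence "(1 + \<sigma> * f (\<phi> x)) + (1 + - \<sigma> * f (\<xi> x)) - 2 \<ge> - 0 * \<bar>\<phi> x + \<xi> x - 2 * x\<bar>"
      using \<sigma> by (simp add: mult_left_mono)
    ultimately show "\<exists>d. ((\<lambda>x. \<phi> x + \<xi> x - 2 * x) has_real_derivative d) (at x) \<and> d \<ge> - 0 * \<bar>\<phi> x + \<xi> x - 2 * x\<bar>"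
      by blast
  qed (use N1 N2 b0 in \<open>auto simp: pruefer_0[OF P] pruefer_0[OF Q]\<close>)
  thus ?thesis by simp
qed

text \<open>Read from the right end, \<xi> gives another solution of the equation of \<theta>, but
  one that need not start at \<open>0\<close>. The ordering still propagates by Gronwall. It serves
  to join the comparisons from the two ends.\<close>

lemma pruefer_reverse_le:
  assumes P: "pruefer s a c \<theta>" and Q: "pruefer s (\<lambda>x. a (c - x)) c \<xi>" and x: "0 \<le> x0" "x0 \<le> x1" "x1 \<le> c"
    and i: "of_int n * b - \<xi> (c - x0) \<le> \<theta> x0"
  shows "of_int n * b - \<xi> (c - x1) \<le> \<theta> x1"
proof -
  obtain N1 where N1: "countable N1" "\<And>x. x \<in> {0<..<c} - N1 \<Longrightarrow> (\<theta> has_real_derivative s + a x * f (\<theta> x)) (at x)"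
    using pruefer_deriv[OF P] by blast
  obtain N2 where N2: "countable N2" "\<And>x. x \<in> {0<..<c} - N2 \<Longrightarrow> (\<xi> has_real_derivative s + a (c - x) * f (\<xi> x)) (at x)"
    using pruefer_deriv[OF Q] by blast
  obtain M where M: "M > 0" "\<And>x. x \<in> {0..c} \<Longrightarrow> \<bar>a x\<bar> \<le> M" using pruefer_bound[OF P] by blast
  define U where "U x = of_int n * b - \<xi> (c - x)" for x
  have "\<theta> x1 - U x1 \<ge> 0"
  proof (rule gronwall_nonneg[where D="\<lambda>x. \<theta> x - U x" and N="N1 \<union> (\<lambda>x. c - x) ` N2" and K="M * p" and a=x0 and b=x1])
    show "continuous_on {x0..x1} (\<lambda>x. \<theta> x - U x)" unfolding U_def using x
      by (intro continuous_intros continuous_on_subset[OF pruefer_cont[OF P]] continuous_on_compose2[OF pruefer_cont[OF Q]]) auto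
    fix t assume t: "t \<in> {x0<..<x1} - (N1 \<union> (\<lambda>x. c - x) ` N2)"
    have "c - t \<notin> N2" using t by force
    hence "(\<xi> has_real_derivative s + a t * f (\<xi> (c - t))) (at (c - t))" using t x N2(2)[of "c - t"] by auto
    hence "((\<lambda>x. \<xi> (c - x)) has_real_derivative (s + a t * f (\<xi> (c - t))) * (- 1)) (at t)"
      by (rule DERIV_chain2) (auto intro!: derivative_eq_intros)
    from DERIV_diff[OF DERIV_const[of "of_int n * b"] this] have dU: "(U has_real_derivative s + a t * f (U t)) (at t)"
      by (simp add: U_def[abs_def] f_reflect add.commute)
    have "((\<lambda>x. \<theta> x - U x) has_real_derivative (s + a t * f (\<theta> t)) - (s + a t * f (U t))) (at t)"
      using t x by (intro DERIV_diff dU N1(2)) auto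
    moreover have "\<bar>a t * (f (\<theta> t) - f (U t))\<bar> \<le> M * (p * \<bar>\<theta> t - U t\<bar>)"
      unfolding abs_mult using t x M by (intro mult_mono f_lipschitz) auto
    hence "(s + a t * f (\<theta> t)) - (s + a t * f (U t)) \<ge> - (M * p) * \<bar>\<theta> t - U t\<bar>"
      by (simp add: algebra_simps abs_le_iff)
    ultimately show "\<exists>d. ((\<lambda>x. \<theta> x - U x) has_real_derivative d) (at t) \<and> d \<ge> - (M * p) * \<bar>\<theta> t - U t\<bar>" by blast
  qed (use N1 N2 i x in \<open>auto simp: U_def\<close>)
  thus ?thesis by (simp add: U_def)
qed

end

section \<open>Lower bound for the gap\<close>

text \<open>The angles of the first two eigenfunctions at scale \<open>1\<close>, with the zero of
  the second one in the left half. The other position is brought into this form by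
  \<open>gap_reverse\<close>.\<close>

locale gap_setup = half_linear +
  fixes q \<phi>1 \<phi>2 :: "real \<Rightarrow> real" and l1 l2 z :: real
  assumes dec: "antimono_on {0..b / 2} q" and inc: "mono_on {b / 2..b} q"
    and P1: "pruefer 1 (\<lambda>x. l1 - q x - 1) b \<phi>1" and e1: "\<phi>1 b = b"
    and P2: "pruefer 1 (\<lambda>x. l2 - q x - 1) b \<phi>2" and e2: "\<phi>2 b = 2 * b"
    and z: "0 < z" "z \<le> b / 2" and ez: "\<phi>2 z = b"
begin

abbreviation a1 :: "real \<Rightarrow> real" where "a1 \<equiv> \<lambda>x. l1 - q x - 1"

definition \<delta> :: real where "\<delta> = l2 - l1"

lemma b0: "b > 0" by (rule b_pos)

lemma q_dec: "0 \<le> x \<Longrightarrow> x \<le> y \<Longrightarrow> y \<le> b / 2 \<Longrightarrow> q y \<le> q x"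
  using dec by (auto simp: monotone_on_def)

lemma q_inc: "b / 2 \<le> x \<Longrightarrow> x \<le> y \<Longrightarrow> y \<le> b \<Longrightarrow> q x \<le> q y"
  using inc by (auto simp: monotone_on_def)

lemma \<delta>_pos: "\<delta> > 0"
proof (rule ccontr)
  assume "\<not> \<delta> > 0"
  hence "\<phi>2 b \<le> \<phi>1 b" using b0
    by - (rule pruefer_le[OF P2 P1, of 0 b], auto simp: \<delta>_def pruefer_0[OF P1] pruefer_0[OF P2])
  thus False using e1 e2 b0 by simp
qed

lemma P2': "pruefer 1 (\<lambda>x. a1 x + \<delta>) b \<phi>2"
  by (rule pruefer_cong[OF P2]) (simp add: \<delta>_def)

lemma \<phi>1_less: "0 \<le> x \<Longrightarrow> x < b \<Longrightarrow> \<phi>1 x < b"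
  using pruefer_crossing[OF P1, of x b 1] e1 by (auto simp: not_less[symmetric])

lemma \<phi>2_less: "0 \<le> x \<Longrightarrow> x < z \<Longrightarrow> \<phi>2 x < b"
  using pruefer_crossing[OF P2, of x z 1] ez z b0 by (auto simp: not_less[symmetric])

lemma \<phi>2_greater: "z < x \<Longrightarrow> x \<le> b \<Longrightarrow> \<phi>2 x > b"
  using pruefer_crossing[OF P2, of z x 1] ez z by auto

text \<open>On \<open>{0..z}\<close> the coefficient \<open>a1\<close> is nondecreasing, so the
  constants \<open>a1 0\<close> and \<open>a1 z\<close> give angles below and above the one to be
  matched at \<open>z\<close>.\<close>

lemma left_const_exists:
  obtains \<sigma> \<psi> where "pruefer 1 (\<lambda>x. \<sigma>) b \<psi>" "\<psi> z = \<phi>1 z" "\<sigma> \<le> a1 z"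
proof -
  define T where "T \<mu> = (SOME \<theta>. pruefer 1 (\<lambda>x. \<mu>) b \<theta>)" for \<mu> :: real
  have T: "pruefer 1 (\<lambda>x. \<mu>) b (T \<mu>)" for \<mu>
    unfolding T_def using pruefer_exists[OF admissible_const] b0 by (metis less_imp_le someI_ex)
  have cont: "continuous_on UNIV (\<lambda>\<mu>. T \<mu> z)"
    by (rule pruefer_param_continuous[where c=b and s=1 and a="\<lambda>\<mu> x. \<mu>" and K=1]) (use T z b0 in auto)
  have "T (a1 0) z \<le> \<phi>1 z"
    by (rule pruefer_le[OF T P1, of 0 z]) (use z b0 in \<open>auto simp: pruefer_0[OF T] pruefer_0[OF P1] intro!: q_dec\<close>)
  moreover have "\<phi>1 z \<le> T (a1 z) z"
    by (rule pruefer_le[OF P1 T, of 0 z]) (use z b0 in \<open>auto simp: pruefer_0[OF T] pruefer_0[OF P1] intro!: q_dec\<close>)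
  moreover have "a1 0 \<le> a1 z" using q_dec[of 0 z] z by simp
  ultimately obtain \<mu> where "\<mu> \<le> a1 z" "T \<mu> z = \<phi>1 z"
    using IVT'[of "\<lambda>\<mu>. T \<mu> z" "a1 0" "\<phi>1 z" "a1 z"] continuous_on_subset[OF cont] by blast
  thus ?thesis using that T by blast
qed

text \<open>Since \<open>a1\<close> is nondecreasing on the left half, \<open>a1 - \<sigma>\<close>
  changes sign at most once. Before the change \<psi> gains on \<phi>1 from the common start; after
  it, a lead of \<phi>1 could not be lost before \<open>z\<close>, where the angles agree.\<close>

lemma left_le:
  assumes Q: "pruefer 1 A b \<psi>" and A: "\<And>x. x \<in> {0..z} \<Longrightarrow> A x = \<sigma>" and e: "\<psi> z = \<phi>1 z" and x: "x \<in> {0<..<z}"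
  shows "\<phi>1 x \<le> \<psi> x"
proof (cases "a1 x \<le> \<sigma>")
  case True
  have "a1 t \<le> A t" if "t \<in> {0<..<x}" for t using q_dec[of t x] that x z True A[of t] by auto
  thus ?thesis using x z b0
    by - (rule pruefer_le[OF P1 Q, of 0 x], auto simp: pruefer_0[OF P1] pruefer_0[OF Q])
next
  case False
  have le: "A t \<le> a1 t" if "t \<in> {x<..<z}" for t using q_dec[of x t] that x z False A[of t] by auto
  show ?thesis
  proof (rule ccontr)
    assume "\<not> \<phi>1 x \<le> \<psi> x"
    hence "\<psi> z < \<phi>1 z" using x z b0 le by - (rule pruefer_less[OF Q P1, of x z], auto)
    thus False using e by simp
  qed
qed

lemma left_pair:
  assumes Q: "pruefer 1 A b \<psi>" and A: "\<And>x. x \<in> {0..z} \<Longrightarrow> A x = \<sigma>" and e: "\<psi> z = \<phi>1 z"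
    and Q2: "pruefer 1 (\<lambda>x. A x + \<delta>) b \<psi>2"
  shows "riccati_pair p a1 A \<phi>1 \<phi>2 \<psi> \<psi>2 b \<delta> z"
proof unfold_locales
  fix x assume x: "x \<in> {0<..<z}"
  show "\<phi>1 x \<le> \<psi> x" by (rule left_le[OF Q A e x])
  show "\<psi> x < b"
  proof (rule ccontr)
    assume "\<not> \<psi> x < b"
    hence "\<psi> z > b" using pruefer_crossing[OF Q, of x z 1] x z b0 by auto
    thus False using e \<phi>1_less[of z] z b0 by simp
  qed
  show "\<phi>2 x < b" using \<phi>2_less x by auto
qed (use P1 P2' Q Q2 \<delta>_pos z b0 in auto)

lemma two_pow_solution:
  obtains \<Theta> where "pruefer 1 (\<lambda>x. 2 powr p - 1) b \<Theta>" "\<Theta> (b / 2) = b" "\<And>x. 0 \<le> x \<Longrightarrow> x < b / 2 \<Longrightarrow> \<Theta> x < b"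
proof -
  obtain \<Theta> where \<Theta>: "pruefer 1 (\<lambda>x. 2 powr p - 1) b \<Theta>"
    using pruefer_exists[OF admissible_const] b0 by (metis less_imp_le)
  show ?thesis
  proof (rule that[OF \<Theta>])
    show "\<Theta> (b / 2) = b" using b0 by (intro const_branch_eq[OF _ \<Theta>]) auto
    show "\<Theta> x < b" if "0 \<le> x" "x < b / 2" for x using b0 that by (intro const_branch_less[OF _ \<Theta>]) auto
  qed
qed

text \<open>By the Riccati comparison the solution for the constant \<sigma> + \<delta> has reached
  \<open>b\<close> at \<open>z\<close>, hence by \<open>b / 2\<close>. The constant
  \<open>2 powr p - 1\<close> is the one that reaches it exactly at \<open>b / 2\<close>, so it is
  at most \<sigma> + \<delta>, and \<sigma> is not positive.\<close>

lemma case_nonpos: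
  assumes Q: "pruefer 1 (\<lambda>x. \<sigma>) b \<psi>" and e: "\<psi> z = \<phi>1 z" and \<sigma>: "\<sigma> \<le> 0" "\<sigma> \<le> a1 z"
  shows "\<delta> \<ge> 2 powr p - 1 \<and> (\<delta> = 2 powr p - 1 \<longrightarrow> z = b / 2 \<and> (\<exists>N. countable N \<and> (\<forall>x\<in>{0<..<b/2} - N. q x = l1 - 1)))"
proof -
  obtain \<psi>2 where Q2: "pruefer 1 (\<lambda>x. \<sigma> + \<delta>) b \<psi>2"
    using pruefer_exists[OF admissible_const] b0 by (metis less_imp_le)
  interpret R: riccati_pair p a1 "\<lambda>x. \<sigma>" \<phi>1 \<phi>2 \<psi> \<psi>2 b \<delta> z
    by (rule left_pair[OF Q _ e Q2]) simp
  have ge: "\<psi>2 z \<ge> b" using R.riccati_compare[of z] ez z by simp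
  obtain \<Theta> where \<Theta>: "pruefer 1 (\<lambda>x. 2 powr p - 1) b \<Theta>" "\<Theta> (b / 2) = b" "\<And>x. 0 \<le> x \<Longrightarrow> x < b / 2 \<Longrightarrow> \<Theta> x < b"
    by (rule two_pow_solution) (rule that, assumption+)
  have \<Theta>z: "\<Theta> z \<le> b"
  proof (cases "z = b / 2")
    case True
    show ?thesis unfolding True \<Theta>(2) by simp
  next
    case False thus ?thesis using \<Theta>(3)[of z] z by auto
  qed
  have strict: "\<not> \<sigma> + \<delta> < 2 powr p - 1"
  proof
    assume "\<sigma> + \<delta> < 2 powr p - 1"
    hence "\<psi>2 z < \<Theta> z" using z b0
      by (intro pruefer_less_strict[OF Q2 \<Theta>(1), of 0]) (auto simp: pruefer_0[OF Q2] pruefer_0[OF \<Theta>(1)])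
    thus False using ge \<Theta>z by simp
  qed
  have "z = b / 2 \<and> (\<exists>N. countable N \<and> (\<forall>x\<in>{0<..<b/2} - N. q x = l1 - 1))" if eq: "\<delta> = 2 powr p - 1"
  proof -
    have \<sigma>0: "\<sigma> = 0" using strict \<sigma> eq by simp
    have le: "\<psi>2 z \<le> \<Theta> z"
      by (rule pruefer_le[OF Q2 \<Theta>(1), of 0 z]) (use z b0 eq \<sigma>0 in \<open>auto simp: pruefer_0[OF Q2] pruefer_0[OF \<Theta>(1)]\<close>)
    have zb: "z = b / 2" using le ge \<Theta>(3)[of z] z by force
    have e2: "\<psi>2 z = b" using le ge \<Theta>z by simp
    \<comment> \<open>If \<open>a1\<close> exceeded \<sigma> at \<open>x\<close>, it would do so up
      to \<open>z\<close>. Rigidity provides a later point where the first angles coincide, and from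
      there \<phi>1 would be strictly ahead at \<open>z\<close>. With
      \<open>a1 \<le> \<sigma>\<close> everywhere, equal angles at \<open>z\<close> force equality
      off a countable set.\<close>
    have a1_le: "a1 x \<le> \<sigma>" if x: "x \<in> {0<..<z}" for x
    proof (rule ccontr)
      assume gt: "\<not> a1 x \<le> \<sigma>"
      obtain x' where x': "x' \<in> {x<..<z}" "\<phi>1 x' = \<psi> x'"
        by (rule R.riccati_rigid[OF ez e2, of x]) (use e \<phi>1_less[of z] z b0 x in auto)
      have "\<psi> z < \<phi>1 z"
      proof (rule pruefer_less_strict[OF Q P1, of x' z])
        fix t assume "t \<in> {x'<..<z}"
        thus "\<sigma> < a1 t" using q_dec[of x t] x x' z gt by auto
      qed (use x x' z b0 in auto)
      thus False using e by simp
    qed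
    obtain N where N: "countable N" "\<And>x. x \<in> {0<..<z} - N \<Longrightarrow> a1 x = \<sigma>"
      by (rule pruefer_rigid[OF P1 Q, of 0 z]) (use a1_le e z b0 in \<open>auto simp: pruefer_0[OF P1] pruefer_0[OF Q]\<close>)
    have "\<forall>x\<in>{0<..<b/2} - N. q x = l1 - 1" using N(2) zb \<sigma>0 by force
    thus ?thesis using zb N(1) by blast
  qed
  thus ?thesis using strict \<sigma> by auto
qed

text \<open>By contradiction. With the step potential the second solutions, started at the two ends,
  satisfy a sum condition \<open>\<ge> 2 * b\<close> at the midpoint by comparison with
  \<open>q\<close>. If \<delta> were at most \<open>2 powr p - 1\<close>, they would be dominated by
  the solutions in \<open>step_sum_less\<close>, whose sum is smaller.\<close>

lemma case_pos:
  assumes Q: "pruefer 1 (\<lambda>x. \<sigma>) b \<psi>" and e: "\<psi> z = \<phi>1 z" and \<sigma>: "\<sigma> > 0" "\<sigma> \<le> a1 z"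
  shows "\<delta> > 2 powr p - 1"
proof (rule ccontr)
  assume "\<not> \<delta> > 2 powr p - 1"
  hence \<delta>_le: "\<delta> \<le> 2 powr p - 1" by simp
  define m where "m = b / 2"
  have m: "0 < m" "m < b" "b - m = m" "z \<le> m" using b0 z by (auto simp: m_def)
  have le_zm: "\<psi> x \<le> \<phi>1 x" if x: "x \<in> {z..m}" for x
  proof (rule pruefer_le[OF Q P1 _ _ _ _ x])
    fix t assume "t \<in> {z<..<m}"
    thus "\<sigma> \<le> a1 t" using \<sigma> q_dec[of z t] z m by (auto simp: m_def)
  qed (use z m e in auto)
  have \<psi>m: "\<psi> m < b" using le_zm[of m] \<phi>1_less[of m] m by auto
  obtain \<Theta> where \<Theta>: "pruefer 1 (\<lambda>x. 2 powr p - 1) b \<Theta>" "\<Theta> (b / 2) = b" "\<And>x. 0 \<le> x \<Longrightarrow> x < b / 2 \<Longrightarrow> \<Theta> x < b"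
    by (rule two_pow_solution) (rule that, assumption+)
  have \<sigma>_less: "\<sigma> < 2 powr p - 1"
  proof (rule ccontr)
    assume "\<not> \<sigma> < 2 powr p - 1"
    hence "\<Theta> m \<le> \<psi> m" using m
      by - (rule pruefer_le[OF \<Theta>(1) Q, of 0 m], auto simp: pruefer_0[OF Q] pruefer_0[OF \<Theta>(1)])
    thus False using \<psi>m \<Theta>(2) by (simp add: m_def)
  qed
  define A where "A \<mu> x = (if x \<le> m then \<sigma> else \<mu>)" for \<mu> x :: real
  have admA: "admissible b (A \<mu>)" for \<mu> by (rule admissible_step[of m _ \<sigma> b \<mu>]) (auto simp: A_def)
  define T where "T \<mu> = (SOME \<theta>. pruefer 1 (A \<mu>) b \<theta>)" for \<mu> :: real
  have T: "pruefer 1 (A \<mu>) b (T \<mu>)" for \<mu>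
    unfolding T_def using pruefer_exists[OF admA] b0 by (metis less_imp_le someI_ex)
  have Tm: "T \<mu> x = \<psi> x" if x: "x \<in> {0..m}" for \<mu> x
  proof (rule antisym)
    show "T \<mu> x \<le> \<psi> x"
      by (rule pruefer_le[OF T Q _ _ _ _ x]) (use m in \<open>auto simp: A_def pruefer_0[OF T] pruefer_0[OF Q]\<close>)
    show "\<psi> x \<le> T \<mu> x"
      by (rule pruefer_le[OF Q T _ _ _ _ x]) (use m in \<open>auto simp: A_def pruefer_0[OF T] pruefer_0[OF Q]\<close>)
  qed
  have cont: "continuous_on UNIV (\<lambda>\<mu>. T \<mu> b)"
    by (rule pruefer_param_continuous[where c=b and s=1 and a=A and K=1]) (use T b0 in \<open>auto simp: A_def\<close>)
  \<comment> \<open>An angle below \<open>b\<close> that the solution has not passed at the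
    midpoint. For the right value \<open>- 1 / f \<beta>\<close> the slope at \<beta> is
    \<open>1 - 1 = 0\<close>, so the angle stays below \<beta> and ends below \<open>b\<close>, the
    lower end for the intermediate value theorem. At the upper end \<open>0\<close> a positive
    \<sigma> keeps the angle at least \<open>x\<close>.\<close>
  define \<beta> where "\<beta> = max (\<psi> m) m"
  have \<beta>: "0 < \<beta>" "\<beta> < b" using \<psi>m m by (auto simp: \<beta>_def)
  have f\<beta>: "f \<beta> > 0" using f_pos \<beta> by auto
  have "T (- 1 / f \<beta>) b \<le> \<beta>"
    by (rule pruefer_barrier[OF T, of m b]) (use m f\<beta> Tm[of m] in \<open>auto simp: A_def \<beta>_def\<close>)
  hence lo: "T (- 1 / f \<beta>) b \<le> b" using \<beta> by simp
  have "1 * b \<le> T 0 b"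
    by (rule pruefer_le[OF pruefer_ident T, of 0 b]) (use \<sigma> b0 in \<open>auto simp: A_def pruefer_0[OF T]\<close>)
  hence hi: "b \<le> T 0 b" by simp
  obtain \<mu> where \<mu>: "\<mu> \<le> 0" "T \<mu> b = b"
    using IVT'[of "\<lambda>\<mu>. T \<mu> b" "- 1 / f \<beta>" b 0] lo hi f\<beta> continuous_on_subset[OF cont] by auto
  define \<psi>1 where "\<psi>1 = T \<mu>"
  have Q1: "pruefer 1 (A \<mu>) b \<psi>1" unfolding \<psi>1_def by (rule T)
  have \<psi>1: "\<psi>1 b = b" "\<And>x. x \<in> {0..m} \<Longrightarrow> \<psi>1 x = \<psi> x" using \<mu> Tm by (auto simp: \<psi>1_def)
  \<comment> \<open>On the right half \<open>a1\<close> is nonincreasing, so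
    \<open>a1 - \<mu>\<close> changes sign at most once, from plus to minus: first \<phi>1 keeps its
    lead, and later a lead of \<psi>1 would persist up to \<open>b\<close>, where both angles equal
    \<open>b\<close>.\<close>
  have right_le: "\<psi>1 x \<le> \<phi>1 x" if x: "x \<in> {z..b}" for x
  proof (cases "x \<le> m")
    case True thus ?thesis using le_zm[of x] \<psi>1(2)[of x] x z by auto
  next
    case False
    hence xm: "m < x" by simp
    have start: "\<psi>1 m \<le> \<phi>1 m" using le_zm[of m] \<psi>1(2)[of m] m by auto
    show ?thesis
    proof (cases "a1 x \<ge> \<mu>")
      case True
      show ?thesis
      proof (rule pruefer_le[OF Q1 P1 _ _ _ start])
        fix t assume "t \<in> {m<..<x}"
        thus "A \<mu> t \<le> a1 t" using q_inc[of t x] x True by (auto simp: A_def m_def)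
      qed (use x xm m in auto)
    next
      case False
      show ?thesis
      proof (rule ccontr)
        assume lt: "\<not> \<psi>1 x \<le> \<phi>1 x"
        have "\<phi>1 b < \<psi>1 b"
        proof (rule pruefer_less[OF P1 Q1, of x b b])
          fix t assume "t \<in> {x<..<b}"
          thus "a1 t \<le> A \<mu> t" using q_inc[of x t] x xm False by (auto simp: A_def m_def)
        qed (use x xm m lt in auto)
        thus False using e1 \<psi>1 by simp
      qed
    qed
  qed
  have ez1: "\<psi>1 z = \<phi>1 z" using \<psi>1(2)[of z] e z m by auto
  have admA\<delta>: "admissible b (\<lambda>x. A \<mu> x + \<delta>)" using admissible_affine[OF admA, of 1 \<mu> \<delta>] by simp
  obtain \<psi>2 where Q2: "pruefer 1 (\<lambda>x. A \<mu> x + \<delta>) b \<psi>2" using pruefer_exists[OF admA\<delta>] b0 by (metis less_imp_le)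
  interpret L: riccati_pair p a1 "A \<mu>" \<phi>1 \<phi>2 \<psi>1 \<psi>2 b \<delta> z
    by (rule left_pair[OF Q1 _ ez1 Q2, of \<sigma>]) (use m in \<open>auto simp: A_def\<close>)
  have left: "\<psi>2 z \<ge> b" using L.riccati_compare[of z] ez z by simp

  have admR: "admissible b (\<lambda>x. A \<mu> (b - x) + \<delta>)"
    by (rule admissible_step[of m _ "\<mu> + \<delta>" b "\<sigma> + \<delta>"]) (use m in \<open>auto simp: A_def\<close>)
  \<comment> \<open>The second solution of the comparison equation started at the right end. \<psi>2
    need not satisfy the boundary condition there, so it cannot be obtained by reflecting
    \<psi>2.\<close>
  obtain \<xi>2 where X2: "pruefer 1 (\<lambda>x. A \<mu> (b - x) + \<delta>) b \<xi>2" using pruefer_exists[OF admR] b0 by (metis less_imp_le)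
  have Pr1: "pruefer 1 (\<lambda>x. a1 (b - x)) b (\<lambda>x. of_int 1 * b - \<phi>1 (b - x))"
    using b0 e1 by (intro pruefer_reverse[OF P1]) auto
  have Pr2: "pruefer 1 (\<lambda>x. a1 (b - x) + \<delta>) b (\<lambda>x. of_int 2 * b - \<phi>2 (b - x))"
    using b0 e2 by (intro pruefer_reverse[OF P2']) auto
  have Qr1: "pruefer 1 (\<lambda>x. A \<mu> (b - x)) b (\<lambda>x. of_int 1 * b - \<psi>1 (b - x))"
    using b0 \<psi>1 by (intro pruefer_reverse[OF Q1]) auto
  interpret R: riccati_pair p "\<lambda>x. a1 (b - x)" "\<lambda>x. A \<mu> (b - x)" "\<lambda>x. of_int 1 * b - \<phi>1 (b - x)" "\<lambda>x. of_int 2 * b - \<phi>2 (b - x)"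
    "\<lambda>x. of_int 1 * b - \<psi>1 (b - x)" \<xi>2 b \<delta> "b - z"
  proof unfold_locales
    fix x assume x: "x \<in> {0<..<b - z}"
    show "of_int 1 * b - \<phi>1 (b - x) \<le> of_int 1 * b - \<psi>1 (b - x)" using right_le[of "b - x"] x z by auto
    show "of_int 1 * b - \<psi>1 (b - x) < b" using pruefer_pos[OF Q1, of "b - x"] x z by auto
    show "of_int 2 * b - \<phi>2 (b - x) < b" using \<phi>2_greater[of "b - x"] x by auto
  qed (use Pr1 Pr2 Qr1 X2 \<delta>_pos z m in auto)
  have right: "\<xi>2 (b - z) \<ge> b" using R.riccati_compare[of "b - z"] ez z m by simp

  \<comment> \<open>At \<open>z\<close> the solution from the left has angle at least
    \<open>b\<close>, the reflected one from the right at most \<open>b\<close>. Both solve the same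
    equation, so the order is kept up to the midpoint.\<close>
  have "of_int 2 * b - \<xi>2 (b - m) \<le> \<psi>2 m"
    by (rule pruefer_reverse_le[OF Q2, of \<xi>2 z m 2]) (use X2 left right z m in auto)
  hence sum_ge: "\<psi>2 m + \<xi>2 m \<ge> 2 * b" using m by simp

  \<comment> \<open>The first angles of the comparison potential, measured from the two ends, add up
    to \<open>b\<close> at the midpoint. By \<open>step_sum_ge\<close> this sum is already at least
    \<open>b\<close> for the values \<sigma> and \<open>- \<sigma>\<close>, so a right value above
    \<open>- \<sigma>\<close> would make it too large.\<close>
  have \<mu>\<sigma>: "\<mu> \<le> - \<sigma>"
  proof (rule ccontr)
    assume gt: "\<not> \<mu> \<le> - \<sigma>"
    obtain \<xi> where X: "pruefer 1 (\<lambda>x. - \<sigma>) b \<xi>" using pruefer_exists[OF admissible_const] b0 by (metis less_imp_le)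
    have "\<xi> m < of_int 1 * b - \<psi>1 (b - m)"
    proof (rule pruefer_less_strict[OF X Qr1, of 0 m])
      fix x assume "x \<in> {0<..<m}"
      thus "- \<sigma> < A \<mu> (b - x)" using m gt by (auto simp: A_def)
    qed (use m \<psi>1 pruefer_0[OF X] in auto)
    hence "\<psi> m + \<xi> m < b" using \<psi>1(2)[of m] m by simp
    moreover have "b \<le> \<psi> (b / 2) + \<xi> (b / 2)"
      using \<sigma> b0 by (intro step_sum_ge[of \<sigma>] pruefer_restrict[OF Q] pruefer_restrict[OF X]) auto
    ultimately show False by (simp add: m_def)
  qed
  obtain \<theta>l where \<theta>l: "pruefer 1 (\<lambda>x. 2 powr p + \<sigma> - 1) b \<theta>l" using pruefer_exists[OF admissible_const] b0 by (metis less_imp_le)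
  obtain \<theta>r where \<theta>r: "pruefer 1 (\<lambda>x. 2 powr p - \<sigma> - 1) b \<theta>r" using pruefer_exists[OF admissible_const] b0 by (metis less_imp_le)
  have "\<psi>2 m \<le> \<theta>l m"
  proof (rule pruefer_le[OF Q2 \<theta>l, of 0 m])
    fix x assume "x \<in> {0<..<m}"
    thus "A \<mu> x + \<delta> \<le> 2 powr p + \<sigma> - 1" using \<delta>_le by (auto simp: A_def)
  qed (use m in \<open>auto simp: pruefer_0[OF Q2] pruefer_0[OF \<theta>l]\<close>)
  moreover have "\<xi>2 m \<le> \<theta>r m"
  proof (rule pruefer_le[OF X2 \<theta>r, of 0 m])
    fix x assume "x \<in> {0<..<m}"
    thus "A \<mu> (b - x) + \<delta> \<le> 2 powr p - \<sigma> - 1" using \<delta>_le \<mu>\<sigma> m by (auto simp: A_def)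
  qed (use m in \<open>auto simp: pruefer_0[OF X2] pruefer_0[OF \<theta>r]\<close>)
  moreover have "\<theta>l m + \<theta>r m < 2 * b" using step_sum_less[OF \<sigma>(1) \<sigma>_less \<theta>l \<theta>r] by (simp add: m_def)
  ultimately show False using sum_ge by simp
qed

lemma gap_core:
  "l2 - l1 \<ge> 2 powr p - 1 \<and>
   (l2 - l1 = 2 powr p - 1 \<longrightarrow> z = b / 2 \<and> (\<exists>N. countable N \<and> (\<forall>x\<in>{0<..<b/2} - N. q x = l1 - 1)))"
proof -
  obtain \<sigma> \<psi> where Q: "pruefer 1 (\<lambda>x. \<sigma>) b \<psi>" "\<psi> z = \<phi>1 z" "\<sigma> \<le> a1 z"
    by (rule left_const_exists) (rule that)
  show ?thesis
  proof (cases "\<sigma> \<le> 0")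
    case True
    from case_nonpos[OF Q(1,2) True Q(3)] show ?thesis by (simp add: \<delta>_def)
  next
    case False
    from case_pos[OF Q(1,2) _ Q(3)] False show ?thesis by (simp add: \<delta>_def)
  qed
qed

end

section \<open>From angles back to eigenvalues: lower bound and case of equality\<close>

lemma nth_dirichlet_eigenvalue_unique:
  assumes "nth_dirichlet_eigenvalue p c q n l" "nth_dirichlet_eigenvalue p c q n l'"
  shows "l = l'"
proof -
  have *: "\<not> x < y" if "nth_dirichlet_eigenvalue p c q n x" "nth_dirichlet_eigenvalue p c q n y" for x y
  proof
    assume "x < y"
    define A where "A t = {\<mu>. dirichlet_eigenvalue p c q \<mu> \<and> \<mu> \<le> t}" for t
    have A: "y \<in> A y" "finite (A y)" "card (A x) = n" "card (A y) = n"
      using that by (simp_all add: A_def nth_dirichlet_eigenvalue_def)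
    have "A x \<subseteq> A y" "y \<notin> A x" using \<open>x < y\<close> by (auto simp: A_def)
    hence "A x \<subset> A y" using A(1) by blast
    from psubset_card_mono[OF A(2) this] A(3,4) show False by simp
  qed
  show ?thesis using *[OF assms] *[OF assms(2,1)] by simp
qed

text \<open>Reduces a potential that is constant only a.e. to the constant itself, whose eigenvalues
  are explicit.\<close>

lemma dirichlet_eigenvalue_AE_cong:
  assumes ae: "AE x in lebesgue. x \<in> {0<..<c} \<longrightarrow> q x = q' x"
  shows "dirichlet_eigenvalue p c q = dirichlet_eigenvalue p c q'"
proof -
  have "dirichlet_solution p c q' lam y y'" if D: "dirichlet_solution p c q lam y y'"
    and ae: "AE x in lebesgue. x \<in> {0<..<c} \<longrightarrow> q x = q' x" for q q' :: "real \<Rightarrow> real" and lam y y'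
  proof -
    have "AE x in lebesgue. x \<in> {0<..<c} \<longrightarrow> ((\<lambda>t. signed_power p (y' t)) has_real_derivative
           - (p - 1) * (lam - q x) * signed_power p (y x)) (at x)"
      using D by (auto simp: dirichlet_solution_def)
    with ae have "AE x in lebesgue. x \<in> {0<..<c} \<longrightarrow> ((\<lambda>t. signed_power p (y' t)) has_real_derivative
           - (p - 1) * (lam - q' x) * signed_power p (y x)) (at x)"
      by eventually_elim auto
    thus ?thesis using D by (auto simp: dirichlet_solution_def)
  qed
  moreover have "AE x in lebesgue. x \<in> {0<..<c} \<longrightarrow> q' x = q x" using ae by eventually_elim auto
  ultimately show ?thesis using ae unfolding dirichlet_eigenvalue_def fun_eq_iff by blast
qed

context half_linear
begin

text \<open>Monotone functions have at most countably many discontinuities, and the values at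
  \<open>0\<close>, \<open>a\<close> and \<open>b\<close> bound a single-well function on the closed
  interval.\<close>

lemma single_well_admissible:
  assumes q: "q absolutely_integrable_on {0<..<b}" and w: "single_well b a q"
  shows "admissible b q"
proof -
  have a: "0 \<le> a" "a \<le> b" and dec: "antimono_on {0..a} q" and inc: "mono_on {a..b} q"
    using w by (auto simp: single_well_def)
  have bd: "\<bar>q x\<bar> \<le> \<bar>q 0\<bar> + \<bar>q a\<bar> + \<bar>q b\<bar>" if x: "x \<in> {0..b}" for x
  proof (cases "x \<le> a")
    case True
    hence "q a \<le> q x" "q x \<le> q 0" using dec x a by (auto simp: monotone_on_def)
    thus ?thesis by linarith
  next
    case False
    hence "q a \<le> q x" "q x \<le> q b" using inc x a by (auto simp: monotone_on_def)
    thus ?thesis by linarith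
  qed
  have "q absolutely_integrable_on {0..b}"
  proof (rule absolutely_integrable_spike_set[OF q])
    show "negligible {x \<in> {0<..<b} - {0..b}. q x \<noteq> 0}" by (rule negligible_subset[of "{}"]) auto
    show "negligible {x \<in> {0..b} - {0<..<b}. q x \<noteq> 0}" by (rule negligible_subset[of "{0,b}"]) auto
  qed
  moreover have "countable {x \<in> {a<..<b}. \<not> isCont q x}"
    using inc by (intro mono_on_ctble_discont_open) (auto simp: monotone_on_def)
  moreover have "countable {x \<in> {0<..<a}. \<not> isCont (\<lambda>x. - q x) x}"
    using dec by (intro mono_on_ctble_discont_open) (auto simp: monotone_on_def)
  moreover have "isCont q x" if "isCont (\<lambda>x. - q x) x" for x
    using isCont_minus[OF that] by simp
  ultimately show ?thesis unfolding admissible_def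
    using bd
    by (intro conjI exI[of _ "\<bar>q 0\<bar> + \<bar>q a\<bar> + \<bar>q b\<bar>"]
        exI[of _ "{x \<in> {a<..<b}. \<not> isCont q x} \<union> {x \<in> {0<..<a}. \<not> isCont (\<lambda>x. - q x) x} \<union> {a}"]) auto
qed

lemma coef_1: "coef 1 lam q = (\<lambda>x. lam - q x - 1)"
  by (simp add: coef_def fun_eq_iff)

text \<open>Taking scale \<open>1\<close> for the first and scale \<open>2\<close> for the second
  eigenvalue makes the coefficient vanish, so the angles are \<open>x\<close> and
  \<open>2 * x\<close>.\<close>

lemma const_nth:
  "nth_dirichlet_eigenvalue p b (\<lambda>_. c) 1 (c + 1)" "nth_dirichlet_eigenvalue p b (\<lambda>_. c) 2 (c + 2 powr p)"
proof -
  have "coef 1 (c + 1) (\<lambda>_. c) = (\<lambda>x. 0)" by (simp add: coef_1)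
  thus "nth_dirichlet_eigenvalue p b (\<lambda>_. c) 1 (c + 1)"
    using pruefer_ident[of 1 b] by (subst nth_eigenvalue_iff[OF admissible_const, of 1]) (auto intro!: exI[of _ "\<lambda>x. 1 * x"])
  have "(2::real) powr (1 - p) * 2 powr p = 2" by (subst powr_add[symmetric]) simp
  hence "coef 2 (c + 2 powr p) (\<lambda>_. c) = (\<lambda>x. 0)" by (simp add: coef_def fun_eq_iff)
  thus "nth_dirichlet_eigenvalue p b (\<lambda>_. c) 2 (c + 2 powr p)"
    using pruefer_ident[of 2 b] by (subst nth_eigenvalue_iff[OF admissible_const, of 2]) (auto intro!: exI[of _ "\<lambda>x. 2 * x"])
qed

lemma gap_reverse:
  assumes w: "single_well b (b / 2) q"
    and P1: "pruefer 1 (\<lambda>x. l1 - q x - 1) b \<phi>1" and e1: "\<phi>1 b = b"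
    and P2: "pruefer 1 (\<lambda>x. l2 - q x - 1) b \<phi>2" and e2: "\<phi>2 b = 2 * b"
    and z: "b / 2 \<le> z" "z < b" and ez: "\<phi>2 z = b"
  shows "gap_setup p (\<lambda>x. q (b - x)) (\<lambda>x. of_int 1 * b - \<phi>1 (b - x)) (\<lambda>x. of_int 2 * b - \<phi>2 (b - x)) l1 l2 (b - z)"
proof unfold_locales
  have b0: "b \<ge> 0" using b_pos by simp
  show "pruefer 1 (\<lambda>x. l1 - q (b - x) - 1) b (\<lambda>x. of_int 1 * b - \<phi>1 (b - x))"
    using e1 b0 by (intro pruefer_reverse[OF P1]) auto
  show "pruefer 1 (\<lambda>x. l2 - q (b - x) - 1) b (\<lambda>x. of_int 2 * b - \<phi>2 (b - x))"
    using e2 b0 by (intro pruefer_reverse[OF P2]) auto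
  show "antimono_on {0..b / 2} (\<lambda>x. q (b - x))" "mono_on {b / 2..b} (\<lambda>x. q (b - x))"
    using w by (auto simp: single_well_def monotone_on_def)
qed (use z ez pruefer_0[OF P1] pruefer_0[OF P2] in auto)

lemma gap_lower_bound:
  assumes q: "q absolutely_integrable_on {0<..<b}" and w: "single_well b (b / 2) q"
    and n1: "nth_dirichlet_eigenvalue p b q 1 lam1" and n2: "nth_dirichlet_eigenvalue p b q 2 lam2"
  shows "lam2 - lam1 \<ge> 2 powr p - 1 \<and>
     (lam2 - lam1 = 2 powr p - 1 \<longrightarrow> (AE x in lebesgue. x \<in> {0<..<b} \<longrightarrow> q x = lam1 - 1))"
proof -
  have b0: "b > 0" by (rule b_pos)
  have adm: "admissible b q" by (rule single_well_admissible[OF q w])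
  obtain \<phi>1 where \<phi>1: "pruefer 1 (\<lambda>x. lam1 - q x - 1) b \<phi>1" "\<phi>1 b = b"
    using n1 nth_eigenvalue_iff[OF adm, of 1 1 lam1] by (auto simp: coef_1)
  obtain \<phi>2 where \<phi>2: "pruefer 1 (\<lambda>x. lam2 - q x - 1) b \<phi>2" "\<phi>2 b = 2 * b"
    using n2 nth_eigenvalue_iff[OF adm, of 1 2 lam2] by (auto simp: coef_1)
  have "\<exists>z\<ge>0. z \<le> b \<and> \<phi>2 z = b"
    using \<phi>2 b0 pruefer_0[OF \<phi>2(1)] by (intro IVT' pruefer_cont[OF \<phi>2(1)]) auto
  then obtain z where z: "0 \<le> z" "z \<le> b" "\<phi>2 z = b" by blast
  have z': "0 < z" "z < b"
    using z \<phi>2(2) pruefer_0[OF \<phi>2(1)] b0 by (cases "z = 0"; cases "z = b"; auto)+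
  have left: "gap_setup p q \<phi>1 \<phi>2 lam1 lam2 z" if "z \<le> b / 2"
  proof unfold_locales
    show "antimono_on {0..b / 2} q" "mono_on {b / 2..b} q" using w by (auto simp: single_well_def)
  qed (use \<phi>1 \<phi>2 z z' that in auto)
  have right: "gap_setup p (\<lambda>x. q (b - x)) (\<lambda>x. of_int 1 * b - \<phi>1 (b - x)) (\<lambda>x. of_int 2 * b - \<phi>2 (b - x)) lam1 lam2 (b - z)"
    if "b / 2 \<le> z" by (rule gap_reverse[OF w \<phi>1 \<phi>2 that z'(2) z(3)])
  show ?thesis
  proof (cases "z \<le> b / 2")
    case True
    note L = gap_setup.gap_core[OF left[OF True]]
    have "AE x in lebesgue. x \<in> {0<..<b} \<longrightarrow> q x = lam1 - 1" if eq: "lam2 - lam1 = 2 powr p - 1"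
    proof -
      obtain N where N: "countable N" "\<forall>x\<in>{0<..<b/2} - N. q x = lam1 - 1" and zb: "z = b / 2" using L eq by blast
      \<comment> \<open>Equality puts the zero exactly at \<open>b / 2\<close>. The reflected
        potential therefore falls under the same setup, and it determines \<open>q\<close> on the
        right half.\<close>
      have "b / 2 \<le> z" using zb by simp
      from gap_setup.gap_core[OF right[OF this]] eq
      obtain N' where N': "countable N'" "\<forall>x\<in>{0<..<b/2} - N'. q (b - x) = lam1 - 1" by blast
      show ?thesis
      proof (rule AE_of_off_countable[of "N \<union> (\<lambda>x. b - x) ` N' \<union> {b/2}"], use N(1) N'(1) in blast, intro impI)
        fix x assume x: "x \<notin> N \<union> (\<lambda>x. b - x) ` N' \<union> {b/2}" "x \<in> {0<..<b}"
        show "q x = lam1 - 1"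
        proof (cases "x < b / 2")
          case True thus ?thesis using N(2) x by auto
        next
          case False
          have "b - x \<notin> N'" using x(1) by force
          thus ?thesis using N'(2)[rule_format, of "b - x"] x False by auto
        qed
      qed
    qed
    thus ?thesis using L by blast
  next
    case False
    hence zz: "b / 2 \<le> z" by simp
    \<comment> \<open>Here the zero lies strictly to the right of \<open>b / 2\<close>, whereas
      equality would place it at \<open>b / 2\<close>; the gap is thus strictly larger.\<close>
    from gap_setup.gap_core[OF right[OF zz]] False show ?thesis by auto
  qed
qed

lemma gap_eq_iff:
  assumes q: "q absolutely_integrable_on {0<..<b}" and w: "single_well b (b / 2) q"
    and n1: "nth_dirichlet_eigenvalue p b q 1 lam1" and n2: "nth_dirichlet_eigenvalue p b q 2 lam2"
  shows "lam2 - lam1 = 2 powr p - 1 \<longleftrightarrow> (\<exists>c. AE x in lebesgue. x \<in> {0<..<b} \<longrightarrow> q x = c)"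
proof
  assume "lam2 - lam1 = 2 powr p - 1"
  thus "\<exists>c. AE x in lebesgue. x \<in> {0<..<b} \<longrightarrow> q x = c" using gap_lower_bound[OF assms] by blast
next
  assume "\<exists>c. AE x in lebesgue. x \<in> {0<..<b} \<longrightarrow> q x = c"
  then obtain c where "AE x in lebesgue. x \<in> {0<..<b} \<longrightarrow> q x = c" by blast
  hence eq: "dirichlet_eigenvalue p b q = dirichlet_eigenvalue p b (\<lambda>_. c)" by (rule dirichlet_eigenvalue_AE_cong)
  have "nth_dirichlet_eigenvalue p b q n l = nth_dirichlet_eigenvalue p b (\<lambda>_. c) n l" for n l
    by (simp add: nth_dirichlet_eigenvalue_def eq)
  hence "lam1 = c + 1" "lam2 = c + 2 powr p"
    using n1 n2 const_nth[of c] nth_dirichlet_eigenvalue_unique by blast+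
  thus "lam2 - lam1 = 2 powr p - 1" by simp
qed

section \<open>Potentials with a small gap\<close>

lemma pruefer_integral_eq:
  assumes a: "admissible b a" and P: "pruefer s a b \<theta>"
  shows "\<theta> b = s * b + integral {0..b} (\<lambda>x. a x * f (\<theta> x))"
proof -
  have b0: "b \<ge> 0" using b_pos by simp
  have cf: "continuous_on {0..b} (\<lambda>x. f (\<theta> x))" by (intro continuous_intros pruefer_cont[OF P])
  obtain N1 where N1: "countable N1" "\<And>x. x \<in> {0<..<b} - N1 \<Longrightarrow>
     ((\<lambda>x. integral {0..x} (\<lambda>t. a t * f (\<theta> t))) has_real_derivative a x * f (\<theta> x)) (at x)"
    using admissible_integral_deriv[OF a cf] by blast
  obtain N2 where N2: "countable N2" "\<And>x. x \<in> {0<..<b} - N2 \<Longrightarrow> (\<theta> has_real_derivative s + a x * f (\<theta> x)) (at x)"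
    using pruefer_deriv[OF P] by blast
  have "\<theta> b - s * b - integral {0..b} (\<lambda>t. a t * f (\<theta> t)) = \<theta> 0 - s * 0 - integral {0..0} (\<lambda>t. a t * f (\<theta> t))"
  proof (rule const_of_zero_deriv_off_countable[where N="N1 \<union> N2" and b=b and x=b
        and f="\<lambda>x. \<theta> x - s * x - integral {0..x} (\<lambda>t. a t * f (\<theta> t))"])
    show "continuous_on {0..b} (\<lambda>x. \<theta> x - s * x - integral {0..x} (\<lambda>t. a t * f (\<theta> t)))"
      by (intro continuous_intros pruefer_cont[OF P] admissible_integral_continuous[OF a cf b0])
    fix x assume x: "x \<in> {0<..<b} - (N1 \<union> N2)"
    have "((\<lambda>x. \<theta> x - s * x - integral {0..x} (\<lambda>t. a t * f (\<theta> t))) has_real_derivative (s + a x * f (\<theta> x)) - s - a x * f (\<theta> x)) (at x)"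
      using x by (intro DERIV_diff N1(2) N2(2)) (auto intro!: derivative_eq_intros)
    thus "((\<lambda>x. \<theta> x - s * x - integral {0..x} (\<lambda>t. a t * f (\<theta> t))) has_real_derivative 0) (at x)" by simp
  qed (use N1 N2 b0 in auto)
  thus ?thesis by (simp add: pruefer_0[OF P])
qed

text \<open>The unperturbed angle is \<open>s * x\<close>, so the first-order expansion needs no variational equation.\<close>

lemma perturbed_eigenvalue:
  assumes s: "s > 0" and J: "admissible b J" "\<And>x. x \<in> {0..b} \<Longrightarrow> 0 \<le> J x \<and> J x \<le> 1" and \<epsilon>: "\<epsilon> \<ge> 0"
  obtains \<mu> \<theta> where "pruefer s (coef s (s powr p + \<mu>) (\<lambda>x. \<epsilon> * J x)) b \<theta>" "\<theta> b = s * b"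
    "\<bar>\<mu> * integral {0..b} (\<lambda>x. f (s * x)) - \<epsilon> * integral {0..b} (\<lambda>x. J x * f (s * x))\<bar> \<le> 2 * p * s powr (1 - p) * b * b * \<epsilon> * \<epsilon>"
proof -
  have b0: "b > 0" by (rule b_pos)
  define k where "k = s powr (1 - p)"
  have k: "k > 0" using s by (simp add: k_def)
  have ks: "k * s powr p = s" unfolding k_def using s by (subst powr_add[symmetric]) simp
  have co: "coef s (s powr p + \<mu>) (\<lambda>x. \<epsilon> * J x) = (\<lambda>x. k * (\<mu> - \<epsilon> * J x))" for \<mu>
    using ks by (auto simp: coef_def k_def[symmetric] fun_eq_iff algebra_simps)
  have admq: "admissible b (\<lambda>x. \<epsilon> * J x)" using admissible_affine[OF J(1), of \<epsilon> 0] by simp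
  define T where "T \<mu> = (SOME \<theta>. pruefer s (coef s (s powr p + \<mu>) (\<lambda>x. \<epsilon> * J x)) b \<theta>)" for \<mu>
  have T: "pruefer s (\<lambda>x. k * (\<mu> - \<epsilon> * J x)) b (T \<mu>)" for \<mu>
    unfolding T_def co[symmetric] using pruefer_exists[OF admissible_coef[OF admq]] b0 by (metis less_imp_le someI_ex)
  have cont: "continuous_on UNIV (\<lambda>\<mu>. T \<mu> b)"
    by (rule pruefer_param_continuous[where c=b and s=s and a="\<lambda>\<mu> x. k * (\<mu> - \<epsilon> * J x)" and K=k])
       (use T b0 k in \<open>auto simp: right_diff_distrib[symmetric] abs_mult\<close>)
  have J\<epsilon>: "0 \<le> \<epsilon> * J x" "\<epsilon> * J x \<le> \<epsilon>" if "x \<in> {0..b}" for x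
    using J(2)[OF that] \<epsilon> by (auto simp: mult_left_le)
  have "T 0 b \<le> s * b"
  proof (rule pruefer_le[OF T pruefer_ident, of 0 b])
    fix x assume "x \<in> {0<..<b}"
    thus "k * (0 - \<epsilon> * J x) \<le> 0" using k J\<epsilon>[of x] by (simp add: mult_nonneg_nonpos)
  qed (use b0 in \<open>auto simp: pruefer_0[OF T]\<close>)
  moreover have "s * b \<le> T \<epsilon> b"
  proof (rule pruefer_le[OF pruefer_ident T, of 0 b])
    fix x assume "x \<in> {0<..<b}"
    thus "0 \<le> k * (\<epsilon> - \<epsilon> * J x)" using k J\<epsilon>[of x] by simp
  qed (use b0 in \<open>auto simp: pruefer_0[OF T]\<close>)
  \<comment> \<open>The perturbation lies between \<open>0\<close> and \<epsilon>, and so does the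
    shift of the eigenvalue, by comparison with the unperturbed angle \<open>s * x\<close>.\<close>
  ultimately obtain \<mu> where \<mu>: "0 \<le> \<mu>" "\<mu> \<le> \<epsilon>" "T \<mu> b = s * b"
    using IVT'[of "\<lambda>\<mu>. T \<mu> b" 0 "s * b" \<epsilon>] \<epsilon> continuous_on_subset[OF cont] by blast
  define \<theta> where "\<theta> = T \<mu>"
  have P: "pruefer s (\<lambda>x. k * (\<mu> - \<epsilon> * J x)) b \<theta>" "\<theta> b = s * b" unfolding \<theta>_def by (rule T, rule \<mu>(3))
  have c\<theta>: "continuous_on {0..b} (\<lambda>x. f (\<theta> x))" by (intro continuous_intros pruefer_cont[OF P(1)])
  have cs: "continuous_on {0..b} (\<lambda>x. f (s * x))" by (intro continuous_intros)
  have admc: "admissible b (\<lambda>x. k * (\<mu> - \<epsilon> * J x))"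
    using admissible_affine[OF J(1), of "- (k * \<epsilon>)" "k * \<mu>"] by (simp add: algebra_simps)
  have int1: "(\<lambda>x. f (\<theta> x)) integrable_on {0..b}" "(\<lambda>x. f (s * x)) integrable_on {0..b}"
    using c\<theta> cs by (auto intro: integrable_continuous_real)
  have int2: "(\<lambda>x. J x * f (\<theta> x)) integrable_on {0..b}" "(\<lambda>x. J x * f (s * x)) integrable_on {0..b}"
    using b0 by (auto intro!: admissible_mult_integrable[OF J(1)] c\<theta> cs)
  \<comment> \<open>The final angle is exactly \<open>s * b\<close>, so the integral of the
    perturbation along the perturbed angle vanishes. Replacing that angle by \<open>s * x\<close> in
    the resulting balance costs a factor of order \<epsilon>, which multiplies \<epsilon> or \<mu>;
    hence the quadratic error.\<close>
  have "0 = integral {0..b} (\<lambda>x. k * (\<mu> - \<epsilon> * J x) * f (\<theta> x))"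
    using pruefer_integral_eq[OF admc P(1)] P(2) by simp
  also have "\<dots> = integral {0..b} (\<lambda>x. (k * \<mu>) * f (\<theta> x) - (k * \<epsilon>) * (J x * f (\<theta> x)))"
    by (simp add: algebra_simps)
  also have "\<dots> = (k * \<mu>) * integral {0..b} (\<lambda>x. f (\<theta> x)) - (k * \<epsilon>) * integral {0..b} (\<lambda>x. J x * f (\<theta> x))"
    using integrable_on_cmult_left[OF int1(1), of "k * \<mu>"] integrable_on_cmult_left[OF int2(1), of "k * \<epsilon>"]
    by (subst integral_diff) auto
  finally have bal: "\<mu> * integral {0..b} (\<lambda>x. f (\<theta> x)) = \<epsilon> * integral {0..b} (\<lambda>x. J x * f (\<theta> x))"
    using k by (simp add: mult.assoc)
  obtain N where N: "countable N" "\<And>x. x \<in> {0<..<b} - N \<Longrightarrow> (\<theta> has_real_derivative s + k * (\<mu> - \<epsilon> * J x) * f (\<theta> x)) (at x)"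
    using pruefer_deriv[OF P(1)] by blast
  have near: "\<bar>\<theta> x - s * x\<bar> \<le> k * \<epsilon> * b" if x: "x \<in> {0..b}" for x
  proof -
    have "\<bar>(\<theta> x - s * x) - (\<theta> 0 - s * 0)\<bar> \<le> k * \<epsilon> * (x - 0)"
    proof (rule lipschitz_of_bounded_deriv_off_countable[where f="\<lambda>x. \<theta> x - s * x" and a=0 and b=b, OF _ N(1)])
      show "continuous_on {0..b} (\<lambda>x. \<theta> x - s * x)" by (intro continuous_intros pruefer_cont[OF P(1)])
      fix t assume t: "t \<in> {0<..<b} - N"
      have "((\<lambda>x. \<theta> x - s * x) has_real_derivative (s + k * (\<mu> - \<epsilon> * J t) * f (\<theta> t)) - s) (at t)"
        by (intro DERIV_diff N(2)[OF t]) (auto intro!: derivative_eq_intros)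
      moreover have "\<bar>(s + k * (\<mu> - \<epsilon> * J t) * f (\<theta> t)) - s\<bar> \<le> k * \<epsilon>"
      proof -
        have "\<bar>\<mu> - \<epsilon> * J t\<bar> \<le> \<epsilon>" using J\<epsilon>[of t] t \<mu> by auto
        hence "\<bar>\<mu> - \<epsilon> * J t\<bar> * f (\<theta> t) \<le> \<epsilon> * 1" using \<epsilon> f_le_1 by (intro mult_mono) auto
        thus ?thesis using k by (simp add: abs_mult mult.assoc)
      qed
      ultimately show "\<exists>d. ((\<lambda>x. \<theta> x - s * x) has_real_derivative d) (at t) \<and> \<bar>d\<bar> \<le> k * \<epsilon>" by blast
    qed (use x in auto)
    also have "k * \<epsilon> * (x - 0) \<le> k * \<epsilon> * b" using k \<epsilon> x by (intro mult_left_mono) auto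
    finally show ?thesis by (simp add: pruefer_0[OF P(1)])
  qed
  define K where "K = p * (k * \<epsilon> * b)"
  have fnear: "\<bar>f (\<theta> x) - f (s * x)\<bar> \<le> K" if x: "x \<in> {0..b}" for x
  proof -
    have "\<bar>f (\<theta> x) - f (s * x)\<bar> \<le> p * \<bar>\<theta> x - s * x\<bar>" by (rule f_lipschitz)
    also have "\<dots> \<le> K" unfolding K_def using near[OF x] p_gt_1 by (intro mult_left_mono) auto
    finally show ?thesis .
  qed
  have K0: "K \<ge> 0" using k \<epsilon> b0 p_gt_1 by (simp add: K_def)
  have I1: "\<bar>integral {0..b} (\<lambda>x. f (\<theta> x)) - integral {0..b} (\<lambda>x. f (s * x))\<bar> \<le> K * b"
  proof -
    have "integral {0..b} (\<lambda>x. f (\<theta> x)) - integral {0..b} (\<lambda>x. f (s * x)) = integral {0..b} (\<lambda>x. f (\<theta> x) - f (s * x))"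
      by (rule integral_diff[symmetric, OF int1])
    moreover have "norm (integral {0..b} (\<lambda>x. f (\<theta> x) - f (s * x))) \<le> integral {0..b} (\<lambda>x. K)"
      using fnear int1 by (intro integral_norm_bound_integral integrable_diff integrable_const_ivl) auto
    ultimately show ?thesis using b0 by (simp add: mult.commute)
  qed
  have I2: "\<bar>integral {0..b} (\<lambda>x. J x * f (\<theta> x)) - integral {0..b} (\<lambda>x. J x * f (s * x))\<bar> \<le> K * b"
  proof -
    have "integral {0..b} (\<lambda>x. J x * f (\<theta> x)) - integral {0..b} (\<lambda>x. J x * f (s * x)) = integral {0..b} (\<lambda>x. J x * f (\<theta> x) - J x * f (s * x))"
      by (rule integral_diff[symmetric, OF int2])
    moreover have "norm (integral {0..b} (\<lambda>x. J x * f (\<theta> x) - J x * f (s * x))) \<le> integral {0..b} (\<lambda>x. K)"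
    proof (intro integral_norm_bound_integral integrable_diff integrable_const_ivl int2)
      fix x assume x: "x \<in> {0..b}"
      have "norm (J x * f (\<theta> x) - J x * f (s * x)) = \<bar>J x\<bar> * \<bar>f (\<theta> x) - f (s * x)\<bar>"
        by (simp add: right_diff_distrib[symmetric] abs_mult)
      also have "\<dots> \<le> 1 * K" using J(2)[OF x] fnear[OF x] by (intro mult_mono) auto
      finally show "norm (J x * f (\<theta> x) - J x * f (s * x)) \<le> K" by simp
    qed
    ultimately show ?thesis using b0 by (simp add: mult.commute)
  qed
  have "\<bar>\<mu> * integral {0..b} (\<lambda>x. f (s * x)) - \<epsilon> * integral {0..b} (\<lambda>x. J x * f (s * x))\<bar> =
     \<bar>\<epsilon> * (integral {0..b} (\<lambda>x. J x * f (\<theta> x)) - integral {0..b} (\<lambda>x. J x * f (s * x)))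
       - \<mu> * (integral {0..b} (\<lambda>x. f (\<theta> x)) - integral {0..b} (\<lambda>x. f (s * x)))\<bar>"
    using bal by (simp add: algebra_simps)
  also have "\<dots> \<le> \<bar>\<epsilon> * (integral {0..b} (\<lambda>x. J x * f (\<theta> x)) - integral {0..b} (\<lambda>x. J x * f (s * x)))\<bar>
       + \<bar>\<mu> * (integral {0..b} (\<lambda>x. f (\<theta> x)) - integral {0..b} (\<lambda>x. f (s * x)))\<bar>" by (rule abs_triangle_ineq4)
  also have "\<dots> \<le> \<epsilon> * (K * b) + \<epsilon> * (K * b)"
    unfolding abs_mult using I1 I2 \<mu> \<epsilon> K0 b0 by (intro add_mono mult_mono) auto
  also have "\<dots> = 2 * p * s powr (1 - p) * b * b * \<epsilon> * \<epsilon>" by (simp add: K_def k_def)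
  finally show ?thesis using that[of \<mu> \<theta>] P unfolding co by blast
qed

text \<open>To first order in \<epsilon> each eigenvalue moves by the mean of \<open>J\<close> with
  weight \<open>f (s * x)\<close>. The hypothesis says that this mean is smaller for the second
  eigenvalue, so the gap shrinks linearly with an error of order
  \<open>\<epsilon> * \<epsilon>\<close>.\<close>

lemma small_gap:
  assumes J: "admissible b J" "\<And>x. x \<in> {0..b} \<Longrightarrow> 0 \<le> J x \<and> J x \<le> 1"
    and less: "integral {0..b} (\<lambda>x. J x * f (2 * x)) / integral {0..b} (\<lambda>x. f (2 * x))
      < integral {0..b} (\<lambda>x. J x * f (1 * x)) / integral {0..b} (\<lambda>x. f (1 * x))"
    and I1: "integral {0..b} (\<lambda>x. f (1 * x)) > 0" and I2: "integral {0..b} (\<lambda>x. f (2 * x)) > 0"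
  obtains \<epsilon> lam1 lam2 where "\<epsilon> > 0" "nth_dirichlet_eigenvalue p b (\<lambda>x. \<epsilon> * J x) 1 lam1"
    "nth_dirichlet_eigenvalue p b (\<lambda>x. \<epsilon> * J x) 2 lam2" "lam2 - lam1 < 2 powr p - 1"
proof -
  have b0: "b > 0" by (rule b_pos)
  define i1 where "i1 = integral {0..b} (\<lambda>x. f (1 * x))"
  define i2 where "i2 = integral {0..b} (\<lambda>x. f (2 * x))"
  define A1 where "A1 = integral {0..b} (\<lambda>x. J x * f (1 * x))"
  define A2 where "A2 = integral {0..b} (\<lambda>x. J x * f (2 * x))"
  define C1 where "C1 = 2 * p * 1 powr (1 - p) * b * b"
  define C2 where "C2 = 2 * p * 2 powr (1 - p) * b * b"
  have i: "i1 > 0" "i2 > 0" using I1 I2 by (auto simp: i1_def i2_def)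
  define r where "r = A1 / i1 - A2 / i2"
  have r: "r > 0" using less by (simp add: r_def i1_def i2_def A1_def A2_def)
  define K where "K = C1 / i1 + C2 / i2"
  have K: "K > 0" unfolding K_def C1_def C2_def using i p_gt_1 b0 by (intro add_pos_pos divide_pos_pos mult_pos_pos) auto
  \<comment> \<open>With linear gain \<open>r\<close> and quadratic constant \<open>K\<close>, this
    choice leaves \<open>\<epsilon> * K = r / 2 < r\<close>.\<close>
  define \<epsilon> where "\<epsilon> = r / (2 * K)"
  have \<epsilon>: "\<epsilon> > 0" using r K by (simp add: \<epsilon>_def)
  have adm: "admissible b (\<lambda>x. \<epsilon> * J x)" using admissible_affine[OF J(1), of \<epsilon> 0] by simp
  obtain \<mu>1 \<theta>1 where 1: "pruefer 1 (coef 1 (1 powr p + \<mu>1) (\<lambda>x. \<epsilon> * J x)) b \<theta>1" "\<theta>1 b = 1 * b" "\<bar>\<mu>1 * i1 - \<epsilon> * A1\<bar> \<le> C1 * \<epsilon> * \<epsilon>"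
    by (rule perturbed_eigenvalue[OF zero_less_one J less_imp_le[OF \<epsilon>]])
       (assumption, rule that, assumption, assumption, simp only: i1_def A1_def C1_def)
  obtain \<mu>2 \<theta>2 where 2: "pruefer 2 (coef 2 (2 powr p + \<mu>2) (\<lambda>x. \<epsilon> * J x)) b \<theta>2" "\<theta>2 b = 2 * b" "\<bar>\<mu>2 * i2 - \<epsilon> * A2\<bar> \<le> C2 * \<epsilon> * \<epsilon>"
    by (rule perturbed_eigenvalue[OF zero_less_numeral J less_imp_le[OF \<epsilon>]])
       (assumption, rule that, assumption, assumption, simp only: i2_def A2_def C2_def)
  have n1: "nth_dirichlet_eigenvalue p b (\<lambda>x. \<epsilon> * J x) 1 (1 powr p + \<mu>1)"
    by (subst nth_eigenvalue_iff[OF adm, of 1]) (use 1 in auto)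
  have n2: "nth_dirichlet_eigenvalue p b (\<lambda>x. \<epsilon> * J x) 2 (2 powr p + \<mu>2)"
    by (subst nth_eigenvalue_iff[OF adm, of 2]) (use 2 in auto)
  have "\<mu>1 * i1 \<ge> \<epsilon> * A1 - C1 * \<epsilon> * \<epsilon>" using 1(3) by (auto simp: abs_le_iff)
  hence m1: "\<mu>1 \<ge> \<epsilon> * (A1 / i1) - \<epsilon> * \<epsilon> * (C1 / i1)" using i by (simp add: field_simps)
  have "\<mu>2 * i2 \<le> \<epsilon> * A2 + C2 * \<epsilon> * \<epsilon>" using 2(3) by (auto simp: abs_le_iff)
  hence m2: "\<mu>2 \<le> \<epsilon> * (A2 / i2) + \<epsilon> * \<epsilon> * (C2 / i2)" using i by (simp add: field_simps)
  have "\<mu>2 - \<mu>1 \<le> \<epsilon> * (\<epsilon> * K - r)" using m1 m2 by (simp add: K_def r_def algebra_simps)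
  also have "\<epsilon> * K - r < 0" using K r by (simp add: \<epsilon>_def)
  hence "\<epsilon> * (\<epsilon> * K - r) < 0" using \<epsilon> by (simp add: mult_pos_neg)
  finally have "(2 powr p + \<mu>2) - (1 powr p + \<mu>1) < 2 powr p - 1" by simp
  thus ?thesis using that[OF \<epsilon> n1 n2] by blast
qed

text \<open>After division by \<open>F s b\<close> this is the mass to the left of \<open>x\<close>
  of the p-th power of the eigenfunction \<open>S (s t)\<close> of the zero potential, for
  \<open>s = 1\<close> and \<open>s = 2\<close>.\<close>

definition F :: "real \<Rightarrow> real \<Rightarrow> real" where "F s x = integral {0..x} (\<lambda>t. f (s * t))"

lemma F_deriv: assumes "0 < x" "x < b" shows "(F s has_real_derivative f (s * x)) (at x)"
proof -
  have "(F s has_real_derivative f (s * x)) (at x within {0..b})"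
    unfolding F_def using assms by (intro integral_has_real_derivative continuous_intros) auto
  thus ?thesis using assms by (simp add: at_within_Icc_at)
qed

lemma F_cont: "continuous_on {0..b} (F s)"
  unfolding F_def by (intro indefinite_integral_continuous_1 integrable_continuous_real continuous_intros)

lemma F_0 [simp]: "F s 0 = 0" by (simp add: F_def)

lemma F_reflect: assumes s: "s = of_int n" and x: "x \<in> {0..b}" shows "F s x + F s (b - x) = F s b"
proof -
  have "F s x + F s (b - x) = F s 0 + F s (b - 0)"
  proof (rule const_of_zero_deriv_off_countable[OF _ countable_empty _ x])
    show "continuous_on {0..b} (\<lambda>x. F s x + F s (b - x))"
      by (intro continuous_intros F_cont continuous_on_compose2[OF F_cont]) auto
    fix t assume t: "t \<in> {0<..<b} - {}"
    have "((\<lambda>x. F s (b - x)) has_real_derivative f (s * (b - t)) * (- 1)) (at t)"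
      using t by (intro DERIV_chain2[OF F_deriv]) (auto intro!: derivative_eq_intros)
    moreover have "f (s * (b - t)) = f (s * t)" using f_reflect[of n "s * t"] by (simp add: s algebra_simps)
    ultimately show "((\<lambda>x. F s x + F s (b - x)) has_real_derivative 0) (at t)"
      using DERIV_add[OF F_deriv[of t s]] t by fastforce
  qed
  thus ?thesis by simp
qed

lemma F_pos: assumes "s > 0" shows "F s b > 0"
proof -
  have b0: "b > 0" by (rule b_pos)
  have ne: "F s b \<ge> 0" unfolding F_def by (rule integral_nonneg) (auto intro!: integrable_continuous_real continuous_intros)
  moreover have "F s b \<noteq> 0"
  proof
    assume "F s b = 0"
    moreover have "continuous_on {0..b} (\<lambda>t. f (s * t))" by (intro continuous_intros)
    ultimately have z: "f (s * x) = 0" if "x \<in> {0..b}" for x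
      using integral_eq_0_iff[of 0 b "\<lambda>t. f (s * t)"] that b0 unfolding F_def by auto
    define x where "x = min b (b / (2 * s))"
    have x: "0 < x" "x \<le> b" "s * x < b"
    proof -
      show "0 < x" "x \<le> b" using b0 assms by (auto simp: x_def)
      have "s * x \<le> s * (b / (2 * s))" using assms by (intro mult_left_mono) (auto simp: x_def)
      also have "\<dots> < b" using assms b0 by simp
      finally show "s * x < b" .
    qed
    have "f (s * x) > 0" using x assms by (intro f_pos) auto
    thus False using z[of x] x by auto
  qed
  ultimately show ?thesis by simp
qed

text \<open>By symmetry both normalised masses equal \<open>1/2\<close> at the midpoint. There the
  density of the second vanishes while that of the first is positive, so just to the left of the
  midpoint the second mass is the larger one.\<close>

lemma jump_position:
  assumes "a < b / 2"
  obtains c where "a < c" "0 < c" "c < b / 2" "F 1 c / F 1 b < F 2 c / F 2 b"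
proof -
  have b0: "b > 0" by (rule b_pos)
  define H where "H x = F 2 x / F 2 b - F 1 x / F 1 b" for x
  have d: "(H has_real_derivative f (2 * (b / 2)) / F 2 b - f (1 * (b / 2)) / F 1 b) (at (b / 2))"
    unfolding H_def[abs_def] using b0 by (intro DERIV_diff DERIV_cdivide F_deriv) auto
  have "f (2 * (b / 2)) = 0" using f_mult_b[of 1] by simp
  hence neg: "f (2 * (b / 2)) / F 2 b - f (1 * (b / 2)) / F 1 b < 0" using F_pos[of 1] by simp
  obtain e where e: "e > 0" "\<And>h. h > 0 \<Longrightarrow> h < e \<Longrightarrow> H (b / 2) < H (b / 2 - h)"
    using DERIV_neg_dec_left[OF d neg] by blast
  have half: "F s (b / 2) = F s b / 2" if "s = of_int n" for s n
    using F_reflect[OF that, of "b / 2"] b0 by simp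
  have h1: "F 1 (b / 2) = F 1 b / 2" by (rule half[of 1 1]) simp
  have h2: "F 2 (b / 2) = F 2 b / 2" by (rule half[of 2 2]) simp
  have H0: "H (b / 2) = 0" unfolding H_def h1 h2 using F_pos[of 1] F_pos[of 2] by simp
  define h where "h = min (e / 2) ((b / 2 - max a 0) / 2)"
  have "h \<le> (b / 2 - max a 0) / 2" unfolding h_def by (rule min.cobounded2)
  moreover have "h > 0" "h < e" using e assms b0 by (auto simp: h_def)
  ultimately show ?thesis using e(2)[of h] H0 assms b0
    by (intro that[of "b / 2 - h"]) (auto simp: H_def)
qed

lemma integral_upper_jump:
  assumes c: "0 < c" "c < b"
  shows "integral {0..b} (\<lambda>x. (if c < x then 1 else 0) * f (s * x)) = F s b - F s c"
proof -
  define G where "G x = (if x \<le> c then 0 else F s x - F s c)" for x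
  have "((\<lambda>x. (if c < x then 1 else 0) * f (s * x)) has_integral G b - G 0) {0..b}"
  proof (rule fundamental_theorem_of_calculus_interior_strong[of "{c}"])
    have "continuous_on ({0..c} \<union> {c..b}) G" unfolding G_def
      using c by (intro continuous_on_cases) (auto intro!: continuous_intros continuous_on_subset[OF F_cont])
    moreover have "{0..c} \<union> {c..b} = {0..b}" using c by auto
    ultimately show "continuous_on {0..b} G" by simp
    fix x assume x: "x \<in> {0<..<b} - {c}"
    show "(G has_vector_derivative (if c < x then 1 else 0) * f (s * x)) (at x)"
    proof (cases "c < x")
      case True
      have "((\<lambda>x. F s x - F s c) has_real_derivative f (s * x) - 0) (at x)"
        using x by (intro DERIV_diff F_deriv DERIV_const) auto
      moreover have "\<forall>\<^sub>F t in nhds x. G t = F s t - F s c"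
        using eventually_nhds_in_open[of "{c<..}" x] True by (auto elim!: eventually_mono simp: G_def)
      ultimately show ?thesis using True
        by (simp add: DERIV_cong_ev[OF refl _ refl] has_real_derivative_iff_has_vector_derivative[symmetric])
    next
      case False
      have "\<forall>\<^sub>F t in nhds x. G t = 0"
        using eventually_nhds_in_open[of "{..<c}" x] False x by (auto elim!: eventually_mono simp: G_def)
      thus ?thesis using False
        by (simp add: DERIV_cong_ev[OF refl _ refl] has_real_derivative_iff_has_vector_derivative[symmetric])
    qed
  qed (use c in auto)
  thus ?thesis using c by (simp add: integral_unique G_def)
qed

lemma integral_lower_jump:
  assumes c: "0 < c" "c < b"
  shows "integral {0..b} (\<lambda>x. (if x < c then 1 else 0) * f (s * x)) = F s c"
proof -
  have i: "(\<lambda>x. (if c < x then 1 else 0) * f (s * x)) integrable_on {0..b}"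
    using b_pos by (intro admissible_mult_integrable[where c=b] admissible_step[of c _ 0 b 1] continuous_intros) auto
  have i': "(\<lambda>x. f (s * x)) integrable_on {0..b}" by (intro integrable_continuous_real continuous_intros)
  have "integral {0..b} (\<lambda>x. (if x < c then 1 else 0) * f (s * x)) =
     integral {0..b} (\<lambda>x. f (s * x) - (if c < x then 1 else 0) * f (s * x))"
    by (rule integral_spike[of "{c}"]) auto
  also have "\<dots> = F s b - (F s b - F s c)"
    using integral_upper_jump[OF c] by (subst integral_diff[OF i' i]) (simp add: F_def)
  finally show ?thesis by simp
qed

text \<open>An upward step at \<open>c\<close> with \<open>a < c < b / 2\<close> is constant on
  \<open>{0..a}\<close> and increasing on \<open>{a..b}\<close>, so its transition point may be
  declared to be \<open>a\<close>. Near the middle the second eigenfunction is small, so the part of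
  the step left of \<open>b / 2\<close> raises the first eigenvalue more than the second.\<close>

lemma small_gap_exists:
  assumes a: "a \<in> {0..b}" "a \<noteq> b / 2"
  shows "\<exists>q lam1 lam2. q absolutely_integrable_on {0<..<b} \<and> single_well b a q \<and>
     nth_dirichlet_eigenvalue p b q 1 lam1 \<and> nth_dirichlet_eigenvalue p b q 2 lam2 \<and> lam2 - lam1 < 2 powr p - 1"
proof -
  have b0: "b > 0" by (rule b_pos)
  have Fb: "integral {0..b} (\<lambda>x. f (s * x)) = F s b" for s by (simp add: F_def)
  have main: "\<exists>q lam1 lam2. q absolutely_integrable_on {0<..<b} \<and> single_well b a q \<and>
     nth_dirichlet_eigenvalue p b q 1 lam1 \<and> nth_dirichlet_eigenvalue p b q 2 lam2 \<and> lam2 - lam1 < 2 powr p - 1"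
    if J: "admissible b J" "\<And>x. 0 \<le> J x \<and> J x \<le> 1" and sw: "single_well b a J"
      and less: "integral {0..b} (\<lambda>x. J x * f (2 * x)) / F 2 b < integral {0..b} (\<lambda>x. J x * f (1 * x)) / F 1 b" for J
  proof -
    obtain \<epsilon> lam1 lam2 where *: "\<epsilon> > 0" "nth_dirichlet_eigenvalue p b (\<lambda>x. \<epsilon> * J x) 1 lam1"
      "nth_dirichlet_eigenvalue p b (\<lambda>x. \<epsilon> * J x) 2 lam2" "lam2 - lam1 < 2 powr p - 1"
    proof (rule small_gap[OF J(1) J(2)])
      show "integral {0..b} (\<lambda>x. J x * f (2 * x)) / integral {0..b} (\<lambda>x. f (2 * x))
        < integral {0..b} (\<lambda>x. J x * f (1 * x)) / integral {0..b} (\<lambda>x. f (1 * x))" unfolding Fb by (rule less)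
      show "integral {0..b} (\<lambda>x. f (1 * x)) > 0" "integral {0..b} (\<lambda>x. f (2 * x)) > 0"
        unfolding Fb by (rule F_pos, simp)+
    qed (rule that)
    have "admissible b (\<lambda>x. \<epsilon> * J x)" using admissible_affine[OF J(1), of \<epsilon> 0] by simp
    hence "(\<lambda>x. \<epsilon> * J x) absolutely_integrable_on {0..b}" by (simp add: admissible_def)
    hence "(\<lambda>x. \<epsilon> * J x) absolutely_integrable_on {0<..<b}"
      by (rule set_integrable_subset) auto
    moreover have "single_well b a (\<lambda>x. \<epsilon> * J x)"
      using sw *(1) by (auto simp: single_well_def monotone_on_def mult_left_mono)
    ultimately show ?thesis using *(2-4) by blast
  qed
  show ?thesis
  proof (cases "a < b / 2")
    case True
    obtain c where c: "a < c" "0 < c" "c < b / 2" "F 1 c / F 1 b < F 2 c / F 2 b" by (rule jump_position[OF True])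
    show ?thesis
    proof (rule main[of "\<lambda>x. if c < x then 1 else 0"])
      show "admissible b (\<lambda>x. if c < x then 1 else 0)" by (rule admissible_step[of c _ 0 b 1]) auto
      show "single_well b a (\<lambda>x. if c < x then 1 else 0)"
        using a c by (auto simp: single_well_def monotone_on_def)
      have "0 < c" "c < b" using c b0 by auto
      from integral_upper_jump[OF this]
      show "integral {0..b} (\<lambda>x. (if c < x then 1 else 0) * f (2 * x)) / F 2 b < integral {0..b} (\<lambda>x. (if c < x then 1 else 0) * f (1 * x)) / F 1 b"
        using c(4) F_pos[of 1] F_pos[of 2] by (simp only: diff_divide_distrib) simp
    qed auto
  next
    case False
    hence "b - a < b / 2" using a(2) by auto
    then obtain c where c: "b - a < c" "0 < c" "c < b / 2" "F 1 c / F 1 b < F 2 c / F 2 b" by (rule jump_position)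
    \<comment> \<open>The mirror image of the step: a downward jump at \<open>c'\<close>, which lies
      between \<open>b / 2\<close> and \<open>a\<close>.\<close>
    define c' where "c' = b - c"
    have c': "c' < a" "0 < c'" "c' < b" using c b0 by (auto simp: c'_def)
    have Fc: "F s c' = F s b - F s c" if "s = of_int n" for s n
      using F_reflect[OF that, of c] c b0 by (auto simp: c'_def)
    show ?thesis
    proof (rule main[of "\<lambda>x. if x < c' then 1 else 0"])
      show "admissible b (\<lambda>x. if x < c' then 1 else 0)" by (rule admissible_step[of c' _ 1 b 0]) auto
      show "single_well b a (\<lambda>x. if x < c' then 1 else 0)"
        using a c' by (auto simp: single_well_def monotone_on_def)
      show "integral {0..b} (\<lambda>x. (if x < c' then 1 else 0) * f (2 * x)) / F 2 b < integral {0..b} (\<lambda>x. (if x < c' then 1 else 0) * f (1 * x)) / F 1 b"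
        using c(4) F_pos[of 1] F_pos[of 2] Fc[of 1 1] Fc[of 2 2]
        by (simp only: integral_lower_jump[OF c'(2,3)]) (simp add: diff_divide_distrib)
    qed auto
  qed
qed

end

theorem theorem1p1:
  fixes p :: real
  assumes "p > 1"
  shows "(\<forall>q lam1 lam2.
            q absolutely_integrable_on {0<..<pi_hat p} \<and>
            single_well (pi_hat p) (pi_hat p / 2) q \<and>
            nth_dirichlet_eigenvalue p (pi_hat p) q 1 lam1 \<and>
            nth_dirichlet_eigenvalue p (pi_hat p) q 2 lam2 \<longrightarrow>
              lam2 - lam1 \<ge> 2 powr p - 1 \<and>
              (lam2 - lam1 = 2 powr p - 1 \<longleftrightarrow>
                 (\<exists>c. AE x in lebesgue. x \<in> {0<..<pi_hat p} \<longrightarrow> q x = c))) \<and>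
         (\<forall>a\<in>{0..pi_hat p}. a \<noteq> pi_hat p / 2 \<longrightarrow>
            (\<exists>q lam1 lam2.
               q absolutely_integrable_on {0<..<pi_hat p} \<and>
               single_well (pi_hat p) a q \<and>
               nth_dirichlet_eigenvalue p (pi_hat p) q 1 lam1 \<and>
               nth_dirichlet_eigenvalue p (pi_hat p) q 2 lam2 \<and>
               lam2 - lam1 < 2 powr p - 1))"
proof -
  interpret half_linear p by unfold_locales (rule assms)
  show ?thesis
  proof (intro conjI allI impI ballI)
    fix q lam1 lam2
    assume q: "q absolutely_integrable_on {0<..<b} \<and> single_well b (b / 2) q \<and>
      nth_dirichlet_eigenvalue p b q 1 lam1 \<and> nth_dirichlet_eigenvalue p b q 2 lam2"
    show "lam2 - lam1 \<ge> 2 powr p - 1" using gap_lower_bound[of q lam1 lam2] q by simp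
    show "lam2 - lam1 = 2 powr p - 1 \<longleftrightarrow> (\<exists>c. AE x in lebesgue. x \<in> {0<..<b} \<longrightarrow> q x = c)"
      by (rule gap_eq_iff) (use q in auto)
  qed (rule small_gap_exists)
qed

end
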